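(* Let $n\ge1$, and let $\Delta$, $M_a$, $T_a$, $\Phi$, $\mathcal{F}_t$, $\mathcal{B}_t$ be as defined in the context. Let $t\ge0$, let $\Xi\in\mathcal{F}_t$ be any simplex, and let $\Lambda$ be the simplex of $\mathcal{B}_t$ corresponding to $\Xi$ under the combinatorial isomorphism from $\mathcal{F}_t$ to $\mathcal{B}_t$ that fixes the vertices of $\Delta$. Then $\Phi$ restricts to a homeomorphism between $\Xi$ and $\Lambda$. Moreover, for every $\Delta_{a_0\ldots a_{t-1}}\in\mathcal{F}_t$ we have $$\Phi=(T_{a_{t-1}}\circ\cdots\circ T_{a_0})\circ(\Phi\restriction\Delta_{a_0\ldots a_{t-1}})\circ(M_{a_{t-1}}\circ\cdots\circ M_{a_0})^{-1}.$$
   Context: Fix an integer $n\ge1$ and identify $\mathbb{R}^n$ with the hyperplane $\{x_{n+1}=1\}$ of $\mathbb{R}^{n+1}$. A vector $(\alpha_1,\ldots,\alpha_{n+1})\in\mathbb{R}^{n+1}$ with $\alpha_{n+1}>0$ gives, in projective coordinates, the point $(\alpha_1/\alpha_{n+1},\ldots,\alpha_n/\alpha_{n+1})$ of $\mathbb{R}^n$. Let $V$ be the $(n+1)\times(n+1)$ matrix all of whose entries are $0$, except $V_{ij}=1$ whenever $i=n+1$, or $j\ge2$ and $i+j\le n+2$. Let $\Delta$ be the $n$-simplex whose vertices $v_1,\ldots,v_{n+1}$ are given in projective coordinates by the columns of $V$ (so $\Delta=\{1\ge x_1\ge x_2\ge\cdots\ge x_n\ge0\}$). Let $A_0$ be the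 $(n+1)\times(n+1)$ matrix whose entries are $0$ except for entries $1$ in positions $(1,1)$, $(1,n+1)$, $(2,n+1)$ and $(j+1,j)$ for $2\le j\le n$; let $A_1$ be the same matrix except that the $1$ in position $(1,1)$ is moved to position $(2,1)$. For $a=0,1$ let $\Delta_a$ be the simplex whose vertices are given in projective coordinates by the columns of $VA_a$; one has $\Delta=\Delta_0\cup\Delta_1$. For $a=0,1$ the matrix $M_a=VA_a^{-1}V^{-1}\in\mathrm{GL}_{n+1}(\mathbb{Z})$ induces a fractional-linear homeomorphism, also denoted $M_a$, from $\Delta_a$ to $\Delta$: the projective coordinates of $M_a(x)$ are $M_a(x_1\cdots x_n\,1)^{tr}$. The maps $M_0,M_1$ agree on $\Delta_0\cap\Delta_1$, and the Mönkemeyer map $M:\Delta\to\Delta$ is the continuous map with $M(x)=M_a(x)$ for $x\in\Delta_a$. In affine coordinates, $M(x_1,\ldots,x_n)=\bigl(\frac{x_1}{1-x_n},\frac{x_1-x_n}{1-x_n},\ldots,\frac{x_{n-1}-x_n}{1-x_n}\bigr)$ if $x_1+x_n\le1$ (i.e. on $\Delta_0$), and $M(x_1,\ldots,x_n)=\bigl(\frac{1-x_n}{x_1},\frac{x_1-x_n}{x_1},\ldots,\frac{x_{n-1}-x_n}{x_1}\bigr)$ if $x_1+x_n\ge1$ (i.e. on $\Delta_1$). For $a=0,1$ let $B_a$ be the matrix identical to $A_a$ except that the two $1$'s in the last column are replaced by $1/2$. The matrix $T_a=VB_a^{-1}V^{-1}$ has last row $(0\cdots0\,1)$ and induces an affine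 homeomorphism, also denoted $T_a$, from $\Delta_a$ to $\Delta$, by $T_a(x_1\cdots x_n\,1)^{tr}=(y_1\cdots y_n\,1)^{tr}$. The maps $T_0,T_1$ agree on $\Delta_0\cap\Delta_1$, and the tent map $T:\Delta\to\Delta$ is the continuous map with $T(x)=T_a(x)$ for $x\in\Delta_a$. In affine coordinates, $T(x_1,\ldots,x_n)=(x_1+x_n,x_1-x_n,\ldots,x_{n-1}-x_n)$ if $x_1+x_n\le1$, and $T(x_1,\ldots,x_n)=(2-x_1-x_n,x_1-x_n,\ldots,x_{n-1}-x_n)$ if $x_1+x_n\ge1$. (For $n=1$ only the first coordinate is present in these formulas.) For $a_0,\ldots,a_{t-1}\in\{0,1\}$ let $\Delta_{a_0\ldots a_{t-1}}=\{x\in\Delta:M^i(x)\in\Delta_{a_i}\text{ for }0\le i\le t-1\}$ and $\Gamma_{a_0\ldots a_{t-1}}=\{x\in\Delta:T^i(x)\in\Delta_{a_i}\text{ for }0\le i\le t-1\}$ (both equal to $\Delta$ for $t=0$). These are $n$-simplexes; $\mathcal{F}_t$ (respectively $\mathcal{B}_t$) is the simplicial complex, supported on $\Delta$, consisting of all $\Delta_{a_0\ldots a_{t-1}}$ (respectively all $\Gamma_{a_0\ldots a_{t-1}}$) and all their faces. There is a unique combinatorial isomorphism from $\mathcal{F}_t$ to $\mathcal{B}_t$ that fixes the vertices of $\Delta$; on maximal simplexes it is given by $\Delta_{a_0\ldots a_{t-1}}\mapsto\Gamma_{a_0\ldots a_{t-1}}$. In the displayed formula, $M_{a_{t-1}}\circ\cdots\circ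 M_{a_0}$ is regarded as a homeomorphism from $\Delta_{a_0\ldots a_{t-1}}$ to $\Delta$, and $T_{a_{t-1}}\circ\cdots\circ T_{a_0}$ as a homeomorphism from $\Gamma_{a_0\ldots a_{t-1}}$ to $\Delta$ (both are the identity of $\Delta$ if $t=0$). For an infinite sequence $\bar a=a_0a_1a_2\ldots\in\{0,1\}^{\mathbb{N}}$, let $\varphi(\bar a)$ be the unique point of $\bigcap_{t\ge0}\Delta_{a_0\ldots a_{t-1}}$ and $\upsilon(\bar a)$ the unique point of $\bigcap_{t\ge0}\Gamma_{a_0\ldots a_{t-1}}$. The map $\Phi:\Delta\to\Delta$ is defined by $\Phi(p)=\upsilon(\bar a)$ for any $\bar a$ with $\varphi(\bar a)=p$; this is a well-defined homeomorphism, and it is the unique homeomorphism of $\Delta$ such that $T=\Phi\circ M\circ\Phi^{-1}$. *)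

theory Defs
  imports "HOL-Analysis.Analysis"
begin

text \<open>
  The dimension \<open>n\<close> is \<open>CARD('n)\<close> for a finite, linearly ordered index type \<open>'n\<close>; thus \<open>n \<ge> 1\<close>.
  Matrices of size \<open>n + 1\<close> are indexed by \<open>'n option\<close>: the indices \<open>1, \<dots>, n\<close> are the \<open>Some i\<close>
  in the order of \<open>'n\<close>, and \<open>None\<close> is the index \<open>n + 1\<close>.  Binary digits are booleans, with \<open>True\<close>
  standing for 1.
\<close>

fun pos :: "'n::{finite,linorder} option \<Rightarrow> nat" where
  "pos (Some i) = card {j. j \<le> i}"
| "pos (None :: 'n option) = CARD('n) + 1"

type_synonym 'n sqmat = "real ^ ('n option) ^ ('n option)"

definition homog :: "real ^ 'n::finite \<Rightarrow> real ^ ('n option)" where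
  "homog x = (\<chi> i. case i of None \<Rightarrow> 1 | Some j \<Rightarrow> x $ j)"

definition proj_point :: "real ^ ('n::finite option) \<Rightarrow> real ^ 'n::finite" where
  "proj_point \<alpha> = (\<chi> j. \<alpha> $ Some j / \<alpha> $ None)"

definition column_points :: "('n::finite) sqmat \<Rightarrow> (real ^ 'n::finite) set" where
  "column_points P = range (\<lambda>j. proj_point (column j P))"

definition V_mat :: "('n::{finite,linorder}) sqmat" where
  "V_mat = (\<chi> i j. if pos i = CARD('n) + 1 \<or> (2 \<le> pos j \<and> pos i + pos j \<le> CARD('n) + 2)
                   then 1 else 0)"

definition A_mat :: "bool \<Rightarrow> ('n::{finite,linorder}) sqmat" where
  "A_mat a = (\<chi> i j. if (pos i, pos j) \<in>
       {(if a then 2 else 1, 1), (1, CARD('n) + 1), (2, CARD('n) + 1)}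
         \<union> {(k + 1, k) |k. 2 \<le> k \<and> k \<le> CARD('n)}
     then 1 else 0)"

definition B_mat :: "bool \<Rightarrow> ('n::{finite,linorder}) sqmat" where
  "B_mat a = (\<chi> i j. if pos j = CARD('n) + 1 then A_mat a $ i $ j / 2 else A_mat a $ i $ j)"

definition Delta :: "(real ^ 'n::{finite,linorder}) set" where
  "Delta = convex hull (column_points V_mat)"

definition Delta_half :: "bool \<Rightarrow> (real ^ 'n::{finite,linorder}) set" where
  "Delta_half a = convex hull (column_points (V_mat ** A_mat a))"

definition M_mat :: "bool \<Rightarrow> ('n::{finite,linorder}) sqmat" where
  "M_mat a = V_mat ** matrix_inv (A_mat a) ** matrix_inv V_mat"

definition T_mat :: "bool \<Rightarrow> ('n::{finite,linorder}) sqmat" where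
  "T_mat a = V_mat ** matrix_inv (B_mat a) ** matrix_inv V_mat"

definition M_branch :: "bool \<Rightarrow> real ^ 'n::{finite,linorder} \<Rightarrow> real ^ 'n::{finite,linorder}" where
  "M_branch a x = proj_point (M_mat a *v homog x)"

text \<open>The last row of \<^term>\<open>T_mat a\<close> is \<open>(0 \<dots> 0 1)\<close>, so no normalization is needed here.\<close>

definition T_branch :: "bool \<Rightarrow> real ^ 'n::{finite,linorder} \<Rightarrow> real ^ 'n::{finite,linorder}" where
  "T_branch a x = (\<chi> j. (T_mat a *v homog x) $ Some j)"

text \<open>
  The two branches agree on \<open>Delta_half False \<inter> Delta_half True\<close>; the values outside
  \<^const>\<open>Delta\<close> are irrelevant.
\<close>

definition Moenkemeyer :: "real ^ 'n::{finite,linorder} \<Rightarrow> real ^ 'n::{finite,linorder}" where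
  "Moenkemeyer x = (if x \<in> Delta_half False then M_branch False x else M_branch True x)"

definition tent :: "real ^ 'n::{finite,linorder} \<Rightarrow> real ^ 'n::{finite,linorder}" where
  "tent x = (if x \<in> Delta_half False then T_branch False x else T_branch True x)"

definition Delta_cyl :: "bool list \<Rightarrow> (real ^ 'n::{finite,linorder}) set" where
  "Delta_cyl a = {x \<in> Delta. \<forall>i < length a. (Moenkemeyer ^^ i) x \<in> Delta_half (a ! i)}"

definition Gamma_cyl :: "bool list \<Rightarrow> (real ^ 'n::{finite,linorder}) set" where
  "Gamma_cyl a = {x \<in> Delta. \<forall>i < length a. (tent ^^ i) x \<in> Delta_half (a ! i)}"

text \<open>
  As in \<^const>\<open>simplicial_complex\<close>, the empty set counts as a face of every simplex.
\<close>

definition F_complex :: "nat \<Rightarrow> (real ^ 'n::{finite,linorder}) set set" where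
  "F_complex t = {S. \<exists>a. length a = t \<and> S face_of Delta_cyl a}"

definition B_complex :: "nat \<Rightarrow> (real ^ 'n::{finite,linorder}) set set" where
  "B_complex t = {S. \<exists>a. length a = t \<and> S face_of Gamma_cyl a}"

definition combinatorial_iso ::
  "'a::real_vector set set \<Rightarrow> 'b::real_vector set set \<Rightarrow> ('a set \<Rightarrow> 'b set) \<Rightarrow> bool" where
  "combinatorial_iso K L h \<longleftrightarrow>
     bij_betw h K L \<and> (\<forall>S\<in>K. \<forall>S'\<in>K. S face_of S' \<longleftrightarrow> h S face_of h S')"

text \<open>
  Extensionality only fixes the values outside the domain \<^term>\<open>F_complex t\<close>, so that the
  isomorphism is unique as a HOL function.
\<close>

definition canonical_iso ::
  "nat \<Rightarrow> (real ^ 'n::{finite,linorder}) set \<Rightarrow> (real ^ 'n::{finite,linorder}) set" where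
  "canonical_iso t = (THE h. h \<in> extensional (F_complex t) \<and>
     combinatorial_iso (F_complex t) (B_complex t) h \<and>
     (\<forall>v \<in> column_points V_mat. h {v} = {v}))"

text \<open>\<open>M_word [a\<^sub>0, \<dots>, a\<^sub>t\<^sub>-\<^sub>1]\<close> is \<open>M_branch a\<^sub>t\<^sub>-\<^sub>1 \<circ> \<dots> \<circ> M_branch a\<^sub>0\<close> on its cylinder; likewise \<open>T_word\<close>.\<close>

definition M_word :: "bool list \<Rightarrow> real ^ 'n::{finite,linorder} \<Rightarrow> real ^ 'n::{finite,linorder}" where
  "M_word a = restrict (fold (\<lambda>b f. M_branch b \<circ> f) a id) (Delta_cyl a)"

definition T_word :: "bool list \<Rightarrow> real ^ 'n::{finite,linorder} \<Rightarrow> real ^ 'n::{finite,linorder}" where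
  "T_word a = restrict (fold (\<lambda>b f. T_branch b \<circ> f) a id) (Gamma_cyl a)"

definition phi :: "(nat \<Rightarrow> bool) \<Rightarrow> real ^ 'n::{finite,linorder}" where
  "phi a = (THE p. p \<in> (\<Inter>t. Delta_cyl (map a [0..<t])))"

definition upsilon :: "(nat \<Rightarrow> bool) \<Rightarrow> real ^ 'n::{finite,linorder}" where
  "upsilon a = (THE p. p \<in> (\<Inter>t. Gamma_cyl (map a [0..<t])))"

text \<open>The value does not depend on the choice of the symbolic sequence \<open>a\<close>.\<close>

definition Phi :: "real ^ 'n::{finite,linorder} \<Rightarrow> real ^ 'n::{finite,linorder}" where
  "Phi p = upsilon (SOME a. phi a = p)"

end

theory Submission
  imports Defs
begin

text \<open>
  In barycentric coordinates both maps fold the simplex along the same combinatorial pattern; only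
  the weight \<open>\<kappa>\<close> of the new vertex on the bisected edge differs.  Hence carriers of points, and the
  gluing of cylinders along faces, are transported from one map to the other.  Cylinders shrink to
  points: vertex coordinates are averaged along bisected edges, and as long as the weights are
  bounded away from \<open>0\<close> any splitting of the vertices into low and high ones dies out in boundedly
  many steps; for the Moenkemeyer map the weights are bounded after every digit 1, and a tail of
  digits 0 is computed explicitly.  So matching itineraries defines \<open>\<Phi>\<close>, which satisfies the
  functional equation and maps each simplex of the first complex onto one of the second.  The
  resulting isomorphism is the canonical one, because an automorphism fixing the vertices of \<open>\<Delta>\<close>
  is the identity.
\<close>

subsection \<open>Barycentric coordinates and the branches\<close>

text \<open>The weight \<open>\<kappa>\<close> enters an inverse branch only as a positive factor,
  so the digits alone decide which barycentric coordinates of an image vanish. Hence the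
  combinatorial facts hold for every \<open>\<kappa> > 0\<close>, and only convergence singles out
  the values 1 and 2. The obstacle is convergence for \<open>\<kappa> = 1\<close>. Edges are cut at
  mediants, and along a run of digits 0 the denominator of vertex 0 stays fixed while the others
  grow, so no single step contracts by a uniform factor. The depth needed is therefore found
  separately for each itinerary. For \<open>\<kappa> = 2\<close> it depends on the precision only,
  and this uniformity on the target side is what yields continuity of \<Phi>; continuity of the
  inverse then follows from compactness. Since \<open>canonical_iso\<close> is a definite
  description, exhibiting an isomorphism does not suffice. A second candidate, composed with the
  inverse conjugacy, becomes an automorphism of a single complex, so that rigidity is needed only
  for one complex at a time.\<close>

text \<open>
  The vertices \<open>v\<^sub>1, \<dots>, v\<^sub>n\<^sub>+\<^sub>1\<close> of the paper are \<open>v 0, \<dots>, v n\<close> here; \<open>bc x k\<close> is the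
  barycentric coordinate of \<open>x\<close> belonging to \<open>v k\<close>.
\<close>

locale barycentric =
  fixes n :: nat and v :: "nat \<Rightarrow> 'a::euclidean_space" and bc :: "'a \<Rightarrow> nat \<Rightarrow> real"
  assumes n_pos: "1 \<le> n"
    and bc_sum: "(\<Sum>k\<le>n. bc x k) = 1"
    and bc_reconstruct: "(\<Sum>k\<le>n. bc x k *\<^sub>R v k) = x"
    and bc_comb: "(\<Sum>k\<le>n. c k) = 1 \<Longrightarrow> j \<le> n \<Longrightarrow> bc (\<Sum>k\<le>n. c k *\<^sub>R v k) j = c j"
    and bc_cont: "continuous_on UNIV (\<lambda>x. bc x k)"
begin

definition pt :: "(nat \<Rightarrow> real) \<Rightarrow> 'a" where
  "pt c = (1 / (\<Sum>k\<le>n. c k)) *\<^sub>R (\<Sum>k\<le>n. c k *\<^sub>R v k)"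

lemma bc_pt:
  assumes "(\<Sum>k\<le>n. c k) \<noteq> 0" "j \<le> n"
  shows "bc (pt c) j = c j / (\<Sum>k\<le>n. c k)"
proof -
  have "pt c = (\<Sum>k\<le>n. (c k / (\<Sum>k\<le>n. c k)) *\<^sub>R v k)"
    by (simp add: pt_def scaleR_sum_right)
  moreover have "(\<Sum>k\<le>n. c k / (\<Sum>k\<le>n. c k)) = 1"
    using assms by (simp flip: sum_divide_distrib)
  ultimately show ?thesis using bc_comb[OF _ assms(2)] by metis
qed

lemma pt_bc [simp]: "pt (bc x) = x"
  by (simp add: pt_def bc_sum bc_reconstruct)

lemma pt_cong: "(\<And>k. k \<le> n \<Longrightarrow> c k = d k) \<Longrightarrow> pt c = pt d"
  by (simp add: pt_def)

lemma pt_scale: "r \<noteq> 0 \<Longrightarrow> pt (\<lambda>k. r * c k) = pt c"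
proof -
  assume "r \<noteq> 0"
  have "(\<Sum>k\<le>n. (r * c k) *\<^sub>R v k) = r *\<^sub>R (\<Sum>k\<le>n. c k *\<^sub>R v k)"
    by (simp add: scaleR_sum_right)
  with \<open>r \<noteq> 0\<close> show ?thesis by (simp add: pt_def flip: sum_distrib_left)
qed

lemma pt_divide: "r \<noteq> 0 \<Longrightarrow> pt (\<lambda>k. c k / r) = pt c"
  using pt_scale[of "1 / r" c] by simp

lemma bc_eqI: "(\<And>k. k \<le> n \<Longrightarrow> bc x k = bc y k) \<Longrightarrow> x = y"
  by (metis pt_bc pt_cong)

lemma bc_vertex: "k \<le> n \<Longrightarrow> j \<le> n \<Longrightarrow> bc (v k) j = (if j = k then 1 else 0)"
proof -
  assume "k \<le> n" "j \<le> n"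
  then have "(\<Sum>i\<le>n. (if i = k then 1 else 0) *\<^sub>R v i) = v k"
    by (simp add: if_distrib[of "\<lambda>r. r *\<^sub>R _"] cong: if_cong)
  with bc_comb[of "\<lambda>i. if i = k then 1 else 0" j] \<open>k \<le> n\<close> \<open>j \<le> n\<close> show ?thesis by simp
qed

lemma bc_convex_comb:
  assumes "j \<le> n"
  shows "bc ((1 - u) *\<^sub>R x + u *\<^sub>R y) j = (1 - u) * bc x j + u * bc y j"
proof -
  have "(1 - u) *\<^sub>R x + u *\<^sub>R y =
      (1 - u) *\<^sub>R (\<Sum>k\<le>n. bc x k *\<^sub>R v k) + u *\<^sub>R (\<Sum>k\<le>n. bc y k *\<^sub>R v k)"
    by (simp add: bc_reconstruct)
  also have "\<dots> = (\<Sum>k\<le>n. ((1 - u) * bc x k + u * bc y k) *\<^sub>R v k)"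
    by (simp add: scaleR_sum_right scaleR_add_left sum.distrib)
  finally have "bc ((1 - u) *\<^sub>R x + u *\<^sub>R y) j =
      bc (\<Sum>k\<le>n. ((1 - u) * bc x k + u * bc y k) *\<^sub>R v k) j" by simp
  also have "\<dots> = (1 - u) * bc x j + u * bc y j"
    using assms by (intro bc_comb) (simp_all add: sum.distrib bc_sum flip: sum_distrib_left)
  finally show ?thesis .
qed

section \<open>The simplex as the set of points with nonnegative barycentric coordinates\<close>

definition base_simplex :: "'a set" where
  "base_simplex = {x. \<forall>k\<le>n. 0 \<le> bc x k}"

lemma bc_nonneg: "x \<in> base_simplex \<Longrightarrow> k \<le> n \<Longrightarrow> 0 \<le> bc x k"
  by (simp add: base_simplex_def)

lemma bc_le_1: "x \<in> base_simplex \<Longrightarrow> k \<le> n \<Longrightarrow> bc x k \<le> 1"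
  using member_le_sum[of k "{..n}" "bc x"] by (simp add: bc_sum base_simplex_def)

lemma bc_pt_simplex:
  assumes "\<And>k. k \<le> n \<Longrightarrow> 0 \<le> c k" "0 < (\<Sum>k\<le>n. c k)"
  shows "pt c \<in> base_simplex"
  using assms by (simp add: base_simplex_def bc_pt)

lemma vertex_in_simplex: "k \<le> n \<Longrightarrow> v k \<in> base_simplex"
  by (simp add: base_simplex_def bc_vertex)

lemma vertex_inj: "i \<le> n \<Longrightarrow> k \<le> n \<Longrightarrow> v i = v k \<longleftrightarrow> i = k"
  using bc_vertex[of i i] bc_vertex[of k i] by (auto split: if_splits)

lemma closed_simplex: "closed base_simplex"
proof -
  have "base_simplex = (\<Inter>k\<in>{..n}. {x. 0 \<le> bc x k})"
    by (auto simp: base_simplex_def)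
  moreover have "closed {x. 0 \<le> bc x k}" for k
    by (intro closed_Collect_le continuous_intros bc_cont)
  ultimately show ?thesis by auto
qed

lemma dist_le_bc:
  assumes "\<And>k. k \<le> n \<Longrightarrow> \<bar>bc x k - bc y k\<bar> \<le> e"
  shows "dist x y \<le> e * (\<Sum>k\<le>n. norm (v k))"
proof -
  have "x - y = (\<Sum>k\<le>n. (bc x k - bc y k) *\<^sub>R v k)"
    by (simp add: scaleR_diff_left sum_subtractf bc_reconstruct)
  then have "dist x y \<le> (\<Sum>k\<le>n. \<bar>bc x k - bc y k\<bar> * norm (v k))"
    by (auto simp: dist_norm intro: order_trans[OF norm_sum])
  also have "\<dots> \<le> (\<Sum>k\<le>n. e * norm (v k))"
    using assms by (intro sum_mono mult_right_mono) auto
  finally show ?thesis by (simp add: sum_distrib_left)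
qed

lemma bounded_simplex: "bounded base_simplex"
proof -
  have "dist (v 0) x \<le> 1 * (\<Sum>k\<le>n. norm (v k))" if "x \<in> base_simplex" for x
  proof (rule dist_le_bc)
    show "\<bar>bc (v 0) k - bc x k\<bar> \<le> 1" if "k \<le> n" for k
      using bc_nonneg[OF \<open>x \<in> base_simplex\<close> that] bc_le_1[OF \<open>x \<in> base_simplex\<close> that] that
      by (auto simp: bc_vertex)
  qed
  then show ?thesis unfolding bounded_def by blast
qed

lemma compact_simplex: "compact base_simplex"
  using closed_simplex bounded_simplex by (simp add: compact_eq_bounded_closed)

lemma convex_simplex: "convex base_simplex"
  by (auto simp: convex_alt base_simplex_def bc_convex_comb)

lemma simplex_hull: "convex hull (v ` {..n}) = base_simplex"
proof (rule hull_unique)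
  show "v ` {..n} \<subseteq> base_simplex" using vertex_in_simplex by auto
  show "convex base_simplex" by (rule convex_simplex)
  fix S assume S: "v ` {..n} \<subseteq> S" "convex S"
  show "base_simplex \<subseteq> S"
  proof
    fix x assume "x \<in> base_simplex"
    then have "(\<Sum>k\<le>n. bc x k *\<^sub>R v k) \<in> S"
      using S by (intro convex_sum) (auto simp: bc_sum base_simplex_def)
    then show "x \<in> S" by (simp add: bc_reconstruct)
  qed
qed

section \<open>The two halves and the weighted bisection\<close>

definition hi :: "bool \<Rightarrow> nat" where "hi a = (if a then 1 else 0)"
definition lo :: "bool \<Rightarrow> nat" where "lo a = (if a then 0 else 1)"

lemma hi_lo_le [simp]: "hi a \<le> n" "lo a \<le> n"
  using n_pos by (auto simp: hi_def lo_def)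

text \<open>The cut runs through the midpoint of the edge \<open>v 0\<close>, \<open>v 1\<close> and
  the remaining vertices, and \<open>half a\<close> is the side of \<open>v (hi a)\<close>. It does
  not depend on \<open>\<kappa>\<close>: both maps fold along the same wall.\<close>

definition half :: "bool \<Rightarrow> 'a set" where
  "half a = {x \<in> base_simplex. bc x (lo a) \<le> bc x (hi a)}"

text \<open>
  Both algorithms replace the edge \<open>v 0, v 1\<close> by its weighted midpoint: in unnormalised barycentric
  coordinates \<open>fwd 1\<close> is the matrix \<open>A\<^sub>a\<^sup>-\<^sup>1\<close> and \<open>fwd 2\<close> is \<open>B\<^sub>a\<^sup>-\<^sup>1\<close>.  Thus \<open>\<kappa> = 1\<close> gives the
  Moenkemeyer map and \<open>\<kappa> = 2\<close> the tent map.  The transpose \<open>vertex_step\<close> of \<open>bwd\<close> acts on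
  quantities attached to the vertices of a cylinder.
\<close>

definition fwd :: "real \<Rightarrow> bool \<Rightarrow> (nat \<Rightarrow> real) \<Rightarrow> nat \<Rightarrow> real" where
  "fwd \<kappa> a c k = (if k = 0 then c (hi a) - c (lo a) else if k = n then \<kappa> * c (lo a) else c (Suc k))"

definition bwd :: "real \<Rightarrow> bool \<Rightarrow> (nat \<Rightarrow> real) \<Rightarrow> nat \<Rightarrow> real" where
  "bwd \<kappa> a e k = (if k = hi a then e 0 + e n / \<kappa> else if k = lo a then e n / \<kappa> else e (k - 1))"

definition vertex_step :: "real \<Rightarrow> bool \<Rightarrow> (nat \<Rightarrow> real) \<Rightarrow> nat \<Rightarrow> real" where
  "vertex_step \<kappa> b W k = (if k = 0 then W (hi b) else if k = n then (W 0 + W 1) / \<kappa> else W (Suc k))"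

text \<open>The splittings isolate the exceptional indices on the two sides of a branch: 0 and
  \<open>n\<close> for the image, \<open>hi a\<close> and \<open>lo a\<close> for the source. The
  middle sums match after a shift by one and are empty for \<open>n = 1\<close>.\<close>

lemma sum_split_last:
  fixes g :: "nat \<Rightarrow> 'b::comm_monoid_add"
  shows "(\<Sum>k\<le>n. g k) = g 0 + (\<Sum>i<n-1. g (Suc i)) + g n"
proof -
  obtain m where m: "n = Suc m" using n_pos by (cases n) auto
  show ?thesis
    unfolding m sum.atMost_Suc_shift by (simp flip: lessThan_Suc_atMost add: ac_simps)
qed

lemma sum_split_first:
  fixes g :: "nat \<Rightarrow> 'b::comm_monoid_add"
  shows "(\<Sum>k\<le>n. g k) = g (hi a) + g (lo a) + (\<Sum>i<n-1. g (Suc (Suc i)))"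
proof -
  obtain m where m: "n = Suc m" using n_pos by (cases n) auto
  show ?thesis
    unfolding m sum.atMost_Suc_shift
    by (simp flip: lessThan_Suc_atMost add: sum.lessThan_Suc_shift ac_simps hi_def lo_def del:
        sum.lessThan_Suc)
qed

lemma bwd_dual: "(\<Sum>k\<le>n. bwd \<kappa> b e k * W k) = (\<Sum>k\<le>n. e k * vertex_step \<kappa> b W k)"
proof -
  have "(\<Sum>i<n-1. bwd \<kappa> b e (Suc (Suc i)) * W (Suc (Suc i))) =
      (\<Sum>i<n-1. e (Suc i) * vertex_step \<kappa> b W (Suc i))"
    by (rule sum.cong) (auto simp: bwd_def vertex_step_def hi_def lo_def)
  moreover have "n \<noteq> 0" using n_pos by simp
  ultimately show ?thesis
    unfolding sum_split_last[of "\<lambda>k. e k * vertex_step \<kappa> b W k"] sum_split_first[of _ b]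
    by (auto simp: bwd_def vertex_step_def hi_def lo_def algebra_simps add_divide_distrib)
qed

text \<open>For \<open>\<kappa> = 2\<close> the total is preserved and the branch is affine; for
  \<open>\<kappa> = 1\<close> it drops by \<open>c (lo a)\<close>, which is the origin of the
  denominator of the fractional-linear map.\<close>

lemma sum_fwd: "(\<Sum>k\<le>n. fwd \<kappa> a c k) = (\<Sum>k\<le>n. c k) + (\<kappa> - 2) * c (lo a)"
proof -
  have "(\<Sum>i<n-1. fwd \<kappa> a c (Suc i)) = (\<Sum>i<n-1. c (Suc (Suc i)))"
    by (rule sum.cong) (auto simp: fwd_def)
  then show ?thesis
    using n_pos unfolding sum_split_last[of "fwd \<kappa> a c"] sum_split_first[of c a]
    by (auto simp: fwd_def algebra_simps)
qed

lemma fwd_bwd: "0 < \<kappa> \<Longrightarrow> k \<le> n \<Longrightarrow> fwd \<kappa> a (bwd \<kappa> a e) k = e k"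
  using n_pos by (auto simp: fwd_def bwd_def hi_def lo_def)

lemma bwd_fwd: "0 < \<kappa> \<Longrightarrow> k \<le> n \<Longrightarrow> bwd \<kappa> a (fwd \<kappa> a c) k = c k"
  using n_pos by (auto simp: fwd_def bwd_def hi_def lo_def)

lemma fwd_divide: "fwd \<kappa> a (\<lambda>k. c k / r) k = fwd \<kappa> a c k / r"
  by (simp add: fwd_def diff_divide_distrib)

lemma bwd_divide: "bwd \<kappa> a (\<lambda>k. c k / r) k = bwd \<kappa> a c k / r"
  by (simp add: bwd_def add_divide_distrib)

lemma fwd_cong: "(\<And>k. k \<le> n \<Longrightarrow> c k = d k) \<Longrightarrow> k \<le> n \<Longrightarrow> fwd \<kappa> a c k = fwd \<kappa> a d k"
  by (simp add: fwd_def)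

lemma bwd_cong: "(\<And>k. k \<le> n \<Longrightarrow> c k = d k) \<Longrightarrow> k \<le> n \<Longrightarrow> bwd \<kappa> a c k = bwd \<kappa> a d k"
  by (simp add: bwd_def)

definition branch :: "real \<Rightarrow> bool \<Rightarrow> 'a \<Rightarrow> 'a" where
  "branch \<kappa> a x = pt (fwd \<kappa> a (bc x))"

definition inv_branch :: "real \<Rightarrow> bool \<Rightarrow> 'a \<Rightarrow> 'a" where
  "inv_branch \<kappa> a y = pt (bwd \<kappa> a (bc y))"

lemma bc_lo_le_half: "x \<in> half a \<Longrightarrow> bc x (lo a) \<le> 1 / 2"
proof -
  assume x: "x \<in> half a"
  have "0 \<le> (\<Sum>i<n-1. bc x (Suc (Suc i)))"
    using x by (intro sum_nonneg) (auto simp: half_def base_simplex_def)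
  then show ?thesis
    using bc_sum[of x] x unfolding sum_split_first[of "bc x" a] by (simp add: half_def)
qed

lemma half_simplex: "x \<in> half a \<Longrightarrow> x \<in> base_simplex"
  by (simp add: half_def)

lemma fwd_nonneg: "0 < \<kappa> \<Longrightarrow> x \<in> half a \<Longrightarrow> k \<le> n \<Longrightarrow> 0 \<le> fwd \<kappa> a (bc x) k"
  by (auto simp: half_def fwd_def base_simplex_def)

lemma sum_fwd_pos:
  assumes "0 < \<kappa>" "x \<in> half a" shows "0 < (\<Sum>k\<le>n. fwd \<kappa> a (bc x) k)"
proof -
  have "0 \<le> bc x (lo a)" using assms by (simp add: half_def bc_nonneg)
  then have "0 < 1 - 2 * bc x (lo a) + \<kappa> * bc x (lo a)"
    using bc_lo_le_half[OF assms(2)] assms(1)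
    by (cases "bc x (lo a) = 0") (auto intro!: add_nonneg_pos)
  then show ?thesis by (simp add: sum_fwd bc_sum algebra_simps)
qed

lemma bwd_nonneg: "0 < \<kappa> \<Longrightarrow> (\<And>j. j \<le> n \<Longrightarrow> 0 \<le> e j) \<Longrightarrow> k \<le> n \<Longrightarrow> 0 \<le> bwd \<kappa> a e k"
  by (auto simp: bwd_def)

lemma sum_bwd_pos:
  assumes "0 < \<kappa>" "\<And>j. j \<le> n \<Longrightarrow> 0 \<le> e j" "0 < (\<Sum>k\<le>n. e k)"
  shows "0 < (\<Sum>k\<le>n. bwd \<kappa> a e k)"
proof -
  have *: "(\<Sum>k\<le>n. bwd \<kappa> a e k) = (\<Sum>k\<le>n. e k * vertex_step \<kappa> a (\<lambda>_. 1) k)"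
    using bwd_dual[of \<kappa> a e "\<lambda>_. 1"] by simp
  obtain k where k: "k \<le> n" "0 < e k"
    using assms(2,3) by (metis atMost_iff not_le sum_nonpos)
  have "0 < e k * vertex_step \<kappa> a (\<lambda>_. 1) k" using k assms(1) by (simp add: vertex_step_def)
  then show ?thesis unfolding *
    using k assms by (intro sum_pos2[of _ k]) (auto simp: vertex_step_def)
qed

lemma bc_branch:
  assumes "0 < \<kappa>" "x \<in> half a" "k \<le> n"
  shows "bc (branch \<kappa> a x) k = fwd \<kappa> a (bc x) k / (\<Sum>k\<le>n. fwd \<kappa> a (bc x) k)"
  using sum_fwd_pos[OF assms(1,2)] assms(3) by (simp add: branch_def bc_pt)

lemma bc_inv_branch:
  assumes "0 < \<kappa>" "y \<in> base_simplex" "k \<le> n"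
  shows "bc (inv_branch \<kappa> a y) k = bwd \<kappa> a (bc y) k / (\<Sum>k\<le>n. bwd \<kappa> a (bc y) k)"
  using sum_bwd_pos[OF assms(1), of "bc y" a] assms(2,3)
  by (simp add: inv_branch_def bc_pt bc_sum base_simplex_def)

lemma sum_bwd_bc_pos: "0 < \<kappa> \<Longrightarrow> y \<in> base_simplex \<Longrightarrow> 0 < (\<Sum>k\<le>n. bwd \<kappa> a (bc y) k)"
  by (rule sum_bwd_pos) (auto simp: bc_sum base_simplex_def)

lemma branch_in: "0 < \<kappa> \<Longrightarrow> x \<in> half a \<Longrightarrow> branch \<kappa> a x \<in> base_simplex"
  unfolding branch_def by (rule bc_pt_simplex) (auto simp: fwd_nonneg sum_fwd_pos)

lemma inv_branch_in_half:
  assumes "0 < \<kappa>" "y \<in> base_simplex" shows "inv_branch \<kappa> a y \<in> half a"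
proof -
  have "inv_branch \<kappa> a y \<in> base_simplex"
    unfolding inv_branch_def using assms
    by (intro bc_pt_simplex bwd_nonneg sum_bwd_bc_pos) (auto simp: bc_nonneg)
  moreover have "bwd \<kappa> a (bc y) (lo a) \<le> bwd \<kappa> a (bc y) (hi a)"
    using assms by (simp add: bwd_def hi_def lo_def bc_nonneg)
  then have "bc (inv_branch \<kappa> a y) (lo a) \<le> bc (inv_branch \<kappa> a y) (hi a)"
    using sum_bwd_bc_pos[OF assms, of a] by (simp add: bc_inv_branch assms divide_right_mono)
  ultimately show ?thesis by (simp add: half_def)
qed

lemma inv_branch_in: "0 < \<kappa> \<Longrightarrow> y \<in> base_simplex \<Longrightarrow> inv_branch \<kappa> a y \<in> base_simplex"
  using inv_branch_in_half half_simplex by blast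

lemma branch_inv_branch:
  assumes "0 < \<kappa>" "y \<in> base_simplex" shows "branch \<kappa> a (inv_branch \<kappa> a y) = y"
proof -
  let ?S = "\<Sum>k\<le>n. bwd \<kappa> a (bc y) k"
  have "branch \<kappa> a (inv_branch \<kappa> a y) = pt (\<lambda>k. bc y k / ?S)"
    unfolding branch_def
  proof (rule pt_cong)
    fix k assume k: "k \<le> n"
    have "fwd \<kappa> a (bc (inv_branch \<kappa> a y)) k = fwd \<kappa> a (\<lambda>k. bwd \<kappa> a (bc y) k / ?S) k"
      using k by (intro fwd_cong) (auto simp: bc_inv_branch assms)
    then show "fwd \<kappa> a (bc (inv_branch \<kappa> a y)) k = bc y k / ?S"
      using k assms by (simp add: fwd_divide fwd_bwd)
  qed
  also have "\<dots> = y" using sum_bwd_bc_pos[OF assms, of a] by (simp add: pt_divide)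
  finally show ?thesis .
qed

lemma inv_branch_branch:
  assumes "0 < \<kappa>" "x \<in> half a" shows "inv_branch \<kappa> a (branch \<kappa> a x) = x"
proof -
  let ?S = "\<Sum>k\<le>n. fwd \<kappa> a (bc x) k"
  have "inv_branch \<kappa> a (branch \<kappa> a x) = pt (\<lambda>k. bc x k / ?S)"
    unfolding inv_branch_def
  proof (rule pt_cong)
    fix k assume k: "k \<le> n"
    have "bwd \<kappa> a (bc (branch \<kappa> a x)) k = bwd \<kappa> a (\<lambda>k. fwd \<kappa> a (bc x) k / ?S) k"
      using k by (intro bwd_cong) (auto simp: bc_branch assms)
    then show "bwd \<kappa> a (bc (branch \<kappa> a x)) k = bc x k / ?S"
      using k assms by (simp add: bwd_divide bwd_fwd)
  qed
  also have "\<dots> = x" using sum_fwd_pos[OF assms] by (simp add: pt_divide)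
  finally show ?thesis .
qed

lemma half_cover: "x \<in> base_simplex \<Longrightarrow> x \<in> half False \<or> x \<in> half True"
  by (auto simp: half_def hi_def lo_def)

lemma branch_agree:
  assumes "x \<in> half a" "x \<in> half b" shows "branch \<kappa> a x = branch \<kappa> b x"
proof (cases "a = b")
  case False
  then have "bc x (hi a) = bc x (lo a)" "bc x (hi b) = bc x (lo b)" "bc x (lo a) = bc x (lo b)"
    using assms by (auto simp: half_def hi_def lo_def)
  then show ?thesis unfolding branch_def by (intro pt_cong) (simp add: fwd_def)
qed simp

text \<open>On the wall the coordinates at \<open>hi a\<close> and \<open>lo a\<close> coincide, and
  \<open>fwd\<close> puts their difference at index 0. So the wall goes to the facet opposite
  \<open>v 0\<close>, the only place where the two inverse branches are glued.\<close>

lemma branch_half_boundary: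
  assumes "0 < \<kappa>" "x \<in> half a" "x \<in> half b" "a \<noteq> b" shows "bc (branch \<kappa> a x) 0 = 0"
proof -
  have "bc x (hi a) = bc x (lo a)"
    using assms by (auto simp: half_def hi_def lo_def)
  then show ?thesis using assms by (simp add: bc_branch fwd_def)
qed

lemma inv_branch_agree: "bc y 0 = 0 \<Longrightarrow> inv_branch \<kappa> a y = inv_branch \<kappa> b y"
  unfolding inv_branch_def by (intro pt_cong) (auto simp: bwd_def hi_def lo_def)

lemma inv_branch_eq_iff:
  "0 < \<kappa> \<Longrightarrow> y \<in> base_simplex \<Longrightarrow> z \<in> base_simplex \<Longrightarrow> inv_branch \<kappa> a y = inv_branch \<kappa> a z \<longleftrightarrow> y = z"
  by (metis branch_inv_branch)

lemma inv_branch_eq_neq: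
  assumes "0 < \<kappa>" "y \<in> base_simplex" "z \<in> base_simplex" "a \<noteq> b"
  shows "inv_branch \<kappa> a y = inv_branch \<kappa> b z \<longleftrightarrow> y = z \<and> bc y 0 = 0"
proof
  assume eq: "inv_branch \<kappa> a y = inv_branch \<kappa> b z"
  then have h: "inv_branch \<kappa> a y \<in> half a" "inv_branch \<kappa> a y \<in> half b"
    using inv_branch_in_half assms by metis+
  then show "y = z \<and> bc y 0 = 0"
    using branch_agree[OF h] branch_half_boundary[OF assms(1) h assms(4)] eq assms
        branch_inv_branch by metis
qed (auto intro: inv_branch_agree)

text \<open>\<open>bwd\<close> adds nonnegative coordinates with positive weights, so nothing
  cancels. The resulting criterion does not mention \<open>\<kappa>\<close>; the transfer between
  the two maps rests on this.\<close>

lemma bc_inv_branch_pos_iff: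
  assumes "0 < \<kappa>" "y \<in> base_simplex" "j \<le> n"
  shows "0 < bc (inv_branch \<kappa> a y) j \<longleftrightarrow>
    (if j = hi a then 0 < bc y 0 \<or> 0 < bc y n else
        if j = lo a then 0 < bc y n else 0 < bc y (j - 1))"
proof -
  have "0 < bc (inv_branch \<kappa> a y) j \<longleftrightarrow> 0 < bwd \<kappa> a (bc y) j"
    using sum_bwd_bc_pos[OF assms(1,2), of a] assms
        by (simp add: bc_inv_branch zero_less_divide_iff)
  moreover have "0 \<le> bc y 0" "0 \<le> bc y n" using assms bc_nonneg by auto
  ultimately show ?thesis
    using assms(1) by (auto simp: bwd_def zero_less_divide_iff add_nonneg_pos add_pos_nonneg)
qed

lemma continuous_on_inv_branch: "0 < \<kappa> \<Longrightarrow> continuous_on base_simplex (inv_branch \<kappa> a)"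
proof -
  assume \<kappa>: "0 < \<kappa>"
  have c: "continuous_on base_simplex (\<lambda>y. bwd \<kappa> a (bc y) k)" for k
    using \<kappa> unfolding bwd_def
    by (cases "k = hi a"; cases "k = lo a")
      (auto intro!: continuous_intros continuous_on_subset[OF bc_cont])
  show ?thesis
    unfolding inv_branch_def pt_def
    by (intro continuous_intros c) (metis sum_bwd_bc_pos[OF \<kappa>] less_irrefl)
qed

subsection \<open>Cylinders and their faces\<close>


primrec branch_word :: "real \<Rightarrow> bool list \<Rightarrow> 'a \<Rightarrow> 'a" where
  "branch_word \<kappa> [] x = x"
| "branch_word \<kappa> (b # a) x = branch_word \<kappa> a (branch \<kappa> b x)"

primrec inv_word :: "real \<Rightarrow> bool list \<Rightarrow> 'a \<Rightarrow> 'a" where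
  "inv_word \<kappa> [] y = y"
| "inv_word \<kappa> (b # a) y = inv_branch \<kappa> b (inv_word \<kappa> a y)"

definition step_map :: "real \<Rightarrow> 'a \<Rightarrow> 'a" where
  "step_map \<kappa> x = (if x \<in> half False then branch \<kappa> False x else branch \<kappa> True x)"

definition cyl :: "real \<Rightarrow> bool list \<Rightarrow> 'a set" where
  "cyl \<kappa> a = {x \<in> base_simplex. \<forall>i<length a. (step_map \<kappa> ^^ i) x \<in> half (a ! i)}"

lemma step_map_half: "x \<in> half a \<Longrightarrow> step_map \<kappa> x = branch \<kappa> a x"
  unfolding step_map_def using branch_agree half_cover half_simplex by metis

lemma cyl_Nil [simp]: "cyl \<kappa> [] = base_simplex"
  by (simp add: cyl_def)

lemma cyl_Cons:
  assumes "0 < \<kappa>"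
  shows "x \<in> cyl \<kappa> (b # a) \<longleftrightarrow> x \<in> half b \<and> branch \<kappa> b x \<in> cyl \<kappa> a"
proof -
  have "x \<in> cyl \<kappa> (b # a) \<longleftrightarrow>
      x \<in> base_simplex \<and> x \<in> half b \<and> (\<forall>i<length a. (step_map \<kappa> ^^ i) (step_map \<kappa> x) \<in>
          half (a ! i))"
    by (simp only: cyl_def mem_Collect_eq list.size All_less_Suc2 nth_Cons_0 nth_Cons_Suc funpow_0
        funpow_Suc_right comp_apply add_0_right add_Suc_right One_nat_def)
  also have "\<dots> \<longleftrightarrow> x \<in> half b \<and> branch \<kappa> b x \<in> cyl \<kappa> a"
    using step_map_half[of x b \<kappa>] half_simplex[of x b] branch_in[OF assms, of x b]
        by (auto simp: cyl_def)
  finally show ?thesis .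
qed

lemma inv_word_append: "inv_word \<kappa> (a @ b) y = inv_word \<kappa> a (inv_word \<kappa> b y)"
  by (induction a) auto

lemma inv_word_in: "0 < \<kappa> \<Longrightarrow> y \<in> base_simplex \<Longrightarrow> inv_word \<kappa> a y \<in> base_simplex"
  by (induction a) (auto simp: inv_branch_in)

lemma inv_word_in_cyl: "0 < \<kappa> \<Longrightarrow> y \<in> base_simplex \<Longrightarrow> inv_word \<kappa> a y \<in> cyl \<kappa> a"
  by (induction a) (auto simp: cyl_Cons inv_branch_in_half branch_inv_branch inv_word_in)

lemma branch_word_inv_word: "0 < \<kappa> \<Longrightarrow> y \<in> base_simplex \<Longrightarrow> branch_word \<kappa> a (inv_word \<kappa> a y) = y"
  by (induction a) (auto simp: branch_inv_branch inv_word_in)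

lemma branch_word_in: "0 < \<kappa> \<Longrightarrow> x \<in> cyl \<kappa> a \<Longrightarrow> branch_word \<kappa> a x \<in> base_simplex"
  by (induction a arbitrary: x) (auto simp: cyl_Cons)

lemma inv_word_branch_word: "0 < \<kappa> \<Longrightarrow> x \<in> cyl \<kappa> a \<Longrightarrow> inv_word \<kappa> a (branch_word \<kappa> a x) = x"
  by (induction a arbitrary: x) (auto simp: cyl_Cons inv_branch_branch)

lemma cyl_eq: "0 < \<kappa> \<Longrightarrow> cyl \<kappa> a = inv_word \<kappa> a ` base_simplex"
  by (metis (no_types, lifting) branch_word_in inv_word_branch_word inv_word_in_cyl image_eqI
      image_subsetI subsetI subset_antisym)

lemma branch_word_step_map: "0 < \<kappa> \<Longrightarrow> x \<in> cyl \<kappa> a \<Longrightarrow> branch_word \<kappa> a x = (step_map \<kappa> ^^ length a) x"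
proof (induction a arbitrary: x)
  case (Cons b a)
  then have "x \<in> half b" "branch \<kappa> b x \<in> cyl \<kappa> a" by (auto simp: cyl_Cons)
  with Cons show ?case by (simp only: branch_word.simps list.size funpow_Suc_right comp_apply
      step_map_half
        add_0_right add_Suc_right One_nat_def)
qed simp

lemma step_map_inv_word: "0 < \<kappa> \<Longrightarrow> y \<in> base_simplex \<Longrightarrow> (step_map \<kappa> ^^ length a) (inv_word \<kappa> a y) = y"
  by (metis branch_word_inv_word branch_word_step_map inv_word_in_cyl)

lemma cyl_simplex: "x \<in> cyl \<kappa> a \<Longrightarrow> x \<in> base_simplex"
  by (simp add: cyl_def)

lemma cyl_prefix: "cyl \<kappa> (a @ b) \<subseteq> cyl \<kappa> a"
  by (auto simp: cyl_def nth_append)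

lemma continuous_on_inv_word: "0 < \<kappa> \<Longrightarrow> continuous_on base_simplex (inv_word \<kappa> a)"
proof (induction a)
  case Nil
  then show ?case by (simp add: continuous_on_id)
next
  case (Cons b a)
  have "continuous_on base_simplex (inv_branch \<kappa> b \<circ> inv_word \<kappa> a)"
    using Cons inv_word_in
    by (intro continuous_on_compose continuous_on_subset[OF continuous_on_inv_branch]) auto
  then show ?case by (simp add: o_def)
qed

lemma compact_cyl: "0 < \<kappa> \<Longrightarrow> compact (cyl \<kappa> a)"
  by (simp add: cyl_eq compact_continuous_image continuous_on_inv_word compact_simplex)

lemma simplex_nonempty: "base_simplex \<noteq> {}"
  using vertex_in_simplex[of 0] by auto

lemma cyl_nonempty: "0 < \<kappa> \<Longrightarrow> cyl \<kappa> a \<noteq> {}"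
  using simplex_nonempty by (simp add: cyl_eq)

lemma cyl_exists:
  assumes "0 < \<kappa>" "x \<in> base_simplex"
  obtains a where "length a = t" "x \<in> cyl \<kappa> a"
  using assms(2)
proof (induction t arbitrary: x thesis)
  case 0
  then show ?case by simp
next
  case (Suc t)
  obtain b where b: "x \<in> half b" using half_cover Suc.prems by blast
  then obtain a where "length a = t" "branch \<kappa> b x \<in> cyl \<kappa> a"
    using Suc.IH[of "branch \<kappa> b x"] branch_in[OF assms(1)] by blast
  with b show ?case by (intro Suc.prems(1)[of "b # a"]) (auto simp: cyl_Cons assms)
qed

section \<open>Segment-preserving maps, convexity and faces of cylinders\<close>

definition segment_iso :: "'a set \<Rightarrow> 'a set \<Rightarrow> ('a \<Rightarrow> 'a) \<Rightarrow> ('a \<Rightarrow> 'a) \<Rightarrow> bool" where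
  "segment_iso C D h h' \<longleftrightarrow> h ` C \<subseteq> D \<and> h' ` D \<subseteq> C \<and> (\<forall>x\<in>C. h' (h x) = x) \<and> (\<forall>y\<in>D. h (h' y) = y) \<and>
    (\<forall>x\<in>C. \<forall>y\<in>C. \<forall>z\<in>open_segment x y. z \<in> C \<longrightarrow> h z \<in> open_segment (h x) (h y)) \<and>
    (\<forall>x\<in>D. \<forall>y\<in>D. \<forall>z\<in>open_segment x y. z \<in> D \<longrightarrow> h' z \<in> open_segment (h' x) (h' y))"

text \<open>The inverse is part of the notion, so faces can be carried in both directions. Branches
  are projective and in general not affine, but they respect open segments, and
  \<open>face_of\<close> is phrased through open segments alone.\<close>

lemma segment_iso_sym: "segment_iso C D h h' \<Longrightarrow> segment_iso D C h' h"
  unfolding segment_iso_def by (elim conjE, intro conjI)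

lemma segment_iso_face:
  assumes iso: "segment_iso C D h h'" and C: "convex C" and S: "S face_of C" and D: "convex D"
  shows "h ` S face_of D"
proof -
  have SC: "S \<subseteq> C" "convex S" using S face_of_imp_subset face_of_imp_convex by auto
  have hC: "h x \<in> D" "h' (h x) = x" if "x \<in> C" for x
    using that iso by (simp_all add: segment_iso_def image_subset_iff)
  have h'D: "h' y \<in> C" "h (h' y) = y" if "y \<in> D" for y
    using that iso by (simp_all add: segment_iso_def image_subset_iff)
  have seg': "h' z \<in> open_segment (h' x) (h' y)" if "x \<in> D" "y \<in> D" "z \<in> open_segment x y" for x y z
  proof -
    have "z \<in> D" using D that by (meson convex_contains_open_segment in_mono)
    then show ?thesis using that iso by (simp add: segment_iso_def)
  qed
  have hS: "h' y \<in> S \<Longrightarrow> y \<in> D \<Longrightarrow> y \<in> h ` S" for y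
    using h'D(2) by (metis image_eqI)
  have "z \<in> h ` S" if xy: "x \<in> S" "y \<in> S" and z: "z \<in> open_segment (h x) (h y)" for x y z
  proof -
    have D': "h x \<in> D" "h y \<in> D" using xy SC hC by auto
    then have zD: "z \<in> D" using D z by (meson convex_contains_open_segment in_mono)
    have "h' z \<in> open_segment x y"
      using seg'[OF D' z] hC xy SC by (metis subsetD)
    then have "h' z \<in> S" using xy SC(2) by (meson convex_contains_open_segment in_mono)
    then show ?thesis using hS zD by blast
  qed
  then have "convex (h ` S)" by (auto simp: convex_contains_open_segment)
  moreover have "h ` S \<subseteq> D" using SC hC by auto
  moreover have "x \<in> h ` S \<and> y \<in> h ` S"
    if xy: "x \<in> D" "y \<in> D" and s: "s \<in> S" "h s \<in> open_segment x y" for x y s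
  proof -
    have "s \<in> open_segment (h' x) (h' y)"
      using seg'[OF xy s(2)] hC s(1) SC by (metis subsetD)
    then have "h' x \<in> S \<and> h' y \<in> S"
      using S s(1) xy h'D unfolding face_of_def by blast
    then show ?thesis using hS xy by blast
  qed
  ultimately show ?thesis unfolding face_of_def by blast
qed

text \<open>Normalising after an affine change of coordinates only reparametrises a segment: the new
  weight \<open>w\<close> of the second endpoint is its share of the normalising total, which again
  lies strictly between 0 and 1.\<close>

lemma pt_segment:
  assumes L: "\<And>u a b. \<And>k. k \<le> n \<Longrightarrow> L (\<lambda>k. (1 - u) * a k + u * b k) k = (1 - u) * L a k + u * L b k"
    and Lc: "\<And>a b k. (\<And>k. k \<le> n \<Longrightarrow> a k = b k) \<Longrightarrow> k \<le> n \<Longrightarrow> L a k = L b k"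
    and pos: "0 < (\<Sum>k\<le>n. L (bc x) k)" "0 < (\<Sum>k\<le>n. L (bc y) k)"
    and ne: "pt (L (bc x)) \<noteq> pt (L (bc y))"
    and z: "z \<in> open_segment x y"
  shows "pt (L (bc z)) \<in> open_segment (pt (L (bc x))) (pt (L (bc y)))"
proof -
  obtain u where u: "0 < u" "u < 1" and zu: "z = (1 - u) *\<^sub>R x + u *\<^sub>R y"
    using z by (auto simp: in_segment)
  let ?X = "\<Sum>k\<le>n. L (bc x) k" and ?Y = "\<Sum>k\<le>n. L (bc y) k"
  have Lz: "L (bc z) k = (1 - u) * L (bc x) k + u * L (bc y) k" if "k \<le> n" for k
  proof -
    have "L (bc z) k = L (\<lambda>k. (1 - u) * bc x k + u * bc y k) k"
      using that by (intro Lc) (auto simp: zu bc_convex_comb)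
    then show ?thesis using L that by simp
  qed
  define S where "S = (1 - u) * ?X + u * ?Y"
  have S: "0 < S" using pos u by (auto simp: S_def intro!: add_pos_pos)
  have sumz: "(\<Sum>k\<le>n. L (bc z) k) = S"
    unfolding S_def by (simp add: Lz sum.distrib flip: sum_distrib_left)
  define w where "w = u * ?Y / S"
  have w: "0 < w" "w < 1" "1 - w = (1 - u) * ?X / S"
    using S pos u by (auto simp: w_def field_simps S_def)
  have "pt (L (bc z)) = (1 / S) *\<^sub>R (\<Sum>k\<le>n. ((1 - u) * L (bc x) k + u * L (bc y) k) *\<^sub>R v k)"
    unfolding pt_def sumz by (simp add: Lz)
  also have "\<dots> = ((1 - u) / S) *\<^sub>R (\<Sum>k\<le>n. L (bc x) k *\<^sub>R v k) +
      (u / S) *\<^sub>R (\<Sum>k\<le>n. L (bc y) k *\<^sub>R v k)"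
    by (simp add: scaleR_add_left sum.distrib scaleR_add_right scaleR_sum_right)
  also have "\<dots> = (1 - w) *\<^sub>R pt (L (bc x)) + w *\<^sub>R pt (L (bc y))"
    using pos S unfolding w(3) unfolding w_def pt_def by simp
  finally show ?thesis using w ne by (auto simp: in_segment)
qed

lemma fwd_affine: "fwd \<kappa> b (\<lambda>k. (1 - u) * c k + u * d k) k =
    (1 - u) * fwd \<kappa> b c k + u * fwd \<kappa> b d k"
  by (simp add: fwd_def algebra_simps)

lemma bwd_affine: "bwd \<kappa> b (\<lambda>k. (1 - u) * c k + u * d k) k =
    (1 - u) * bwd \<kappa> b c k + u * bwd \<kappa> b d k"
  by (simp add: bwd_def algebra_simps add_divide_distrib diff_divide_distrib)

lemma inv_branch_segment:
  assumes "0 < \<kappa>" "x \<in> base_simplex" "y \<in> base_simplex" "z \<in> open_segment x y"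
  shows "inv_branch \<kappa> b z \<in> open_segment (inv_branch \<kappa> b x) (inv_branch \<kappa> b y)"
  unfolding inv_branch_def
proof (rule pt_segment)
  show "pt (bwd \<kappa> b (bc x)) \<noteq> pt (bwd \<kappa> b (bc y))"
    using inv_branch_eq_iff[of \<kappa> x y b] assms unfolding inv_branch_def by auto
qed (use assms bwd_affine bwd_cong sum_bwd_bc_pos in blast)+

lemma branch_eq_iff:
  "0 < \<kappa> \<Longrightarrow> x \<in> half a \<Longrightarrow> y \<in> half a \<Longrightarrow> branch \<kappa> a x = branch \<kappa> a y \<longleftrightarrow> x = y"
  by (metis inv_branch_branch)

lemma branch_segment:
  assumes "0 < \<kappa>" "x \<in> half b" "y \<in> half b" "z \<in> open_segment x y"
  shows "branch \<kappa> b z \<in> open_segment (branch \<kappa> b x) (branch \<kappa> b y)"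
  unfolding branch_def
proof (rule pt_segment)
  show "pt (fwd \<kappa> b (bc x)) \<noteq> pt (fwd \<kappa> b (bc y))"
    using branch_eq_iff[of \<kappa> x b y] assms unfolding branch_def by auto
qed (use assms fwd_affine fwd_cong sum_fwd_pos in blast)+

lemma convex_half: "convex (half a)"
proof -
  have "half a = base_simplex \<inter> {x. bc x (lo a) \<le> bc x (hi a)}" by (auto simp: half_def)
  moreover have "convex {x. bc x (lo a) \<le> bc x (hi a)}"
    by (auto simp: convex_alt bc_convex_comb intro!: add_mono mult_left_mono)
  ultimately show ?thesis by (simp add: convex_Int convex_simplex)
qed

lemma convex_cyl:
  assumes "0 < \<kappa>" shows "convex (cyl \<kappa> a)"
proof (induction a)
  case Nil
  then show ?case by (simp add: convex_simplex)
next
  case (Cons b a)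
  have "z \<in> cyl \<kappa> (b # a)"
    if "x \<in> cyl \<kappa> (b # a)" "y \<in> cyl \<kappa> (b # a)" "z \<in> open_segment x y" for x y z
  proof -
    have "z \<in> half b" using that convex_half[of b]
      by (metis cyl_Cons assms convex_contains_open_segment in_mono)
    moreover have "branch \<kappa> b z \<in> cyl \<kappa> a"
      using that Cons branch_segment[of \<kappa> x b y z]
      by (metis cyl_Cons assms convex_contains_open_segment in_mono)
    ultimately show ?thesis by (simp add: cyl_Cons assms)
  qed
  then show ?case unfolding convex_contains_open_segment by blast
qed

lemma inv_word_segment:
  assumes "0 < \<kappa>" "x \<in> base_simplex" "y \<in> base_simplex" "z \<in> open_segment x y"
  shows "inv_word \<kappa> a z \<in> open_segment (inv_word \<kappa> a x) (inv_word \<kappa> a y)"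
  using assms by (induction a) (auto intro: inv_branch_segment inv_word_in)

lemma branch_word_segment:
  assumes "0 < \<kappa>" "x \<in> cyl \<kappa> a" "y \<in> cyl \<kappa> a" "z \<in> open_segment x y"
  shows "branch_word \<kappa> a z \<in> open_segment (branch_word \<kappa> a x) (branch_word \<kappa> a y)"
  using assms by (induction a arbitrary: x y z) (auto intro: branch_segment simp: cyl_Cons)

lemma segment_iso_cyl:
  assumes "0 < \<kappa>" shows "segment_iso (cyl \<kappa> a) base_simplex (branch_word \<kappa> a) (inv_word \<kappa> a)"
  unfolding segment_iso_def
  by (intro conjI ballI impI image_subsetI)
    (simp_all add: assms branch_word_in inv_word_in_cyl inv_word_branch_word branch_word_inv_word
        inv_word_segment branch_word_segment)

lemma face_cyl_iff:
  assumes "0 < \<kappa>"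
  shows "S face_of cyl \<kappa> a \<longleftrightarrow> (\<exists>D. D face_of base_simplex \<and> S = inv_word \<kappa> a ` D)"
proof
  assume S: "S face_of cyl \<kappa> a"
  have "branch_word \<kappa> a ` S face_of base_simplex"
    using segment_iso_face[OF segment_iso_cyl[OF assms] convex_cyl[OF assms] S convex_simplex] .
  moreover have "S = inv_word \<kappa> a ` branch_word \<kappa> a ` S"
    using face_of_imp_subset[OF S] inv_word_branch_word[OF assms] by (force simp: image_image)
  ultimately show "\<exists>D. D face_of base_simplex \<and> S = inv_word \<kappa> a ` D" by blast
next
  assume "\<exists>D. D face_of base_simplex \<and> S = inv_word \<kappa> a ` D"
  then show "S face_of cyl \<kappa> a"
    using segment_iso_face[OF segment_iso_sym[OF segment_iso_cyl[OF assms]] convex_simplex _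
        convex_cyl[OF assms]]
    by blast
qed

section \<open>The faces of the simplex\<close>

lemma affine_independent_vertices: "\<not> affine_dependent (v ` {..n})"
proof
  assume "affine_dependent (v ` {..n})"
  then obtain k where k: "k \<le> n" "v k \<in> affine hull (v ` {..n} - {v k})"
    unfolding affine_dependent_def by auto
  \<comment> \<open>The zero set of the coordinate \<open>k\<close> is affine and contains every
    vertex except \<open>v k\<close>.\<close>
  have "affine {x. bc x k = 0}"
    unfolding affine_def
  proof (intro ballI allI impI)
    fix x y and p q :: real
    assume xy: "x \<in> {x. bc x k = 0}" "y \<in> {x. bc x k = 0}" "p + q = 1"
    then show "p *\<^sub>R x + q *\<^sub>R y \<in> {x. bc x k = 0}"
      using k bc_convex_comb[of k q x y] by (simp add: eq_diff_eq[of p 1 q, symmetric])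
  qed
  moreover have "v ` {..n} - {v k} \<subseteq> {x. bc x k = 0}"
    using k by (auto simp: bc_vertex)
  ultimately have "affine hull (v ` {..n} - {v k}) \<subseteq> {x. bc x k = 0}"
    by (simp add: hull_minimal)
  then show False using k by (auto simp: bc_vertex)
qed

definition Face :: "nat set \<Rightarrow> 'a set" where
  "Face J = {x \<in> base_simplex. \<forall>k\<le>n. k \<notin> J \<longrightarrow> bc x k = 0}"

lemma Face_hull: "J \<subseteq> {..n} \<Longrightarrow> convex hull (v ` J) = Face J"
proof (rule hull_unique)
  assume J: "J \<subseteq> {..n}"
  show "v ` J \<subseteq> Face J" using J by (auto simp: Face_def vertex_in_simplex bc_vertex)
  show "convex (Face J)"
    using convex_simplex unfolding Face_def convex_alt by (simp add: bc_convex_comb)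
  fix S assume S: "v ` J \<subseteq> S" "convex S"
  show "Face J \<subseteq> S"
  proof
    fix x assume x: "x \<in> Face J"
    have "(\<Sum>k\<in>J. bc x k) = (\<Sum>k\<le>n. bc x k)" "(\<Sum>k\<in>J. bc x k *\<^sub>R v k) = (\<Sum>k\<le>n. bc x k *\<^sub>R v k)"
      using J x by (auto intro!: sum.mono_neutral_left simp: Face_def)
    moreover have "(\<Sum>k\<in>J. bc x k *\<^sub>R v k) \<in> S"
      using S J x calculation finite_subset[OF J]
      by (intro convex_sum) (auto simp: bc_sum base_simplex_def Face_def)
    ultimately show "x \<in> S" by (simp add: bc_reconstruct)
  qed
qed

lemma Face_singleton: "k \<le> n \<Longrightarrow> Face {k} = {v k}"
  using Face_hull[of "{k}"] by simp

lemma face_simplex_iff: "D face_of base_simplex \<longleftrightarrow> (\<exists>J\<subseteq>{..n}. D = Face J)"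
proof -
  have "D face_of base_simplex \<longleftrightarrow> (\<exists>c\<subseteq>v ` {..n}. D = convex hull c)"
    using face_of_convex_hull_affine_independent[OF affine_independent_vertices]
        by (simp add: simplex_hull)
  also have "\<dots> \<longleftrightarrow> (\<exists>J\<subseteq>{..n}. D = Face J)"
    by (metis Face_hull image_mono subset_image_iff)
  finally show ?thesis .
qed

subsection \<open>Contraction of vertex ranges\<close>


lemma vertex_step_linear: "vertex_step \<kappa> b (\<lambda>k. r * W k + s * U k) =
    (\<lambda>k. r * vertex_step \<kappa> b W k + s * vertex_step \<kappa> b U k)"
  by (auto simp: vertex_step_def fun_eq_iff algebra_simps add_divide_distrib)

lemma fold_vertex_step_linear:
  "fold (vertex_step \<kappa>) a (\<lambda>k. r * W k + s * U k) =
      (\<lambda>k. r * fold (vertex_step \<kappa>) a W k + s * fold (vertex_step \<kappa>) a U k)"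
  by (induction a arbitrary: W U) (auto simp: vertex_step_linear)

text \<open>The head of a word acts last on points but first on vertex data, hence
  \<open>foldr\<close> on one side and \<open>fold\<close> on the other.\<close>

lemma foldr_bwd_dual:
  "(\<Sum>k\<le>n. foldr (bwd \<kappa>) a e k * W k) = (\<Sum>k\<le>n. e k * fold (vertex_step \<kappa>) a W k)"
  by (induction a arbitrary: W) (simp_all add: bwd_dual)

text \<open>Normalisation can be postponed to the very end, because \<open>bwd\<close> is
  homogeneous and \<open>pt\<close> ignores scaling.\<close>

lemma foldr_bwd:
  assumes "0 < \<kappa>" "y \<in> base_simplex"
  shows "(\<forall>k\<le>n. 0 \<le> foldr (bwd \<kappa>) a (bc y) k) \<and> 0 < (\<Sum>k\<le>n. foldr (bwd \<kappa>) a (bc y) k) \<and>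
    inv_word \<kappa> a y = pt (foldr (bwd \<kappa>) a (bc y))"
proof (induction a)
  case Nil
  then show ?case using assms by (simp add: bc_nonneg bc_sum)
next
  case (Cons b a)
  let ?c = "foldr (bwd \<kappa>) a (bc y)"
  let ?S = "\<Sum>k\<le>n. ?c k"
  have "inv_word \<kappa> (b # a) y = pt (bwd \<kappa> b (bc (pt ?c)))"
    using Cons by (simp add: inv_branch_def)
  also have "\<dots> = pt (\<lambda>k. bwd \<kappa> b ?c k / ?S)"
  proof (rule pt_cong)
    fix k assume k: "k \<le> n"
    have "bwd \<kappa> b (bc (pt ?c)) k = bwd \<kappa> b (\<lambda>k. ?c k / ?S) k"
      using k Cons by (intro bwd_cong bc_pt) auto
    then show "bwd \<kappa> b (bc (pt ?c)) k = bwd \<kappa> b ?c k / ?S"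
      by (simp add: bwd_divide)
  qed
  also have "\<dots> = pt (bwd \<kappa> b ?c)"
    using Cons by (intro pt_divide) auto
  finally show ?case
    using Cons assms by (auto intro: bwd_nonneg sum_bwd_pos)
qed

lemma bc_inv_word:
  assumes "0 < \<kappa>" "y \<in> base_simplex" "j \<le> n"
  shows "0 < (\<Sum>k\<le>n. bc y k * fold (vertex_step \<kappa>) a (\<lambda>_. 1) k)"
    and "bc (inv_word \<kappa> a y) j =
      (\<Sum>k\<le>n. bc y k * fold (vertex_step \<kappa>) a (\<lambda>k. if k = j then 1 else 0) k) /
      (\<Sum>k\<le>n. bc y k * fold (vertex_step \<kappa>) a (\<lambda>_. 1) k)"
proof -
  let ?c = "foldr (bwd \<kappa>) a (bc y)"
  have s: "(\<Sum>k\<le>n. ?c k) = (\<Sum>k\<le>n. bc y k * fold (vertex_step \<kappa>) a (\<lambda>_. 1) k)"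
    using foldr_bwd_dual[of \<kappa> a "bc y" "\<lambda>_. 1"] by simp
  moreover have "?c j = (\<Sum>k\<le>n. bc y k * fold (vertex_step \<kappa>) a (\<lambda>k. if k = j then 1 else 0) k)"
    using foldr_bwd_dual[of \<kappa> a "bc y" "\<lambda>k. if k = j then 1 else 0"] assms(3)
    by (simp add: if_distrib[of "(*) _"] cong: if_cong)
  ultimately show "0 < (\<Sum>k\<le>n. bc y k * fold (vertex_step \<kappa>) a (\<lambda>_. 1) k)"
    and "bc (inv_word \<kappa> a y) j =
      (\<Sum>k\<le>n. bc y k * fold (vertex_step \<kappa>) a (\<lambda>k. if k = j then 1 else 0) k) /
      (\<Sum>k\<le>n. bc y k * fold (vertex_step \<kappa>) a (\<lambda>_. 1) k)"
    using foldr_bwd[OF assms(1,2), of a] bc_pt[of ?c j] assms(3) by auto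
qed

text \<open>
  Here \<open>d\<close> and \<open>N\<close> hold the denominators and the numerators of one coordinate of the vertices of a
  cylinder, so \<open>\<delta>\<close> bounds the range of that coordinate.
\<close>

definition narrow :: "(nat \<Rightarrow> real) \<Rightarrow> (nat \<Rightarrow> real) \<Rightarrow> real \<Rightarrow> bool" where
  "narrow d N \<delta> \<longleftrightarrow> (\<exists>l h. h - l \<le> \<delta> \<and> (\<forall>k\<le>n. l * d k \<le> N k \<and> N k \<le> h * d k))"

lemma vertex_step_le:
  assumes "0 < \<kappa>" "\<And>k. k \<le> n \<Longrightarrow> W k \<le> U k" "k \<le> n"
  shows "vertex_step \<kappa> b W k \<le> vertex_step \<kappa> b U k"
  using assms n_pos by (auto simp: vertex_step_def intro!: divide_right_mono add_mono)

lemma vertex_step_scale: "vertex_step \<kappa> b (\<lambda>k. r * W k) = (\<lambda>k. r * vertex_step \<kappa> b W k)"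
  by (auto simp: vertex_step_def fun_eq_iff algebra_simps)

lemma narrow_vertex_step:
  assumes "0 < \<kappa>" "narrow d N \<delta>" shows "narrow (vertex_step \<kappa> b d) (vertex_step \<kappa> b N) \<delta>"
proof -
  obtain l h where lh: "h - l \<le> \<delta>" "\<And>k. k \<le> n \<Longrightarrow> l * d k \<le> N k \<and> N k \<le> h * d k"
    using assms(2) unfolding narrow_def by blast
  have "l * vertex_step \<kappa> b d k \<le> vertex_step \<kappa> b N k \<and>
      vertex_step \<kappa> b N k \<le> h * vertex_step \<kappa> b d k" if "k \<le> n" for k
    using vertex_step_le[OF assms(1), of "\<lambda>k. l * d k" N k b] vertex_step_le[OF assms(1),
        of N "\<lambda>k. h * d k" k b] lh that
    by (simp add: vertex_step_scale)
  with lh(1) show ?thesis unfolding narrow_def by blast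
qed

lemma narrow_fold:
  "0 < \<kappa> \<Longrightarrow> narrow d N \<delta> \<Longrightarrow> narrow (fold (vertex_step \<kappa>) a d) (fold (vertex_step \<kappa>) a N) \<delta>"
  by (induction a arbitrary: d N) (auto simp: narrow_vertex_step)

lemma narrow_mono: "narrow d N \<delta> \<Longrightarrow> \<delta> \<le> \<delta>' \<Longrightarrow> narrow d N \<delta>'"
  unfolding narrow_def by (meson order_trans)

text \<open>By \<open>bc_inv_word\<close> a coordinate of a point of the cylinder is a mean of the
  vertex quotients, weighted by denominators, so it stays in any interval containing these
  quotients.\<close>

lemma narrow_bc_diff:
  assumes "0 < \<kappa>" "j \<le> n" "x \<in> cyl \<kappa> a" "y \<in> cyl \<kappa> a"
    and "narrow (fold (vertex_step \<kappa>) a (\<lambda>_. 1)) (fold (vertex_step \<kappa>) a (\<lambda>k.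
        if k = j then 1 else 0)) \<delta>"
  shows "\<bar>bc x j - bc y j\<bar> \<le> \<delta>"
proof -
  let ?d = "fold (vertex_step \<kappa>) a (\<lambda>_. 1)" and ?N = "fold (vertex_step \<kappa>) a (\<lambda>k.
      if k = j then 1 else 0)"
  obtain l h where lh: "h - l \<le> \<delta>" "\<And>k. k \<le> n \<Longrightarrow> l * ?d k \<le> ?N k \<and> ?N k \<le> h * ?d k"
    using assms(5) unfolding narrow_def by blast
  have "l \<le> bc z j \<and> bc z j \<le> h" if "z \<in> cyl \<kappa> a" for z
  proof -
    define e where "e = bc (branch_word \<kappa> a z)"
    have z: "branch_word \<kappa> a z \<in> base_simplex" "inv_word \<kappa> a (branch_word \<kappa> a z) = z"
      using that assms branch_word_in inv_word_branch_word by auto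
    have e: "\<And>k. k \<le> n \<Longrightarrow> 0 \<le> e k" using z bc_nonneg by (simp add: e_def)
    have D: "0 < (\<Sum>k\<le>n. e k * ?d k)" "bc z j = (\<Sum>k\<le>n. e k * ?N k) / (\<Sum>k\<le>n. e k * ?d k)"
      using bc_inv_word[OF assms(1) z(1) assms(2), of a] z(2) by (simp_all add: e_def)
    have "(\<Sum>k\<le>n. e k * (l * ?d k)) \<le> (\<Sum>k\<le>n. e k * ?N k)"
      "(\<Sum>k\<le>n. e k * ?N k) \<le> (\<Sum>k\<le>n. e k * (h * ?d k))"
      using e lh(2) by (auto intro!: sum_mono mult_left_mono)
    then have "l * (\<Sum>k\<le>n. e k * ?d k) \<le> (\<Sum>k\<le>n. e k * ?N k)"
      "(\<Sum>k\<le>n. e k * ?N k) \<le> h * (\<Sum>k\<le>n. e k * ?d k)"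
      by (simp_all add: sum_distrib_left mult.left_commute)
    then show ?thesis using D by (simp add: pos_le_divide_eq pos_divide_le_eq)
  qed
  from this[OF assms(3)] this[OF assms(4)] show ?thesis using lh(1) by linarith
qed

text \<open>
  The labels \<open>A\<close> and \<open>B\<close> of a vertex say that its coordinate stays away from the lower,
  respectively upper, end of the range.  A new vertex inherits the labels of both ends of the
  bisected edge, and after \<open>2 * n * n\<close> steps one of the labels has spread to all vertices.
\<close>

definition label_step :: "bool \<Rightarrow> (nat \<Rightarrow> bool) \<Rightarrow> nat \<Rightarrow> bool" where
  "label_step b A k = (if k = 0 then A (hi b) else if k = n then A 0 \<or> A 1 else A (Suc k))"

definition missing :: "(nat \<Rightarrow> bool) \<Rightarrow> nat" where
  "missing A = card {k \<in> {1..n}. \<not> A k}"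

text \<open>Vertex 0 is left out of the count because digit 1 may take its label away. The loss is
  harmless: a label at 0 that is absent at 1 passes to the new vertex \<open>n\<close>. The map
  \<open>g\<close> charges each new gap to an old one; a gap at \<open>n\<close> is charged to
  vertex 1.\<close>

lemma missing_label_step:
  shows "missing (label_step b A) \<le> missing A"
    and "A 0 \<Longrightarrow> \<not> A 1 \<Longrightarrow> missing (label_step b A) < missing A"
proof -
  let ?S = "{k \<in> {1..n}. \<not> A k}" and ?T = "{k \<in> {1..n}. \<not> label_step b A k}"
  define g where "g k = (if k = n then 1 else Suc k)" for k
  have inj: "inj_on g ?T" by (auto simp: inj_on_def g_def split: if_splits)
  have sub: "g ` ?T \<subseteq> ?S" using n_pos by (auto simp: g_def label_step_def)
  show "missing (label_step b A) \<le> missing A"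
    unfolding missing_def using card_inj_on_le[OF inj sub] by simp
  assume A: "A 0" "\<not> A 1"
  then have "1 \<notin> g ` ?T" "1 \<in> ?S" using n_pos by (auto simp: g_def label_step_def)
  then have "card (g ` ?T) < card ?S" using sub by (intro psubset_card_mono) auto
  then show "missing (label_step b A) < missing A"
    unfolding missing_def using card_image[OF inj] by simp
qed

lemma missing_fold: "missing (fold label_step a A) \<le> missing A"
  by (induction a arbitrary: A) (auto intro: order_trans[OF _ missing_label_step(1)])

text \<open>While vertex 1 is labelled, vertex 0 keeps its label under either digit and the gap at
  \<open>k\<close> moves down by one. Within \<open>n\<close> steps some gap stands at 1 next to a
  labelled vertex 0, and that bisection lowers the count.\<close>

lemma missing_decrease:
  assumes "A 0" "\<not> A k" "1 \<le> k" "k \<le> n" "length a = n"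
  shows "missing (fold label_step a A) < missing A"
proof -
  have "missing (fold label_step w A) < missing A"
    if "A 0" "\<not> A k" "1 \<le> k" "k \<le> n" "length w \<ge> k" for w A k
    using that
  proof (induction w arbitrary: k A)
    case (Cons b w)
    show ?case
    proof (cases "A 1")
      case False
      have "missing (fold label_step w (label_step b A)) \<le> missing (label_step b A)"
          by (rule missing_fold)
      also have "\<dots> < missing A" using Cons.prems(1) False by (rule missing_label_step)
      finally show ?thesis by simp
    next
      case True
      then have k: "2 \<le> k" using Cons.prems by (metis One_nat_def Suc_1 Suc_leI le_neq_implies_less)
      have "missing (fold label_step w (label_step b A)) < missing (label_step b A)"
        using Cons.prems True k by (intro Cons.IH[of _ "k - 1"]) (auto simp: label_step_def hi_def)
      also have "\<dots> \<le> missing A" by (rule missing_label_step)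
      finally show ?thesis by simp
    qed
  qed simp
  then show ?thesis using assms by blast
qed

lemma label_step_all: "\<forall>k\<le>n. A k \<Longrightarrow> \<forall>k\<le>n. label_step b A k"
  using n_pos by (auto simp: label_step_def)

lemma fold_label_step_all: "\<forall>k\<le>n. A k \<Longrightarrow> \<forall>k\<le>n. fold label_step a A k"
  by (induction a arbitrary: A) (simp_all add: label_step_all)

lemma fold_label_step_cover: "A 0 \<or> B 0 \<Longrightarrow> (\<And>k. k \<le> n \<Longrightarrow> A k \<or> B k) \<Longrightarrow> k \<le> n \<Longrightarrow>
    fold label_step a A k \<or> fold label_step a B k"
proof (induction a arbitrary: A B)
  case (Cons b a)
  show ?case unfolding fold.simps o_apply
    using Cons.prems n_pos by (intro Cons.IH) (auto simp: label_step_def hi_def)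
qed auto

text \<open>As long as neither label is everywhere, one that is present at vertex 0 has a gap
  elsewhere, so \<open>n\<close> steps lower the joint count. At count 0 only vertex 0 can lack a
  label, and it has one of the two. A joint count of at most \<open>2 * n\<close> gives the length
  \<open>2 * n * n\<close>.\<close>

lemma two_labels:
  assumes "\<And>k. k \<le> n \<Longrightarrow> A k \<or> B k" "missing A + missing B \<le> m" "m * n \<le> length a"
  shows "(\<forall>k\<le>n. fold label_step a A k) \<or> (\<forall>k\<le>n. fold label_step a B k)"
  using assms
proof (induction m arbitrary: A B a)
  case 0
  have "A k \<and> B k" if "k \<in> {1..n}" for k
  proof -
    have "{k \<in> {1..n}. \<not> A k} = {}" "{k \<in> {1..n}. \<not> B k} = {}"
      using 0 by (auto simp: missing_def)
    then show ?thesis using that by blast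
  qed
  then have "(\<forall>k\<le>n. A k) \<or> (\<forall>k\<le>n. B k)"
    using 0(1)[of 0] by (metis One_nat_def Suc_leI atLeastAtMost_iff le0 not_gr_zero)
  then show ?case using fold_label_step_all by blast
next
  case (Suc m)
  show ?case
  proof (cases "(\<forall>k\<le>n. A k) \<or> (\<forall>k\<le>n. B k)")
    case True
    then show ?thesis using fold_label_step_all by blast
  next
    case False
    define w where "w = take n a"
    have w: "length w = n" using Suc.prems(3) by (simp add: w_def)
    have "missing (fold label_step w A) + missing (fold label_step w B) < missing A + missing B"
    proof (cases "A 0")
      case True
      then obtain k where "1 \<le> k" "k \<le> n" "\<not> A k"
        using False by (metis One_nat_def Suc_leI not_gr_zero)
      then show ?thesis using missing_decrease[of A k w] True w missing_fold[of w B] by linarith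
    next
      case *: False
      then have "B 0" using Suc.prems(1)[of 0] by simp
      moreover from this obtain k where "1 \<le> k" "k \<le> n" "\<not> B k"
        using False by (metis One_nat_def Suc_leI not_gr_zero)
      ultimately show ?thesis using missing_decrease[of B k w] w missing_fold[of w A] by linarith
    qed
    then have "(\<forall>k\<le>n. fold label_step (drop n a) (fold label_step w A) k) \<or> (\<forall>k\<le>n. fold label_step
        (drop n a) (fold label_step w B) k)"
      using Suc.prems fold_label_step_cover[of A B _ w]
      by (intro Suc.IH) auto
    moreover have "fold label_step (drop n a) (fold label_step w C) = fold label_step a C" for C
      unfolding w_def by (metis append_take_drop_id fold_append o_apply)
    ultimately show ?thesis by simp
  qed
qed

section \<open>Contraction by bisections that are not too lopsided\<close>

primrec well_weighted :: "real \<Rightarrow> real \<Rightarrow> bool list \<Rightarrow> (nat \<Rightarrow> real) \<Rightarrow> bool" where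
  "well_weighted \<kappa> c [] d = True"
| "well_weighted \<kappa> c (b # a) d = (c * (d 0 + d 1) \<le> d 0 \<and> c * (d 0 + d 1) \<le> d 1 \<and>
    well_weighted \<kappa> c a (vertex_step \<kappa> b d))"

lemma vertex_step_nonneg: "0 < \<kappa> \<Longrightarrow> (\<And>k. k \<le> n \<Longrightarrow> 0 \<le> W k) \<Longrightarrow> k \<le> n \<Longrightarrow> 0 \<le> vertex_step \<kappa> b W k"
  using n_pos by (auto simp: vertex_step_def)

text \<open>A new vertex averages the two ends of an edge with their denominators as weights. By
  \<open>well_weighted\<close> a labelled end has at least the share \<open>c\<close>, and the other
  end cannot spoil the bound as \<open>P\<close> is nonnegative; so a step costs at most a factor
  \<open>c\<close>.\<close>

lemma labels_bound:
  assumes "0 < \<kappa>" "0 \<le> c" "c \<le> 1" "0 \<le> \<eta>" "well_weighted \<kappa> c a d"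
    and "\<And>k. k \<le> n \<Longrightarrow> 0 \<le> d k \<and> 0 \<le> P k" "\<And>k. k \<le> n \<Longrightarrow> A k \<Longrightarrow> \<eta> * d k \<le> P k"
    and "k \<le> n" "fold label_step a A k"
  shows "\<eta> * c ^ length a * fold (vertex_step \<kappa>) a d k \<le> fold (vertex_step \<kappa>) a P k"
  using assms(4-)
proof (induction a arbitrary: d P A \<eta>)
  case (Cons b a)
  have n: "n \<noteq> 0" "1 \<le> n" using n_pos by auto
  have nn: "0 \<le> d k" "0 \<le> P k" if "k \<le> n" for k using Cons.prems that by auto
  have le: "\<eta> * c * d k \<le> \<eta> * d k" if "k \<le> n" for k
    using nn[OF that] assms Cons.prems(1)
        by (simp add: mult_left_le_one_le mult.assoc mult_left_mono)
  have *: "\<eta> * c * vertex_step \<kappa> b d k \<le> vertex_step \<kappa> b P k" if k: "k \<le> n" "label_step b A k" for k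
  proof -
    consider "k = 0" | "k = n" "k \<noteq> 0" | "k \<noteq> 0" "k < n" using k by linarith
    then show ?thesis
    proof cases
      case 1
      then have "\<eta> * d (hi b) \<le> P (hi b)" using k Cons.prems by (simp add: label_step_def)
      then show ?thesis using le[of "hi b"] 1 by (simp add: vertex_step_def)
    next
      case 2
      then have "A 0 \<or> A 1" using k by (simp add: label_step_def)
      then have "\<eta> * (c * (d 0 + d 1)) \<le> P 0 + P 1"
      proof
        assume "A 0"
        then have "\<eta> * d 0 \<le> P 0" using Cons.prems by simp
        moreover have "\<eta> * (c * (d 0 + d 1)) \<le> \<eta> * d 0"
          using Cons.prems by (intro mult_left_mono) auto
        ultimately show ?thesis using nn(2)[of 1] n by simp
      next
        assume "A 1"
        then have "\<eta> * d 1 \<le> P 1" using Cons.prems n by simp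
        moreover have "\<eta> * (c * (d 0 + d 1)) \<le> \<eta> * d 1"
          using Cons.prems by (intro mult_left_mono) auto
        ultimately show ?thesis using nn(2)[of 0] by simp
      qed
      then show ?thesis using 2 assms(1) by (simp add: vertex_step_def divide_right_mono mult.assoc)
    next
      case 3
      then have "\<eta> * d (Suc k) \<le> P (Suc k)" using k Cons.prems by (simp add: label_step_def)
      then show ?thesis using le[of "Suc k"] 3 by (simp add: vertex_step_def)
    qed
  qed
  have "\<eta> * c * c ^ length a * fold (vertex_step \<kappa>) a (vertex_step \<kappa> b d) k \<le>
      fold (vertex_step \<kappa>) a (vertex_step \<kappa> b P) k"
    using Cons.prems assms(1,2) *
        by (intro Cons.IH[where A = "label_step b A"]) (auto intro: vertex_step_nonneg)
  then show ?case by (simp add: mult.assoc)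
qed simp

lemma missing_le: "missing A \<le> n"
  unfolding missing_def by (rule order_trans[OF card_mono[of "{1..n}"]]) auto

lemma narrow_contract:
  assumes "0 < \<kappa>" "0 \<le> c" "c \<le> 1" "well_weighted \<kappa> c a d" "2 * n * n \<le> length a"
    and d: "\<And>k. k \<le> n \<Longrightarrow> 0 < d k" and "narrow d N \<delta>"
  shows "narrow (fold (vertex_step \<kappa>) a d) (fold (vertex_step \<kappa>) a N) ((1 - c ^ length a / 2) * \<delta>)"
proof -
  obtain l h where lh: "h - l \<le> \<delta>" "\<And>k. k \<le> n \<Longrightarrow> l * d k \<le> N k \<and> N k \<le> h * d k"
    using assms(7) unfolding narrow_def by blast
  \<comment> \<open>\<open>P\<close> and \<open>Q\<close> measure the distance to the lower and
    upper end of the range, scaled by the denominator. They add up to \<open>(h - l) * d k\<close>,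
    so at each vertex one of them is at least half of this; that is the choice of
    \<open>\<eta>\<close> and of the labels. The redundant factors fit
    \<open>fold_vertex_step_linear\<close>.\<close>
  define P where "P = (\<lambda>k. 1 * N k + (- l) * d k)"
  define Q where "Q = (\<lambda>k. (- 1) * N k + h * d k)"
  define \<eta> where "\<eta> = (h - l) / 2"
  have "l * d 0 \<le> h * d 0" using lh(2)[of 0] by simp
  then have \<eta>: "0 \<le> \<eta>" using d[of 0] by (simp add: \<eta>_def)
  have PQ: "0 \<le> P k" "0 \<le> Q k" "P k + Q k = 2 * \<eta> * d k" if "k \<le> n" for k
    using lh(2)[OF that] by (auto simp: P_def Q_def \<eta>_def algebra_simps)
  define A where "A k = (\<eta> * d k \<le> P k)" for k
  define B where "B k = (\<eta> * d k \<le> Q k)" for k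
  have AB: "A k \<or> B k" if "k \<le> n" for k using PQ(3)[OF that] unfolding A_def B_def by linarith
  let ?d = "fold (vertex_step \<kappa>) a d" and ?N = "fold (vertex_step \<kappa>) a N"
  let ?e = "\<eta> * c ^ length a"
  \<comment> \<open>Whichever label wins, one end of the range moves inwards by \<open>?e\<close>,
    the fraction \<open>c ^ length a / 2\<close> of its length.\<close>
  have eq: "h - l - ?e = (1 - c ^ length a / 2) * (h - l)"
    by (simp add: \<eta>_def algebra_simps)
  have c1: "c ^ length a \<le> 1" using assms by (intro power_le_one) auto
  then have width: "h - l - ?e \<le> (1 - c ^ length a / 2) * \<delta>"
    unfolding eq using lh(1) by (intro mult_left_mono) auto
  have fP: "fold (vertex_step \<kappa>) a P = (\<lambda>k. ?N k - l * ?d k)"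
    unfolding P_def fold_vertex_step_linear by simp
  have fQ: "fold (vertex_step \<kappa>) a Q = (\<lambda>k. h * ?d k - ?N k)"
    unfolding Q_def fold_vertex_step_linear by simp
  have fold_nn: "\<forall>k\<le>n. 0 \<le> fold (vertex_step \<kappa>) a W k" if "\<forall>k\<le>n. 0 \<le> W k" for W
    using that by (induction a arbitrary: W) (simp_all add: vertex_step_nonneg assms(1))
  have "\<forall>k\<le>n. 0 \<le> P k" "\<forall>k\<le>n. 0 \<le> Q k" using PQ by auto
  from this[THEN fold_nn] have nnPQ: "l * ?d k \<le> ?N k" "?N k \<le> h * ?d k" if "k \<le> n" for k
    using that by (simp_all add: fP fQ)
  have "(\<forall>k\<le>n. fold label_step a A k) \<or> (\<forall>k\<le>n. fold label_step a B k)"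
    using AB missing_le[of A] missing_le[of B] assms(5) by (intro two_labels[of A B "2 * n"]) auto
  then show ?thesis
  proof
    assume all: "\<forall>k\<le>n. fold label_step a A k"
    have "(l + ?e) * ?d k \<le> ?N k" if "k \<le> n" for k
    proof -
      have "?e * ?d k \<le> fold (vertex_step \<kappa>) a P k"
        using all that PQ d \<eta> less_imp_le[OF d] assms
        by (intro labels_bound[where A = A]) (auto simp: A_def)
      then show ?thesis by (simp add: fP algebra_simps)
    qed
    then show ?thesis using nnPQ(2) width unfolding narrow_def
      by (intro exI[of _ "l + ?e"] exI[of _ h]) auto
  next
    assume all: "\<forall>k\<le>n. fold label_step a B k"
    have "?N k \<le> (h - ?e) * ?d k" if "k \<le> n" for k
    proof -
      have "?e * ?d k \<le> fold (vertex_step \<kappa>) a Q k"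
        using all that PQ d \<eta> less_imp_le[OF d] assms
        by (intro labels_bound[where A = B]) (auto simp: B_def)
      then show ?thesis by (simp add: fQ algebra_simps)
    qed
    then show ?thesis using nnPQ(1) width unfolding narrow_def
      by (intro exI[of _ l] exI[of _ "h - ?e"]) auto
  qed
qed

subsection \<open>Itineraries determine points\<close>


lemma vertex_step_one_2: "vertex_step 2 b (\<lambda>_. 1) = (\<lambda>_. 1)"
  by (auto simp: vertex_step_def)

lemma fold_vertex_step_one_2: "fold (vertex_step 2) a (\<lambda>_. 1) = (\<lambda>_. 1)"
  by (induction a) (simp_all add: vertex_step_one_2)

lemma well_weighted_one_2: "well_weighted 2 (1 / 2) a (\<lambda>_. 1)"
  by (induction a) (simp_all add: vertex_step_one_2)

lemma narrow_unit: "narrow (\<lambda>_. 1) (\<lambda>k. if k = j then 1 else 0) 1"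
  unfolding narrow_def by (intro exI[of _ 0] exI[of _ 1]) auto

lemma dist_less_of_bc:
  assumes "0 < \<epsilon>"
  obtains \<delta> where "0 < \<delta>" "\<And>x y. (\<And>k. k \<le> n \<Longrightarrow> \<bar>bc x k - bc y k\<bar> \<le> \<delta>) \<Longrightarrow> dist x y < \<epsilon>"
proof -
  define s where "s = 1 + (\<Sum>k\<le>n. norm (v k))"
  have s: "0 < s" unfolding s_def by (intro add_pos_nonneg sum_nonneg) auto
  show thesis
  proof (rule that[of "\<epsilon> / (2 * s)"])
    show "0 < \<epsilon> / (2 * s)" using assms s by simp
    fix x y assume "\<And>k. k \<le> n \<Longrightarrow> \<bar>bc x k - bc y k\<bar> \<le> \<epsilon> / (2 * s)"
    then have "dist x y \<le> \<epsilon> / (2 * s) * (\<Sum>k\<le>n. norm (v k))" by (rule dist_le_bc)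
    also have "\<dots> \<le> \<epsilon> / (2 * s) * s" using assms s by (intro mult_left_mono) (auto simp: s_def)
    also have "\<dots> < \<epsilon>" using assms s by simp
    finally show "dist x y < \<epsilon>" .
  qed
qed

text \<open>Tent cylinders have all denominators 1, so every bisection is balanced with
  \<open>c = 1 / 2\<close> and each block of \<open>L\<close> digits contracts by the same factor
  \<open>q\<close>. The depth does not depend on the word.\<close>

lemma shrink_2:
  assumes "0 < \<epsilon>"
  obtains t where "\<And>a x y. length a = t \<Longrightarrow> x \<in> cyl 2 a \<Longrightarrow> y \<in> cyl 2 a \<Longrightarrow> dist x y < \<epsilon>"
proof -
  define L where "L = 2 * n * n"
  define q :: real where "q = 1 - (1 / 2) ^ L / 2"
  have "(1 / 2 :: real) ^ L \<le> 1" by (simp add: power_le_one)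
  then have q: "0 \<le> q" "q < 1" by (simp_all add: q_def)
  have *: "narrow (\<lambda>_. 1) (fold (vertex_step 2) a (\<lambda>k. if k = j then 1 else 0)) (q ^ m)"
    if "length a = m * L" for m a j
    using that
  proof (induction m arbitrary: a)
    case 0
    then show ?case by (simp add: narrow_unit)
  next
    case (Suc m)
    let ?w = "drop (m * L) a"
    have w: "length ?w = L" using Suc.prems by simp
    let ?N = "fold (vertex_step 2) (take (m * L) a) (\<lambda>k. if k = j then 1 else 0)"
    have "narrow (\<lambda>_. 1) ?N (q ^ m)" using Suc by simp
    then have "narrow (fold (vertex_step 2) ?w (\<lambda>_. 1)) (fold (vertex_step 2) ?w ?N) ((1 -
        (1 / 2) ^ length ?w / 2) * q ^ m)"
      using w by (intro narrow_contract well_weighted_one_2) (simp_all add: L_def)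
    then have "narrow (fold (vertex_step 2) ?w (\<lambda>_. 1)) (fold (vertex_step 2) ?w ?N) (q * q ^ m)"
      by (simp only: w q_def)
    moreover have "fold (vertex_step 2) ?w ?N = fold (vertex_step 2) a (\<lambda>k. if k = j then 1 else 0)"
      by (metis append_take_drop_id fold_append o_apply)
    ultimately show ?case by (simp add: fold_vertex_step_one_2)
  qed
  obtain \<delta> where \<delta>: "0 < \<delta>" "\<And>x y. (\<And>k. k \<le> n \<Longrightarrow> \<bar>bc x k - bc y k\<bar> \<le> \<delta>) \<Longrightarrow> dist x y < \<epsilon>"
    using dist_less_of_bc[OF assms] by blast
  obtain m where m: "q ^ m < \<delta>" using real_arch_pow_inv[OF \<delta>(1) q(2)] by blast
  show thesis
  proof (rule that[of "m * L"], rule \<delta>(2))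
    fix a x y k
    assume a: "length a = m * L" "x \<in> cyl 2 a" "y \<in> cyl 2 a" and k: "k \<le> n"
    have "\<bar>bc x k - bc y k\<bar> \<le> q ^ m"
      using a k *[OF a(1), of k] narrow_bc_diff[of 2 k x a y "q ^ m"]
          unfolding fold_vertex_step_one_2 by simp
    with m show "\<bar>bc x k - bc y k\<bar> \<le> \<delta>" by simp
  qed
qed

text \<open>
  This is the invariant of the denominators \<open>d\<close> of the vertices of a Moenkemeyer cylinder.  After
  a digit 1 it puts all of them between \<open>d 0\<close> and \<open>2 * d 0\<close>, so the next bisections are
  comparable to bisections at the midpoint.
\<close>

definition balanced :: "(nat \<Rightarrow> real) \<Rightarrow> bool" where
  "balanced d \<longleftrightarrow> 0 < d 0 \<and> (\<forall>i j. i \<le> j \<longrightarrow> j \<le> n \<longrightarrow> d i \<le> d j) \<and> d n \<le> d 0 + d 1"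

lemma balanced_pos: "balanced d \<Longrightarrow> k \<le> n \<Longrightarrow> 0 < d k"
  unfolding balanced_def by (meson le0 order_less_le_trans)

text \<open>The bound \<open>d n \<le> d 0 + d 1\<close> is what allows the mediant to take the last
  place in the increasing order of denominators.\<close>

lemma balanced_vertex_step:
  assumes "balanced d" shows "balanced (vertex_step 1 b d)"
proof -
  have mono: "\<And>i j. i \<le> j \<Longrightarrow> j \<le> n \<Longrightarrow> d i \<le> d j" and d0: "0 < d 0" "d n \<le> d 0 + d 1"
    using assms by (auto simp: balanced_def)
  have h: "d 0 \<le> d (hi b)" "d (hi b) \<le> d 1" using mono[of 0 1] n_pos by (auto simp: hi_def)
  have s1: "d 1 \<le> vertex_step 1 b d k" if "1 \<le> k" "k \<le> n" for k
    using that d0 mono[of 1 "Suc k"] by (auto simp: vertex_step_def)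
  have "vertex_step 1 b d i \<le> vertex_step 1 b d j" if ij: "i \<le> j" "j \<le> n" for i j
  proof (cases "i = 0")
    case True
    then show ?thesis using ij h s1[of j] by (cases "j = 0") (auto simp: vertex_step_def)
  next
    case False
    then show ?thesis
      using ij mono[of "Suc i" "Suc j"] mono[of "Suc i" n] d0 by (auto simp: vertex_step_def)
  qed
  moreover have "vertex_step 1 b d n \<le> vertex_step 1 b d 0 + vertex_step 1 b d 1"
  proof (cases "n = 1")
    case True
    moreover have "0 \<le> vertex_step 1 b d 0" using d0 h by (simp add: vertex_step_def)
    ultimately show ?thesis by simp
  next
    case False
    then have "d 1 \<le> d 2" using n_pos by (intro mono) auto
    then show ?thesis using False n_pos d0 mono[of 0 1]
        by (auto simp: vertex_step_def hi_def numeral_2_eq_2)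
  qed
  ultimately show ?thesis using d0 h by (auto simp: balanced_def vertex_step_def)
qed

lemma balanced_fold: "balanced d \<Longrightarrow> balanced (fold (vertex_step 1) a d)"
  by (induction a arbitrary: d) (simp_all add: balanced_vertex_step)

lemma balanced_one: "balanced (\<lambda>_. 1)"
  by (simp add: balanced_def)

text \<open>A step keeps the lower bound \<open>p\<close> and at most doubles the largest
  denominator. The exponent \<open>m\<close> tracks this growth, and one further factor 2 pays for
  the sum of two denominators.\<close>

lemma well_weighted_bounded:
  assumes "0 < p" "0 \<le> c"
    and "\<And>k. k \<le> n \<Longrightarrow> p \<le> d k \<and> d k \<le> 2 ^ m * p" "c * 2 ^ (m + length a + 1) \<le> 1"
  shows "well_weighted 1 c a d"
  using assms(3,4)
proof (induction a arbitrary: d m)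
  case (Cons b a)
  have b: "p \<le> d 0" "p \<le> d 1" "d 0 \<le> 2 ^ m * p" "d 1 \<le> 2 ^ m * p"
    using Cons.prems(1) n_pos by auto
  have "c * (d 0 + d 1) \<le> c * (2 ^ (m + 1) * p)"
    using b assms(2) by (intro mult_left_mono) auto
  also have "\<dots> \<le> c * (2 ^ (m + length (b # a) + 1) * p)"
    using assms(1,2) by (intro mult_left_mono mult_right_mono power_increasing) auto
  also have "\<dots> \<le> p"
    using mult_right_mono[OF Cons.prems(2), of p] assms(1) by (simp add: mult.assoc)
  finally have "c * (d 0 + d 1) \<le> p" .
  moreover have "well_weighted 1 c a (vertex_step 1 b d)"
  proof (rule Cons.IH[of _ "Suc m"])
    have m: "(2::real) ^ m * p \<le> 2 ^ Suc m * p" using assms(1) by simp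
    show "p \<le> vertex_step 1 b d k \<and> vertex_step 1 b d k \<le> 2 ^ Suc m * p" if "k \<le> n" for k
      using that Cons.prems(1)[of "Suc k"] b m assms(1) by (auto simp: vertex_step_def hi_def)
    show "c * 2 ^ (Suc m + length a + 1) \<le> 1" using Cons.prems(2) by simp
  qed
  ultimately show ?case using b by simp
qed simp

lemma vertex_step_cong:
  assumes "\<And>k. k \<le> n \<Longrightarrow> W k = U k" "k \<le> n"
  shows "vertex_step \<kappa> b W k = vertex_step \<kappa> b U k"
proof -
  have "W (hi b) = U (hi b)" "W 0 = U 0" "W 1 = U 1" "k \<noteq> n \<Longrightarrow> W (Suc k) = U (Suc k)"
    using assms n_pos by (blast intro: hi_lo_le, blast, blast, simp)
  then show ?thesis unfolding vertex_step_def by presburger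
qed

lemma fold_vertex_step_cong:
  "(\<And>k. k \<le> n \<Longrightarrow> W k = U k) \<Longrightarrow> k \<le> n \<Longrightarrow> fold (vertex_step \<kappa>) a W k = fold (vertex_step \<kappa>) a U k"
proof (induction a arbitrary: W U)
  case (Cons b a)
  show ?case unfolding fold.simps o_apply
  proof (rule Cons.IH)
    show "vertex_step \<kappa> b W k = vertex_step \<kappa> b U k" if "k \<le> n" for k
      using Cons.prems(1) that by (rule vertex_step_cong)
  qed (rule Cons.prems)
qed simp

section \<open>Runs of the digit 0 for the Moenkemeyer map\<close>

lemma fold_replicate_False:
  assumes "i \<le> n" "k \<le> n"
  shows "fold (vertex_step 1) (replicate i False) W k =
    (if k = 0 then W 0 else if k + i \<le> n then W (k + i) else W (k + i - n) + W 0)"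
  using assms
proof (induction i arbitrary: k)
  case (Suc i)
  let ?U = "fold (vertex_step 1) (replicate i False) W"
  have eq: "fold (vertex_step 1) (replicate (Suc i) False) W k = vertex_step 1 False ?U k"
    by (simp flip: replicate_append_same del: fold_replicate)
  show ?case unfolding eq using Suc n_pos
    by (auto simp: vertex_step_def[of 1 False ?U] hi_def simp del: fold_replicate)
qed simp

text \<open>Digit 0 fixes vertex 0 and sends the others round in a cycle, each picking up one copy
  of vertex 0 per \<open>n\<close> digits. Growth is linear here, not geometric.\<close>

lemma fold_replicate_False_pass:
  "k \<le> n \<Longrightarrow> fold (vertex_step 1) (replicate (m * n) False) W k = (if k =
      0 then W 0 else W k + of_nat m * W 0)"
proof (induction m arbitrary: W)
  case (Suc m)
  let ?U = "\<lambda>k. if k = 0 then W 0 else W k + W 0"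
  have "fold (vertex_step 1) (replicate (Suc m * n) False) W k =
      fold (vertex_step 1) (replicate (m * n) False) (fold (vertex_step 1) (replicate n False) W) k"
    by (simp add: replicate_add del: fold_replicate)
  also have "\<dots> = fold (vertex_step 1) (replicate (m * n) False) ?U k"
    using Suc.prems by (intro fold_vertex_step_cong)
        (auto simp: fold_replicate_False simp del: fold_replicate)
  also have "\<dots> = (if k = 0 then W 0 else ?U k + of_nat m * W 0)"
    using Suc.IH[of ?U] Suc.prems by simp
  finally show ?case by (simp add: algebra_simps del: fold_replicate)
qed simp

section \<open>Shrinking of cylinders along an itinerary\<close>

definition prefix_word :: "(nat \<Rightarrow> bool) \<Rightarrow> nat \<Rightarrow> bool list" where
  "prefix_word s t = map s [0..<t]"

lemma length_prefix_word [simp]: "length (prefix_word s t) = t"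
  by (simp add: prefix_word_def)

lemma prefix_word_add: "prefix_word s (t + m) = prefix_word s t @ map s [t..<t + m]"
  by (simp add: prefix_word_def upt_add_eq_append[of 0 t m])

lemma fold_prefix_word_add: "fold f (prefix_word s (t + m)) x =
    fold f (map s [t..<t + m]) (fold f (prefix_word s t) x)"
  by (simp add: prefix_word_add)

lemma narrow_prefix_word_mono:
  assumes "0 < \<kappa>" "narrow (fold (vertex_step \<kappa>) (prefix_word s t) d) (fold (vertex_step \<kappa>)
      (prefix_word s t) N) \<delta>" "t \<le> t'"
  shows "narrow (fold (vertex_step \<kappa>) (prefix_word s t') d) (fold (vertex_step \<kappa>)
      (prefix_word s t') N) \<delta>"
proof -
  obtain m where "t' = t + m" using assms(3) le_Suc_ex by blast
  with narrow_fold[OF assms(1,2), of "map s [t..<t + m]"] show ?thesis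
    unfolding fold_prefix_word_add[symmetric] by blast
qed

text \<open>Contraction is gained only in the \<open>L\<close> digits after a digit 1, where the
  denominators are comparable. The digits in between do no harm since ranges never widen, and
  infinitely many digits 1 supply as many blocks as required.\<close>

lemma narrow_1_frequently:
  fixes s j
  defines "D t \<equiv> fold (vertex_step 1) (prefix_word s t) (\<lambda>_. 1)"
    and "N t \<equiv> fold (vertex_step 1) (prefix_word s t) (\<lambda>k. if k = j then 1 else 0)"
  assumes s: "\<And>t. \<exists>t'\<ge>t. s t'" and "0 < \<epsilon>"
  shows "\<exists>t. narrow (D t) (N t) \<epsilon>"
proof -
  define L where "L = 2 * n * n"
  \<comment> \<open>Just after a digit 1 the denominators differ by a factor of at most 2, and
    \<open>L\<close> steps contribute at most \<open>2 ^ L\<close>; the last factor 2 covers the sum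
    in \<open>well_weighted\<close>.\<close>
  define c :: real where "c = 1 / 2 ^ (L + 2)"
  define q where "q = 1 - c ^ L / 2"
  have "1 \<le> (2::real) ^ L" by simp
  then have c: "0 < c" "c \<le> 1" by (simp_all add: c_def del: one_le_power)
  have "c ^ L \<le> 1" using c by (simp add: power_le_one)
  then have q: "0 \<le> q" "q < 1" using c by (simp_all add: q_def)
  have bal: "balanced (D t)" for t unfolding D_def by (intro balanced_fold balanced_one)
  have "\<exists>t. narrow (D t) (N t) (q ^ m)" for m
  proof (induction m)
    case 0
    show ?case by (rule exI[of _ 0]) (simp add: D_def N_def prefix_word_def narrow_unit)
  next
    case (Suc m)
    then obtain t where t: "narrow (D t) (N t) (q ^ m)" by blast
    obtain u where u: "t \<le> u" "s u" using s by blast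
    let ?w = "map s [Suc u..<Suc u + L]"
    have w: "length ?w = L" by simp
    have Du: "D (Suc u) = vertex_step 1 True (D u)" using u by (simp add: D_def prefix_word_def)
    have "narrow (D (Suc u)) (N (Suc u)) (q ^ m)"
      using narrow_prefix_word_mono[of 1 s t _ _ _ "Suc u"] t u(1) by (auto simp: D_def N_def)
    moreover have "well_weighted 1 c ?w (D (Suc u))"
    \<comment> \<open>The digit 1 at \<open>u\<close> discards vertex 0, and \<open>D u 1\<close>
      becomes the smallest denominator.\<close>
    proof (rule well_weighted_bounded[where p = "D u 1" and m = 1])
      show "0 < D u 1" "0 \<le> c" using balanced_pos[OF bal] n_pos c by auto
      show "c * 2 ^ (1 + length ?w + 1) \<le> 1" by (simp add: c_def)
      have b: "D u 0 \<le> D u 1" "D u n \<le> D u 0 + D u 1" "0 < D u 0"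
        using bal[of u] n_pos by (auto simp: balanced_def)
      show "D u 1 \<le> D (Suc u) k \<and> D (Suc u) k \<le> 2 ^ 1 * D u 1" if "k \<le> n" for k
      proof (cases "k = 0 \<or> k = n")
        case True
        then show ?thesis using b unfolding Du by (auto simp: vertex_step_def hi_def)
      next
        case False
        then have "D u 1 \<le> D u (Suc k)" "D u (Suc k) \<le> D u n"
          using bal[of u] that by (simp_all add: balanced_def)
        then show ?thesis using b False unfolding Du by (simp add: vertex_step_def)
      qed
    qed
    ultimately have "narrow (fold (vertex_step 1) ?w (D (Suc u))) (fold (vertex_step 1) ?w (N
        (Suc u)))
        ((1 - c ^ length ?w / 2) * q ^ m)"
      using c balanced_pos[OF bal] by (intro narrow_contract) (simp_all add: L_def)
    then have "narrow (D (Suc u + L)) (N (Suc u + L)) (q ^ Suc m)"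
      unfolding w D_def N_def fold_prefix_word_add by (simp add: q_def)
    then show ?case by blast
  qed
  moreover obtain m where "q ^ m < \<epsilon>" using real_arch_pow_inv[OF \<open>0 < \<epsilon>\<close> q(2)] by blast
  ultimately show ?thesis using narrow_mono less_imp_le by blast
qed

text \<open>In a tail of zeros all vertices of the cylinder approach its vertex 0: the quotients of
  \<open>N0 k + m * N0 0\<close> by \<open>d k + m * d 0\<close> tend to \<open>r\<close>. The error
  is only of order \<open>1 / m\<close>, which dictates the choice of \<open>m\<close>.\<close>

lemma narrow_1_eventually:
  fixes s j
  defines "D t \<equiv> fold (vertex_step 1) (prefix_word s t) (\<lambda>_. 1)"
    and "N t \<equiv> fold (vertex_step 1) (prefix_word s t) (\<lambda>k. if k = j then 1 else 0)"
  assumes s: "\<And>t. T \<le> t \<Longrightarrow> \<not> s t" and "0 < \<epsilon>"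
  shows "\<exists>t. narrow (D t) (N t) \<epsilon>"
proof -
  define d N0 where "d = D T" and "N0 = N T"
  have bal: "balanced d" unfolding d_def D_def by (intro balanced_fold balanced_one)
  have d0: "0 < d 0" using bal by (simp add: balanced_def)
  define r where "r = N0 0 / d 0"
  have N0: "0 \<le> N0 k \<and> N0 k \<le> d k" if "k \<le> n" for k
  proof -
    have nn: "\<forall>k\<le>n. 0 \<le> fold (vertex_step 1) a W k" if "\<forall>k\<le>n. 0 \<le> W k" for a W
      using that by (induction a arbitrary: W) (simp_all add: vertex_step_nonneg)
    let ?W = "\<lambda>k. if k = j then 1 else (0::real)"
    have "0 \<le> fold (vertex_step 1) (prefix_word s T) ?W k" using nn[of ?W] that by simp
    \<comment> \<open>Nonnegativity for one minus the indicator gives the upper bound for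
      \<open>N0\<close>.\<close>
    moreover have "0 \<le> fold (vertex_step 1) (prefix_word s T) (\<lambda>k. 1 * 1 + (- 1) * ?W k) k"
      using that by (intro nn[rule_format]) auto
    ultimately show ?thesis unfolding fold_vertex_step_linear
        by (simp add: d_def N0_def D_def N_def)
  qed
  have r: "0 \<le> r" "r \<le> 1" using N0[of 0] d0 by (simp_all add: r_def)
  obtain m :: nat where m: "d n / (d 0 * \<epsilon> / 2) < m" using reals_Archimedean2 by blast
  have "map s [T..<T + m * n] = replicate (m * n) False"
    using s by (intro nth_equalityI) auto
  then have D: "D (T + m * n) k = (if k = 0 then d 0 else d k + m * d 0)"
    and N: "N (T + m * n) k = (if k = 0 then N0 0 else N0 k + m * N0 0)" if "k \<le> n" for k
    using that unfolding D_def N_def fold_prefix_word_add d_def N0_def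
    by (simp_all only: fold_replicate_False_pass)
  have N00: "N0 0 = r * d 0" using d0 by (simp add: r_def)
  have "\<bar>N (T + m * n) k - r * D (T + m * n) k\<bar> \<le> \<epsilon> / 2 * D (T + m * n) k" if k: "k \<le> n" for k
  proof (cases "k = 0")
    case True
    then show ?thesis using D[of 0] N[of 0] N00 \<open>0 < \<epsilon>\<close> d0 by simp
  next
    case False
    have dk: "0 < d k" using balanced_pos[OF bal k] .
    have "r * d k \<le> d k" using r dk by simp
    moreover have "0 \<le> r * d k" using r dk by simp
    ultimately have "\<bar>N0 k - r * d k\<bar> \<le> d k" using N0[OF k] by linarith
    also have "\<dots> \<le> d n" using bal k by (simp add: balanced_def)
    also have "\<dots> \<le> m * (d 0 * \<epsilon> / 2)"
      using m d0 \<open>0 < \<epsilon>\<close> by (simp add: pos_divide_less_eq less_imp_le)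
    also have "\<dots> \<le> \<epsilon> / 2 * (d k + m * d 0)"
      using dk \<open>0 < \<epsilon>\<close> by (simp add: algebra_simps)
    finally show ?thesis using False D[OF k] N[OF k] N00 by (simp add: algebra_simps)
  qed
  note bound = this
  have "(r - \<epsilon> / 2) * D (T + m * n) k \<le> N (T + m * n) k \<and>
      N (T + m * n) k \<le> (r + \<epsilon> / 2) * D (T + m * n) k" if "k \<le> n" for k
    using abs_le_D1[OF bound[OF that]] abs_le_D2[OF bound[OF that]]
    by (simp add: left_diff_distrib distrib_right)
  then have "narrow (D (T + m * n)) (N (T + m * n)) \<epsilon>"
    unfolding narrow_def by (intro exI[of _ "r - \<epsilon> / 2"] exI[of _ "r + \<epsilon> / 2"]) auto
  then show ?thesis by blast
qed

lemma cyl_prefix_word_antimono: "t \<le> t' \<Longrightarrow> cyl \<kappa> (prefix_word s t') \<subseteq> cyl \<kappa> (prefix_word s t)"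
  using prefix_word_add[of s t "t' - t"] cyl_prefix by simp

text \<open>The depth is found for each coordinate separately, with a case distinction on whether
  \<open>s\<close> has infinitely many digits 1. The maximum serves all coordinates because ranges
  never widen.\<close>

lemma shrink_1:
  assumes "0 < \<epsilon>"
  shows "\<exists>t. \<forall>x\<in>cyl 1 (prefix_word s t). \<forall>y\<in>cyl 1 (prefix_word s t). dist x y < \<epsilon>"
proof -
  obtain \<delta> where \<delta>: "0 < \<delta>" "\<And>x y. (\<And>k. k \<le> n \<Longrightarrow> \<bar>bc x k - bc y k\<bar> \<le> \<delta>) \<Longrightarrow> dist x y < \<epsilon>"
    using dist_less_of_bc[OF assms] by blast
  have "\<exists>t. narrow (fold (vertex_step 1) (prefix_word s t) (\<lambda>_. 1)) (fold (vertex_step 1)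
      (prefix_word s t) (\<lambda>k. if k = j then 1 else 0)) \<delta>" for j
  proof (cases "\<forall>T. \<exists>t\<ge>T. s t")
    case True
    then show ?thesis using narrow_1_frequently[of s \<delta> j] \<delta>(1) by blast
  next
    case False
    then obtain T where T: "\<And>t. T \<le> t \<Longrightarrow> \<not> s t" by blast
    show ?thesis using narrow_1_eventually[of T s \<delta> j, OF T \<delta>(1)] by simp
  qed
  then obtain t where
    t: "\<And>j. narrow (fold (vertex_step 1) (prefix_word s (t j)) (\<lambda>_. 1)) (fold (vertex_step 1)
        (prefix_word s (t j)) (\<lambda>k. if k = j then 1 else 0)) \<delta>"
    by metis
  define T where "T = Max (t ` {..n})"
  have T: "t j \<le> T" if "j \<le> n" for j using that by (auto simp: T_def)
  have "dist x y < \<epsilon>" if "x \<in> cyl 1 (prefix_word s T)" "y \<in> cyl 1 (prefix_word s T)" for x y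
  proof (rule \<delta>(2))
    fix k assume "k \<le> n"
    then show "\<bar>bc x k - bc y k\<bar> \<le> \<delta>"
      using that narrow_prefix_word_mono[OF _ t T, of k] by (intro narrow_bc_diff) auto
  qed
  then show ?thesis by blast
qed

lemma shrink:
  assumes "\<kappa> \<in> {1, 2}" "0 < \<epsilon>"
  shows "\<exists>t. \<forall>x\<in>cyl \<kappa> (prefix_word s t). \<forall>y\<in>cyl \<kappa> (prefix_word s t). dist x y < \<epsilon>"
proof (cases "\<kappa> = 1")
  case True
  then show ?thesis using shrink_1[OF assms(2)] by simp
next
  case False
  obtain t where "\<And>a x y. length a = t \<Longrightarrow> x \<in> cyl 2 a \<Longrightarrow> y \<in> cyl 2 a \<Longrightarrow> dist x y < \<epsilon>"
    using shrink_2[OF assms(2)] by blast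
  then show ?thesis using False assms(1) length_prefix_word[of s t] by blast
qed

section \<open>The point with a given itinerary\<close>

definition point_of :: "real \<Rightarrow> (nat \<Rightarrow> bool) \<Rightarrow> 'a" where
  "point_of \<kappa> s = (THE p. p \<in> (\<Inter>t. cyl \<kappa> (prefix_word s t)))"

lemma point_of_unique:
  assumes \<kappa>: "\<kappa> \<in> {1, 2}" and "\<And>t. x \<in> cyl \<kappa> (prefix_word s t)" "\<And>t. y \<in> cyl \<kappa> (prefix_word s t)"
  shows "x = y"
proof (rule ccontr)
  assume "x \<noteq> y"
  then have "0 < dist x y" by simp
  from shrink[OF \<kappa> this, of s] obtain t
    where "\<forall>x'\<in>cyl \<kappa> (prefix_word s t). \<forall>y'\<in>cyl \<kappa> (prefix_word s t). dist x' y' < dist x y" by blast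
  with assms(2)[of t] assms(3)[of t] show False by blast
qed

lemma point_of_exists:
  assumes "0 < \<kappa>" shows "\<exists>p. \<forall>t. p \<in> cyl \<kappa> (prefix_word s t)"
proof -
  have "(\<Inter>t. cyl \<kappa> (prefix_word s t)) \<noteq> {}"
    by (rule compact_nest) (simp_all add: compact_cyl cyl_nonempty assms cyl_prefix_word_antimono)
  then show ?thesis by auto
qed

lemma point_of_in:
  assumes "\<kappa> \<in> {1, 2}" shows "point_of \<kappa> s \<in> cyl \<kappa> (prefix_word s t)"
proof -
  obtain p where p: "\<And>t. p \<in> cyl \<kappa> (prefix_word s t)"
      using point_of_exists[of 1 s] point_of_exists[of 2 s] assms by auto
  have "point_of \<kappa> s \<in> (\<Inter>t. cyl \<kappa> (prefix_word s t))"
    unfolding point_of_def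
  proof (rule theI)
    show "p \<in> (\<Inter>t. cyl \<kappa> (prefix_word s t))" using p by simp
    show "x = p" if "x \<in> (\<Inter>t. cyl \<kappa> (prefix_word s t))" for x
      using that p by (intro point_of_unique[OF assms, of x s p]) simp_all
  qed
  then show ?thesis by simp
qed

lemma point_of_eqI: "\<kappa> \<in> {1, 2} \<Longrightarrow> (\<And>t. x \<in> cyl \<kappa> (prefix_word s t)) \<Longrightarrow> point_of \<kappa> s = x"
  by (rule point_of_unique[OF _ point_of_in])

subsection \<open>The conjugacy\<close>


lemma supp_inv_word:
  assumes "0 < \<kappa>" "0 < \<kappa>'" "y \<in> base_simplex" "j \<le> n"
  shows "0 < bc (inv_word \<kappa> a y) j \<longleftrightarrow> 0 < bc (inv_word \<kappa>' a y) j"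
  using assms(4)
proof (induction a arbitrary: j)
  case (Cons b a)
  have le: "j - 1 \<le> n" using Cons.prems by simp
  show ?case
    using Cons.IH[of 0] Cons.IH[of n] Cons.IH[OF le] Cons.prems assms inv_word_in
    by (simp add: bc_inv_branch_pos_iff)
qed simp

lemma supp_inv_word_0:
  assumes "0 < \<kappa>" "0 < \<kappa>'" "y \<in> base_simplex" "j \<le> n"
  shows "bc (inv_word \<kappa> a y) j = 0 \<longleftrightarrow> bc (inv_word \<kappa>' a y) j = 0"
  using supp_inv_word[OF assms, of a] bc_nonneg[OF inv_word_in[OF assms(1,3)] assms(4), of a]
    bc_nonneg[OF inv_word_in[OF assms(2,3)] assms(4), of a] by linarith

text \<open>The gluing of cylinders is combinatorial, hence the conjugacy is well defined.\<close>

lemma inv_word_eq_transfer: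
  assumes "0 < \<kappa>" "0 < \<kappa>'" "length a = length b" "z \<in> base_simplex"
      "inv_word \<kappa> a z = inv_word \<kappa> b z"
  shows "inv_word \<kappa>' a z = inv_word \<kappa>' b z"
  using assms(3,5)
proof (induction a b rule: list_induct2)
  case (Cons x xs y ys)
  note in\<kappa> = inv_word_in[OF assms(1,4)]
  have eq: "inv_branch \<kappa> x (inv_word \<kappa> xs z) = inv_branch \<kappa> y (inv_word \<kappa> ys z)" using Cons.prems
      by simp
  show ?case
  proof (cases "x = y")
    case True
    then have "inv_word \<kappa> xs z = inv_word \<kappa> ys z"
      using eq inv_branch_eq_iff[OF assms(1) in\<kappa> in\<kappa>] by simp
    then show ?thesis using Cons.IH True by simp
  next
    case False
    \<comment> \<open>Distinct digits glue only along the facet where coordinate 0 vanishes, and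
      whether it vanishes does not depend on the weight.\<close>
    have "inv_word \<kappa> xs z = inv_word \<kappa> ys z" "bc (inv_word \<kappa> xs z) 0 = 0"
      using eq unfolding inv_branch_eq_neq[OF assms(1) in\<kappa> in\<kappa> False] by blast+
    then have "inv_word \<kappa>' xs z = inv_word \<kappa>' ys z" "bc (inv_word \<kappa>' xs z) 0 = 0"
      using Cons.IH supp_inv_word_0[OF assms(1,2,4), of 0 xs] by simp_all
    then show ?thesis using inv_branch_agree[of "inv_word \<kappa>' xs z" \<kappa>' x y] by simp
  qed
qed simp

lemma step_map_in: "0 < \<kappa> \<Longrightarrow> x \<in> base_simplex \<Longrightarrow> step_map \<kappa> x \<in> base_simplex"
  using half_cover[of x] branch_in by (auto simp: step_map_def)

lemma funpow_step_map_in: "0 < \<kappa> \<Longrightarrow> x \<in> base_simplex \<Longrightarrow> (step_map \<kappa> ^^ i) x \<in> base_simplex"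
  by (induction i) (auto simp: step_map_in)

lemma \<kappa>_pos: "\<kappa> \<in> {1, 2} \<Longrightarrow> 0 < (\<kappa>::real)"
  by auto

lemma point_of_simplex: "\<kappa> \<in> {1, 2} \<Longrightarrow> point_of \<kappa> s \<in> base_simplex"
  using point_of_in cyl_simplex by blast

lemma point_of_surj:
  assumes "\<kappa> \<in> {1, 2}" "x \<in> base_simplex"
  obtains s where "point_of \<kappa> s = x"
proof -
  define s where "s i \<longleftrightarrow> (step_map \<kappa> ^^ i) x \<notin> half False" for i
  have "(step_map \<kappa> ^^ i) x \<in> half (s i)" for i
    using half_cover[OF funpow_step_map_in[OF \<kappa>_pos[OF assms(1)] assms(2), of i]]
    by (cases "s i") (auto simp: s_def)
  then have "x \<in> cyl \<kappa> (prefix_word s t)" for t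
    using assms(2) by (simp add: cyl_def prefix_word_def)
  then have "point_of \<kappa> s = x" by (rule point_of_eqI[OF assms(1)])
  then show thesis by (rule that)
qed

text \<open>The position of \<open>x\<close> inside either cylinder is its iterate of order
  \<open>length a\<close>, the same \<open>z\<close> for both words. The point with position
  \<open>z\<close> in the cylinders of \<open>\<kappa>'\<close> is the required one.\<close>

lemma cyl_common:
  assumes "0 < \<kappa>" "0 < \<kappa>'" "length a = length b" "x \<in> cyl \<kappa> a" "x \<in> cyl \<kappa> b"
  obtains y where "y \<in> cyl \<kappa>' a" "y \<in> cyl \<kappa>' b" "\<And>j. j \<le> n \<Longrightarrow> bc y j = 0 \<longleftrightarrow> bc x j = 0"
proof -
  define z where "z = branch_word \<kappa> a x"
  have "z = branch_word \<kappa> b x" using assms by (simp add: z_def branch_word_step_map)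
  then have z: "z \<in> base_simplex" "inv_word \<kappa> a z = x" "inv_word \<kappa> b z = x"
    using branch_word_in[OF assms(1,4)] inv_word_branch_word[OF assms(1,4)]
        inv_word_branch_word[OF assms(1,5)] by (simp_all add: z_def)
  then have "inv_word \<kappa>' a z = inv_word \<kappa>' b z" using inv_word_eq_transfer[OF assms(1-3) z(1)]
      by simp
  then show thesis
    using supp_inv_word_0[OF assms(2,1) z(1), of _ a] inv_word_in_cyl[OF assms(2) z(1), of a]
      inv_word_in_cyl[OF assms(2) z(1), of b] z(2)
    by (intro that[of "inv_word \<kappa>' a z"]) simp_all
qed

text \<open>A point with two itineraries lies in both cylinders of every depth, so the cylinders of
  the other map meet at every depth too; as these shrink, their limits coincide.\<close>

lemma point_of_transfer:
  assumes \<kappa>: "\<kappa> \<in> {1, 2}" and \<kappa>': "\<kappa>' \<in> {1, 2}" and eq: "point_of \<kappa> s = point_of \<kappa> s'"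
  shows "point_of \<kappa>' s = point_of \<kappa>' s'"
proof (rule ccontr)
  define \<epsilon> where "\<epsilon> = dist (point_of \<kappa>' s) (point_of \<kappa>' s') / 2"
  assume "point_of \<kappa>' s \<noteq> point_of \<kappa>' s'"
  then have \<epsilon>: "0 < \<epsilon>" by (simp add: \<epsilon>_def)
  obtain t1 where t1: "\<forall>x\<in>cyl \<kappa>' (prefix_word s t1). \<forall>y\<in>cyl \<kappa>' (prefix_word s t1). dist x y < \<epsilon>"
    using shrink[OF \<kappa>' \<epsilon>] by blast
  obtain t2 where t2: "\<forall>x\<in>cyl \<kappa>' (prefix_word s' t2). \<forall>y\<in>cyl \<kappa>' (prefix_word s' t2). dist x y < \<epsilon>"
    using shrink[OF \<kappa>' \<epsilon>] by blast
  define t where "t = max t1 t2"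
  have "point_of \<kappa> s \<in> cyl \<kappa> (prefix_word s t)" "point_of \<kappa> s \<in> cyl \<kappa> (prefix_word s' t)"
    using point_of_in[OF \<kappa>] eq by metis+
  then obtain y where y: "y \<in> cyl \<kappa>' (prefix_word s t)" "y \<in> cyl \<kappa>' (prefix_word s' t)"
    by (rule cyl_common[OF \<kappa>_pos[OF \<kappa>] \<kappa>_pos[OF \<kappa>'], of "prefix_word s t"
        "prefix_word s' t", rotated]) simp_all
  have sub: "cyl \<kappa>' (prefix_word s t) \<subseteq> cyl \<kappa>' (prefix_word s t1)"
      "cyl \<kappa>' (prefix_word s' t) \<subseteq> cyl \<kappa>' (prefix_word s' t2)"
    by (simp_all add: cyl_prefix_word_antimono t_def)
  have "dist (point_of \<kappa>' s) y < \<epsilon>"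
    using t1 y(1) sub(1) point_of_in[OF \<kappa>', of s t1] by blast
  moreover have "dist (point_of \<kappa>' s') y < \<epsilon>"
    using t2 y(2) sub(2) point_of_in[OF \<kappa>', of s' t2] by blast
  ultimately show False
    using dist_triangle2[of "point_of \<kappa>' s" "point_of \<kappa>' s'" y] by (simp add: \<epsilon>_def)
qed

section \<open>The map matching the two codings\<close>

definition conjugacy :: "real \<Rightarrow> real \<Rightarrow> 'a \<Rightarrow> 'a" where
  "conjugacy \<kappa> \<kappa>' x = point_of \<kappa>' (SOME s. point_of \<kappa> s = x)"

lemma conjugacy_point_of:
  assumes "\<kappa> \<in> {1, 2}" "\<kappa>' \<in> {1, 2}" shows "conjugacy \<kappa> \<kappa>' (point_of \<kappa> s) = point_of \<kappa>' s"
proof -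
  have "point_of \<kappa> (SOME s'. point_of \<kappa> s' = point_of \<kappa> s) = point_of \<kappa> s"
    by (rule someI[of "\<lambda>s'. point_of \<kappa> s' = point_of \<kappa> s"]) (rule refl)
  then show ?thesis unfolding conjugacy_def by (rule point_of_transfer[OF assms])
qed

lemma conjugacy_in: "\<kappa>' \<in> {1, 2} \<Longrightarrow> conjugacy \<kappa> \<kappa>' x \<in> base_simplex"
  unfolding conjugacy_def by (rule point_of_simplex)

lemma conjugacy_inverse:
  assumes "\<kappa> \<in> {1, 2}" "\<kappa>' \<in> {1, 2}" "x \<in> base_simplex"
  shows "conjugacy \<kappa>' \<kappa> (conjugacy \<kappa> \<kappa>' x) = x"
  using point_of_surj[OF assms(1,3)] conjugacy_point_of assms(1,2) by metis

text \<open>Every cylinder around the image contains a point with the same vanishing coordinates as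
  \<open>x\<close>. Vanishing is a closed condition, so it passes to the limit.\<close>

lemma conjugacy_bc_0:
  assumes \<kappa>: "\<kappa> \<in> {1, 2}" and \<kappa>': "\<kappa>' \<in> {1, 2}" and "x \<in> base_simplex" "j \<le> n" "bc x j = 0"
  shows "bc (conjugacy \<kappa> \<kappa>' x) j = 0"
proof -
  obtain s where s: "point_of \<kappa> s = x" using point_of_surj[OF \<kappa> assms(3)] .
  have closed: "closed {y. bc y j = 0}"
    by (intro closed_Collect_eq continuous_intros bc_cont)
  have "\<exists>y\<in>{y. bc y j = 0}. dist y (point_of \<kappa>' s) < \<epsilon>" if \<epsilon>: "0 < \<epsilon>" for \<epsilon>
  proof -
    obtain t where t: "\<forall>x\<in>cyl \<kappa>' (prefix_word s t). \<forall>y\<in>cyl \<kappa>' (prefix_word s t). dist x y < \<epsilon>"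
      using shrink[OF \<kappa>' \<epsilon>] by blast
    have x: "x \<in> cyl \<kappa> (prefix_word s t)" using point_of_in[OF \<kappa>] s by blast
    obtain y where "y \<in> cyl \<kappa>' (prefix_word s t)" "\<And>j. j \<le> n \<Longrightarrow> bc y j = 0 \<longleftrightarrow> bc x j = 0"
      using cyl_common[OF \<kappa>_pos[OF \<kappa>] \<kappa>_pos[OF \<kappa>'] refl x x] by blast
    then have "y \<in> cyl \<kappa>' (prefix_word s t)" "bc y j = 0" using assms(4,5) by simp_all
    then show ?thesis using t point_of_in[OF \<kappa>', of s t] by blast
  qed
  then have "point_of \<kappa>' s \<in> {y. bc y j = 0}" using closed_approachable[OF closed] by blast
  then show ?thesis using conjugacy_point_of[OF \<kappa> \<kappa>', of s] s by simp
qed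

text \<open>Prepending a digit to an itinerary amounts to an inverse branch, so a map defined by
  matching itineraries automatically intertwines the inverse branches.\<close>

lemma point_of_Cons:
  assumes "\<kappa> \<in> {1, 2}" shows "point_of \<kappa> (case_nat b s) = inv_branch \<kappa> b (point_of \<kappa> s)"
proof (rule point_of_eqI[OF assms])
  fix t
  have "prefix_word (case_nat b s) (Suc u) = b # prefix_word s u" for u
    unfolding prefix_word_def upt_conv_Cons[OF zero_less_Suc]
        by (simp add: map_Suc_upt[symmetric] del: upt_Suc map_Suc_upt)
  then show "inv_branch \<kappa> b (point_of \<kappa> s) \<in> cyl \<kappa> (prefix_word (case_nat b s) t)"
    using assms point_of_in[OF assms] point_of_simplex[OF assms] \<kappa>_pos[OF assms]
    by (cases t) (simp_all add: cyl_Cons inv_branch_in_half branch_inv_branch inv_branch_in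
        prefix_word_def[of _ 0])
qed

lemma conjugacy_inv_branch:
  assumes "\<kappa> \<in> {1, 2}" "\<kappa>' \<in> {1, 2}" "x \<in> base_simplex"
  shows "conjugacy \<kappa> \<kappa>' (inv_branch \<kappa> b x) = inv_branch \<kappa>' b (conjugacy \<kappa> \<kappa>' x)"
proof -
  obtain s where s: "point_of \<kappa> s = x" using point_of_surj[OF assms(1,3)] .
  show ?thesis
    unfolding s[symmetric] point_of_Cons[OF assms(1),
        symmetric] conjugacy_point_of[OF assms(1,2)] point_of_Cons[OF assms(2)] ..
qed

lemma conjugacy_inv_word:
  assumes "\<kappa> \<in> {1, 2}" "\<kappa>' \<in> {1, 2}" "x \<in> base_simplex"
  shows "conjugacy \<kappa> \<kappa>' (inv_word \<kappa> a x) = inv_word \<kappa>' a (conjugacy \<kappa> \<kappa>' x)"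
  using assms conjugacy_inv_branch inv_word_in[OF \<kappa>_pos[OF assms(1)] assms(3)]
      by (induction a) simp_all

text \<open>The finitely many cylinders of depth \<open>t\<close> that miss \<open>x\<close> form a
  closed set, so a nearby point lies only in cylinders that contain \<open>x\<close>. Their
  counterparts for \<open>\<kappa> = 2\<close> meet those around the image of \<open>x\<close> and
  are small. The uniform depth of \<open>shrink_2\<close> allows \<open>t\<close> to be fixed before
  the nearby point.\<close>

lemma continuous_on_conjugacy: "continuous_on base_simplex (conjugacy 1 2)"
  unfolding continuous_on_iff
proof (intro ballI allI impI)
  fix x and \<epsilon> :: real
  assume x: "x \<in> base_simplex" and \<epsilon>: "0 < \<epsilon>"
  then have "0 < \<epsilon> / 2" by simp
  then obtain t where t: "\<And>a x y. length a = t \<Longrightarrow> x \<in> cyl 2 a \<Longrightarrow> y \<in> cyl 2 a \<Longrightarrow> dist x y < \<epsilon> / 2"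
    using shrink_2 by blast
  define U where "U = (\<Union>c\<in>{c. length c = t \<and> x \<notin> cyl 1 c}. cyl 1 c)"
  have fin: "finite {c :: bool list. length c = t \<and> x \<notin> cyl 1 c}"
    using finite_lists_length_eq[of "UNIV :: bool set" t] by (auto intro: rev_finite_subset)
  have "closed U"
    unfolding U_def using fin by (intro closed_UN ballI compact_imp_closed compact_cyl) simp_all
  moreover have "x \<notin> U" by (auto simp: U_def)
  ultimately obtain \<delta> where \<delta>: "0 < \<delta>" "\<And>y. y \<in> U \<Longrightarrow> \<delta> \<le> dist x y"
    using separate_point_closed[of U x] by blast
  have "dist (conjugacy 1 2 x') (conjugacy 1 2 x) < \<epsilon>"
      if x': "x' \<in> base_simplex" "dist x' x < \<delta>" for x'
  proof -
    obtain s s' where s: "point_of 1 s = x" "point_of 1 s' = x'"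
      using point_of_surj[of 1] x x'(1) by (metis insertI1)
    have x'C: "x' \<in> cyl 1 (prefix_word s' t)" using point_of_in[of 1 s' t] s by simp
    have "x' \<notin> U" using \<delta>(2)[of x'] x'(2) by (auto simp: dist_commute)
    then have "x \<in> cyl 1 (prefix_word s' t)"
      unfolding U_def using x'C length_prefix_word[of s' t] by blast
    moreover have "x \<in> cyl 1 (prefix_word s t)" using point_of_in[of 1 s t] s by simp
    ultimately obtain y where "y \<in> cyl 2 (prefix_word s' t)" "y \<in> cyl 2 (prefix_word s t)"
      by (rule cyl_common[of 1 2 "prefix_word s' t" "prefix_word s t" x, rotated 3]) simp_all
    then have "dist (point_of 2 s') y < \<epsilon> / 2" "dist (point_of 2 s) y < \<epsilon> / 2"
      using t[of "prefix_word s' t"] t[of "prefix_word s t"] point_of_in[of 2] by simp_all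
    moreover have "conjugacy 1 2 x' = point_of 2 s'" "conjugacy 1 2 x = point_of 2 s"
      using conjugacy_point_of[of 1 2] s by auto
    ultimately show ?thesis using dist_triangle2[of "point_of 2 s'" "point_of 2 s" y] by simp
  qed
  then show "\<exists>\<delta>>0. \<forall>x'\<in>base_simplex. dist x' x < \<delta> \<longrightarrow> dist (conjugacy 1 2 x') (conjugacy 1 2 x) < \<epsilon>"
    using \<delta>(1) by blast
qed

lemma conjugacy_Face:
  assumes "\<kappa> \<in> {1, 2}" "\<kappa>' \<in> {1, 2}" shows "conjugacy \<kappa> \<kappa>' ` Face J = Face J"
proof -
  have sub: "conjugacy \<alpha> \<beta> ` Face J \<subseteq> Face J" if "\<alpha> \<in> {1, 2}" "\<beta> \<in> {1, 2}" for \<alpha> \<beta>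
  proof (rule image_subsetI)
    fix x assume "x \<in> Face J"
    then show "conjugacy \<alpha> \<beta> x \<in> Face J"
      using conjugacy_bc_0[OF that, of x] conjugacy_in[OF that(2), of \<alpha> x] by (simp add: Face_def)
  qed
  moreover have "x \<in> conjugacy \<kappa> \<kappa>' ` Face J" if "x \<in> Face J" for x
  proof -
    have "conjugacy \<kappa>' \<kappa> x \<in> Face J" using sub[OF assms(2,1)] that by blast
    moreover have "x = conjugacy \<kappa> \<kappa>' (conjugacy \<kappa>' \<kappa> x)"
      using conjugacy_inverse[OF assms(2,1)] that by (simp add: Face_def)
    ultimately show ?thesis by blast
  qed
  ultimately show ?thesis using assms by (meson subsetI subset_antisym)
qed

text \<open>In the position coordinates of a cylinder a face is some \<open>Face J\<close>, and the
  conjugacy maps each \<open>Face J\<close> onto itself; the image is the face with the same vertex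
  numbers.\<close>

lemma conjugacy_cyl_face:
  assumes "\<kappa> \<in> {1, 2}" "\<kappa>' \<in> {1, 2}" "S face_of cyl \<kappa> a"
  shows "conjugacy \<kappa> \<kappa>' ` S face_of cyl \<kappa>' a"
proof -
  obtain D where D: "D face_of base_simplex" "S = inv_word \<kappa> a ` D"
    using assms face_cyl_iff \<kappa>_pos by blast
  then obtain J where J: "D = Face J" using face_simplex_iff by blast
  have "conjugacy \<kappa> \<kappa>' ` S = inv_word \<kappa>' a ` conjugacy \<kappa> \<kappa>' ` Face J"
    unfolding D(2) J image_image
    by (rule image_cong) (simp_all add: Face_def conjugacy_inv_word[OF assms(1,2)])
  then have "conjugacy \<kappa> \<kappa>' ` S = inv_word \<kappa>' a ` D" using conjugacy_Face[OF assms(1,2)] J by simp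
  then show ?thesis using D(1) face_cyl_iff[OF \<kappa>_pos[OF assms(2)]] by blast
qed

section \<open>Action of the conjugacy on the complexes\<close>

definition cells :: "real \<Rightarrow> nat \<Rightarrow> 'a set set" where
  "cells \<kappa> t = {S. \<exists>a. length a = t \<and> S face_of cyl \<kappa> a}"

lemma cells_subset: "S \<in> cells \<kappa> t \<Longrightarrow> S \<subseteq> base_simplex"
  unfolding cells_def using cyl_simplex face_of_imp_subset by blast

lemma conjugacy_cells: "\<kappa> \<in> {1, 2} \<Longrightarrow> \<kappa>' \<in> {1, 2} \<Longrightarrow> S \<in> cells \<kappa> t \<Longrightarrow> conjugacy \<kappa> \<kappa>' ` S \<in> cells \<kappa>' t"
  unfolding cells_def using conjugacy_cyl_face by blast

lemma conjugacy_image_inverse: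
  assumes "\<kappa> \<in> {1, 2}" "\<kappa>' \<in> {1, 2}" "S \<subseteq> base_simplex" shows "conjugacy \<kappa>' \<kappa> ` conjugacy \<kappa> \<kappa>' ` S
      = S"
proof -
  have "conjugacy \<kappa>' \<kappa> ` conjugacy \<kappa> \<kappa>' ` S = (\<lambda>x. x) ` S"
    unfolding image_image using conjugacy_inverse[OF assms(1,2)] assms(3)
        by (intro image_cong refl) blast
  then show ?thesis by simp
qed

lemma face_of_cell:
  assumes "S \<in> cells \<kappa> t" "S' face_of S" shows "S' \<in> cells \<kappa> t"
  using assms face_of_trans unfolding cells_def by blast

text \<open>Both sets are faces of one cylinder, and so are their images; a face of the cylinder
  contained in another one is a face of that one.\<close>

lemma conjugacy_face_of:
  assumes \<kappa>: "\<kappa> \<in> {1, 2}" "\<kappa>' \<in> {1, 2}" and S': "S' \<in> cells \<kappa> t" and face: "S face_of S'"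
  shows "conjugacy \<kappa> \<kappa>' ` S face_of conjugacy \<kappa> \<kappa>' ` S'"
proof -
  obtain a where "S' face_of cyl \<kappa> a" using S' by (auto simp: cells_def)
  moreover then have "S face_of cyl \<kappa> a" using face face_of_trans by blast
  ultimately have "conjugacy \<kappa> \<kappa>' ` S' face_of cyl \<kappa>' a" "conjugacy \<kappa> \<kappa>' ` S face_of cyl \<kappa>' a"
    using conjugacy_cyl_face[OF \<kappa>] by auto
  moreover have "conjugacy \<kappa> \<kappa>' ` S \<subseteq> conjugacy \<kappa> \<kappa>' ` S'" using face face_of_imp_subset by blast
  ultimately show ?thesis using face_of_subset face_of_imp_subset by blast
qed

lemma conjugacy_face_of_iff:
  assumes \<kappa>: "\<kappa> \<in> {1, 2}" "\<kappa>' \<in> {1, 2}" and S: "S \<in> cells \<kappa> t" "S' \<in> cells \<kappa> t"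
  shows "S face_of S' \<longleftrightarrow> conjugacy \<kappa> \<kappa>' ` S face_of conjugacy \<kappa> \<kappa>' ` S'"
  using conjugacy_face_of[OF \<kappa> S(2)] conjugacy_face_of[OF \<kappa>(2,1) conjugacy_cells[OF \<kappa> S(2)],
      of "conjugacy \<kappa> \<kappa>' ` S"]
  unfolding conjugacy_image_inverse[OF \<kappa> cells_subset[OF S(1)]] conjugacy_image_inverse[OF \<kappa>
      cells_subset[OF S(2)]]
  by blast

lemma conjugacy_bij_cells:
  assumes \<kappa>: "\<kappa> \<in> {1, 2}" "\<kappa>' \<in> {1, 2}"
  shows "bij_betw ((`) (conjugacy \<kappa> \<kappa>')) (cells \<kappa> t) (cells \<kappa>' t)"
proof (rule bij_betw_byWitness[where f' = "(`) (conjugacy \<kappa>' \<kappa>)"])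
  show "\<forall>S\<in>cells \<kappa> t. conjugacy \<kappa>' \<kappa> ` conjugacy \<kappa> \<kappa>' ` S = S"
    using conjugacy_image_inverse[OF \<kappa> cells_subset] by blast
  show "\<forall>S\<in>cells \<kappa>' t. conjugacy \<kappa> \<kappa>' ` conjugacy \<kappa>' \<kappa> ` S = S"
    using conjugacy_image_inverse[OF \<kappa>(2,1) cells_subset] by blast
  show "(`) (conjugacy \<kappa> \<kappa>') ` cells \<kappa> t \<subseteq> cells \<kappa>' t"
    using conjugacy_cells[OF \<kappa>] by blast
  show "(`) (conjugacy \<kappa>' \<kappa>) ` cells \<kappa>' t \<subseteq> cells \<kappa> t"
    using conjugacy_cells[OF \<kappa>(2,1)] by blast
qed

lemma conjugacy_vertex:
  assumes "\<kappa> \<in> {1, 2}" "\<kappa>' \<in> {1, 2}" "k \<le> n" shows "conjugacy \<kappa> \<kappa>' (v k) = v k"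
  using conjugacy_Face[OF assms(1,2), of "{k}"] Face_singleton[OF assms(3)] by auto

subsection \<open>Rigidity of the complexes\<close>


context
  fixes \<kappa> :: real
  assumes pos: "0 < \<kappa>"
begin

definition cyl_vertex :: "bool list \<Rightarrow> nat \<Rightarrow> 'a" where
  "cyl_vertex a k = inv_word \<kappa> a (v k)"

text \<open>The digit is immaterial: \<open>v n\<close> lies on the facet opposite
  \<open>v 0\<close>, where both inverse branches agree.\<close>

definition edge_mid :: 'a where
  "edge_mid = inv_branch \<kappa> False (v n)"

lemma edge_mid_in: "edge_mid \<in> base_simplex"
  by (simp add: edge_mid_def inv_branch_in pos vertex_in_simplex)

lemma bc_edge_mid_pos: "j \<le> n \<Longrightarrow> 0 < bc edge_mid j \<longleftrightarrow> j \<le> 1"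
  using n_pos by (auto simp: edge_mid_def bc_inv_branch_pos_iff pos vertex_in_simplex bc_vertex
      hi_def lo_def)

lemma inv_branch_vertex:
  assumes "k \<le> n"
  shows "inv_branch \<kappa> b (v k) = (if k = 0 then v (hi b) else if k = n then edge_mid else v (Suc k))"
proof (cases "k = n")
  case True
  then have "bc (v k) 0 = 0" using n_pos by (simp add: bc_vertex)
  then show ?thesis using True n_pos inv_branch_agree[of "v k" \<kappa> b False]
      by (simp add: edge_mid_def)
next
  case False
  define l where "l = (if k = 0 then hi b else Suc k)"
  have l: "l \<le> n" using False assms by (simp add: l_def)
  have "inv_branch \<kappa> b (v k) = v l"
  proof (rule bc_eqI)
    fix j assume j: "j \<le> n"
    have s: "bwd \<kappa> b (bc (v k)) i = (if i = l then 1 else 0)" if "i \<le> n" for i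
      using that False assms by (auto simp: bwd_def bc_vertex l_def hi_def lo_def)
    then have "(\<Sum>i\<le>n. bwd \<kappa> b (bc (v k)) i) = 1" using l by simp
    then show "bc (inv_branch \<kappa> b (v k)) j = bc (v l) j"
      using j s l assms by (simp add: bc_inv_branch pos vertex_in_simplex bc_vertex)
  qed
  then show ?thesis using False by (simp add: l_def)
qed

lemma cyl_vertex_Nil [simp]: "cyl_vertex [] k = v k"
  by (simp add: cyl_vertex_def)

lemma cyl_vertex_Cons: "cyl_vertex (b # a) k = inv_branch \<kappa> b (cyl_vertex a k)"
  by (simp add: cyl_vertex_def)

text \<open>The last digit is the one that subdivides the simplex of the word before it; the first
  digit, as in \<open>cyl_vertex_Cons\<close>, places a whole copy of the previous level in one
  half.\<close>

lemma cyl_vertex_snoc: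
  "k \<le> n \<Longrightarrow> cyl_vertex (a @ [b]) k = (if k = 0 then cyl_vertex a (hi b) else
      if k = n then inv_word \<kappa> a edge_mid else cyl_vertex a (Suc k))"
  by (simp add: cyl_vertex_def inv_word_append inv_branch_vertex)

lemma cyl_vertex_in: "k \<le> n \<Longrightarrow> cyl_vertex a k \<in> base_simplex"
  by (simp add: cyl_vertex_def inv_word_in pos vertex_in_simplex)

lemma step_map_cyl_vertex: "k \<le> n \<Longrightarrow> (step_map \<kappa> ^^ length a) (cyl_vertex a k) = v k"
  by (simp add: cyl_vertex_def step_map_inv_word pos vertex_in_simplex)

lemma cyl_vertex_color: "length a = length b \<Longrightarrow> k \<le> n \<Longrightarrow> j \<le> n \<Longrightarrow> cyl_vertex a k = cyl_vertex b j \<Longrightarrow>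
    k = j"
  by (metis step_map_cyl_vertex vertex_inj)

lemma supp_inv_word_mono:
  assumes "y \<in> base_simplex" "z \<in> base_simplex" "\<And>j. j \<le> n \<Longrightarrow> 0 < bc y j \<Longrightarrow> 0 < bc z j"
    and "j \<le> n" "0 < bc (inv_word \<kappa> a y) j"
  shows "0 < bc (inv_word \<kappa> a z) j"
  using assms(4,5)
proof (induction a arbitrary: j)
  case Nil
  then show ?case using assms by simp
next
  case (Cons b a)
  have le: "j - 1 \<le> n" using Cons.prems by simp
  show ?case
    using Cons.IH[of 0] Cons.IH[of n] Cons.IH[OF le] Cons.prems assms(1,2) pos inv_word_in
    by (auto simp: bc_inv_branch_pos_iff split: if_splits)
qed

lemma supp_inv_word_vertex:
  assumes "z \<in> base_simplex" "j \<le> n" "0 < bc (inv_word \<kappa> a z) j"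
  shows "\<exists>k\<le>n. 0 < bc z k \<and> 0 < bc (cyl_vertex a k) j"
  using assms(2,3)
proof (induction a arbitrary: j)
  case Nil
  then show ?case by (intro exI[of _ j]) (simp add: bc_vertex)
next
  case (Cons b a)
  let ?P = "\<lambda>y. if j = hi b then 0 < bc y 0 \<or> 0 < bc y n else
      if j = lo b then 0 < bc y n else 0 < bc y (j - 1)"
  have "?P (inv_word \<kappa> a z)"
    using Cons.prems by (simp add: bc_inv_branch_pos_iff pos inv_word_in assms(1))
  moreover have "j - 1 \<le> n" using Cons.prems by simp
  ultimately have "\<exists>k\<le>n. 0 < bc z k \<and> ?P (cyl_vertex a k)"
    using Cons.IH[of 0] Cons.IH[of n] Cons.IH[of "j - 1"] by (simp split: if_split_asm) blast+
  then show ?case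
    using Cons.prems by (auto simp: cyl_vertex_Cons bc_inv_branch_pos_iff pos cyl_vertex_in)
qed

text \<open>Maximal simplexes meet along faces with matching vertex numbers. Where the digits
  differ, the common point has coordinate 0 equal to 0; by monotonicity of supports the vertex
  \<open>k\<close> lies on the same facet, and there the inverse branches agree.\<close>

lemma carrier_eq:
  assumes "length a = length b" "z \<in> base_simplex" "inv_word \<kappa> a z = inv_word \<kappa> b z" "k \<le> n"
      "0 < bc z k"
  shows "cyl_vertex a k = cyl_vertex b k"
  using assms(1,3)
proof (induction a b rule: list_induct2)
  case (Cons x xs y ys)
  note inz = inv_word_in[OF pos assms(2)]
  have eq: "inv_branch \<kappa> x (inv_word \<kappa> xs z) = inv_branch \<kappa> y (inv_word \<kappa> ys z)" using Cons.prems
      by simp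
  show ?case
  proof (cases "x = y")
    case True
    then have "inv_word \<kappa> xs z = inv_word \<kappa> ys z"
      using eq inv_branch_eq_iff[OF pos inz inz] by simp
    then show ?thesis using Cons.IH True by (simp add: cyl_vertex_Cons)
  next
    case False
    have *: "inv_word \<kappa> xs z = inv_word \<kappa> ys z" "bc (inv_word \<kappa> xs z) 0 = 0"
      using eq unfolding inv_branch_eq_neq[OF pos inz inz False] by blast+
    have "\<not> 0 < bc (cyl_vertex xs k) 0"
    proof
      assume "0 < bc (cyl_vertex xs k) 0"
      then have "0 < bc (inv_word \<kappa> xs z) 0"
        using assms(4,5) unfolding cyl_vertex_def
        by (intro supp_inv_word_mono[OF vertex_in_simplex[OF assms(4)] assms(2)])
          (auto simp: bc_vertex split: if_splits)
      with *(2) show False by simp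
    qed
    then have "bc (cyl_vertex xs k) 0 = 0" using bc_nonneg[OF cyl_vertex_in[OF assms(4)], of 0 xs]
        by simp
    then show ?thesis
      using Cons.IH[OF *(1)] inv_branch_agree[of "cyl_vertex xs k" \<kappa> x y]
          by (simp add: cyl_vertex_Cons)
  qed
qed simp

text \<open>No maximal simplex lies inside a facet of the base simplex. This excludes different
  digits in \<open>cyl_vertex_word_inj\<close>, which would put all vertices on the facet opposite
  \<open>v 0\<close>.\<close>

lemma cyl_vertex_full: "j \<le> n \<Longrightarrow> \<exists>k\<le>n. 0 < bc (cyl_vertex a k) j"
proof (induction a arbitrary: j)
  case Nil
  then show ?case by (intro exI[of _ j]) (simp add: bc_vertex)
next
  case (Cons b a)
  have "j - 1 \<le> n" using Cons.prems by simp
  then obtain k i where "k \<le> n" "0 < bc (cyl_vertex a k) (j - 1)" "i \<le> n"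
      "0 < bc (cyl_vertex a i) n"
    using Cons.IH[of "j - 1"] Cons.IH[of n] by auto
  then have "0 < bc (cyl_vertex (b # a) (if j \<le> 1 then i else k)) j"
    using Cons.prems pos cyl_vertex_in
        by (auto simp: cyl_vertex_Cons bc_inv_branch_pos_iff hi_def lo_def)
  then show ?case using \<open>k \<le> n\<close> \<open>i \<le> n\<close> by (intro exI[of _ "if j \<le> 1 then i else k"]) simp
qed

lemma cyl_vertex_word_inj: "length a = length b \<Longrightarrow> (\<And>k. k \<le> n \<Longrightarrow> cyl_vertex a k = cyl_vertex b k) \<Longrightarrow>
    a = b"
proof (induction a b rule: list_induct2)
  case (Cons x xs y ys)
  have eq: "inv_branch \<kappa> x (cyl_vertex xs k) = inv_branch \<kappa> y (cyl_vertex ys k)" if "k \<le> n" for k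
    using Cons.prems[OF that] by (simp add: cyl_vertex_Cons)
  show ?case
  proof (cases "x = y")
    case True
    have "cyl_vertex xs k = cyl_vertex ys k" if "k \<le> n" for k
      using eq[OF that] inv_branch_eq_iff[OF pos cyl_vertex_in[OF that] cyl_vertex_in[OF that]]
          True by simp
    then show ?thesis using Cons.IH True by simp
  next
    case False
    have "bc (cyl_vertex xs k) 0 = 0" if "k \<le> n" for k
      using eq[OF that] unfolding inv_branch_eq_neq[OF pos cyl_vertex_in[OF that] cyl_vertex_in[OF
          that] False] by blast
    then show ?thesis using cyl_vertex_full[of 0 xs] by auto
  qed
qed simp

section \<open>Vertex sets, adjacency and numbers of incident simplexes\<close>

lemma cyl_vertex_inj_on: "inj_on (cyl_vertex a) {..n}"
  using cyl_vertex_color[of a a] by (auto simp: inj_on_def)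

lemma card_cyl_vertex: "card (cyl_vertex a ` {..n}) = Suc n"
  using card_image[OF cyl_vertex_inj_on] by simp

lemma cyl_vertex_image_inj:
  assumes "length a = length b" "cyl_vertex a ` {..n} = cyl_vertex b ` {..n}" shows "a = b"
proof (rule cyl_vertex_word_inj[OF assms(1)])
  fix k assume k: "k \<le> n"
  then obtain j where "j \<le> n" "cyl_vertex a k = cyl_vertex b j" using assms(2)
      by (metis atMost_iff imageE imageI)
  then show "cyl_vertex a k = cyl_vertex b k" using cyl_vertex_color[OF assms(1) k] by metis
qed

text \<open>Some maximal simplex has all vertices but one on the wall opposite \<open>v 0\<close>.
  If the odd vertex is an end of the edge to be bisected, the half without it is taken and the
  midpoint becomes the odd one. Otherwise the midpoint lies on the wall as well.\<close>

lemma facet_word: "\<exists>a j. length a = t \<and> j \<le> n \<and> (\<forall>k\<le>n. k \<noteq> j \<longrightarrow> bc (cyl_vertex a k) 0 = 0)"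
proof (induction t)
  case 0
  then show ?case by (intro exI[of _ "[]"] exI[of _ 0]) (simp add: bc_vertex)
next
  case (Suc t)
  then obtain a j where a: "length a = t" "j \<le> n" "\<And>k. k \<le> n \<Longrightarrow> k \<noteq> j \<Longrightarrow> bc (cyl_vertex a k) 0 = 0"
      by blast
  show ?case
  proof (cases "j \<le> 1")
    case True
    \<comment> \<open>The digit \<open>j = 0\<close> keeps the end of the edge other than
      \<open>j\<close>.\<close>
    have "\<forall>k\<le>n. k \<noteq> n \<longrightarrow> bc (cyl_vertex (a @ [j = 0]) k) 0 = 0"
      using a(3) True n_pos by (auto simp: cyl_vertex_snoc hi_def)
    then show ?thesis using a(1) by (intro exI[of _ "a @ [j = 0]"] exI[of _ n]) simp
  next
    case False
    have b: "bc (inv_word \<kappa> a edge_mid) 0 = 0"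
    proof -
      have "\<not> 0 < bc (inv_word \<kappa> a edge_mid) 0"
      proof
        assume "0 < bc (inv_word \<kappa> a edge_mid) 0"
        then obtain k where "k \<le> n" "0 < bc edge_mid k" "0 < bc (cyl_vertex a k) 0"
          using supp_inv_word_vertex[OF edge_mid_in] by blast
        then show False using bc_edge_mid_pos[of k] a(3)[of k] False by auto
      qed
      then show ?thesis using bc_nonneg[OF inv_word_in[OF pos edge_mid_in], of 0 a] by simp
    qed
    have "\<forall>k\<le>n. k \<noteq> j - 1 \<longrightarrow> bc (cyl_vertex (a @ [False]) k) 0 = 0"
      using a(3) False b by (auto simp: cyl_vertex_snoc hi_def)
    then show ?thesis using a(1,2) by (intro exI[of _ "a @ [False]"] exI[of _ "j - 1"]) simp
  qed
qed

text \<open>Connectedness of the adjacency graph, stated through invariants \<open>f\<close>. The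
  two halves are copies of the previous depth, and the simplex of \<open>facet_word\<close> together
  with its mirror image gives a crossing of the wall.\<close>

lemma words_connected:
  assumes "\<And>a b j. length a = t \<Longrightarrow> length b = t \<Longrightarrow> j \<le> n \<Longrightarrow>
      (\<And>k. k \<le> n \<Longrightarrow> k \<noteq> j \<Longrightarrow> cyl_vertex a k = cyl_vertex b k) \<Longrightarrow> f a = f b"
    and "length a = t" "length b = t"
  shows "f a = f b"
  using assms
proof (induction t arbitrary: f a b)
  case (Suc t)
  have *: "f (x # a') = f (x # b')" if "length a' = t" "length b' = t" for x a' b'
  proof (rule Suc.IH[of "\<lambda>a. f (x # a)", OF _ that])
    fix a' b' j
    assume "length a' = t" "length b' = t" "j \<le> n" "\<And>k. k \<le> n \<Longrightarrow> k \<noteq> j \<Longrightarrow>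
        cyl_vertex a' k = cyl_vertex b' k"
    then show "f (x # a') = f (x # b')"
        by (intro Suc.prems(1)[of _ _ j]) (simp_all add: cyl_vertex_Cons)
  qed
  obtain c j where c: "length c = t" "j \<le> n" "\<And>k. k \<le> n \<Longrightarrow> k \<noteq> j \<Longrightarrow> bc (cyl_vertex c k) 0 = 0"
    using facet_word by blast
  have cross: "f (x # c) = f (y # c)" for x y
    using c by (intro Suc.prems(1)[of _ _ j]) (auto simp: cyl_vertex_Cons intro: inv_branch_agree)
  obtain x a' y b' where ab: "a = x # a'" "b = y # b'" "length a' = t" "length b' = t"
    using Suc.prems(2,3) by (metis length_Suc_conv)
  then show ?case using *[of a' c x] *[of b' c y] cross[of x y] c(1) by simp
qed simp

lemma cyl_vertex_in_cyl: "k \<le> n \<Longrightarrow> cyl_vertex a k \<in> cyl \<kappa> a"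
  by (simp add: cyl_vertex_def inv_word_in_cyl pos vertex_in_simplex)

text \<open>Digits 0 keep coordinate 0 positive, so during the first \<open>s\<close> steps the
  orbit avoids the wall between the halves and its digits are forced; only the last one is
  free.\<close>

lemma inv_word_replicate_cyl:
  assumes "z \<in> base_simplex" "0 < bc z 0" "inv_word \<kappa> (replicate s False) z \<in> cyl \<kappa> b"
      "length b = Suc s"
  shows "b = replicate s False @ [last b]"
  using assms(3,4)
proof (induction s arbitrary: b)
  case 0
  then show ?case by (cases b) auto
next
  case (Suc s)
  let ?y = "inv_word \<kappa> (replicate s False) z"
  have y: "?y \<in> base_simplex" by (simp add: inv_word_in pos assms(1))
  have "0 < bc (inv_word \<kappa> (replicate u False) z) 0" for u
    by (induction u) (use assms pos inv_word_in n_pos in \<open>auto simp: bc_inv_branch_pos_iff hi_def\<close>)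
  then have y0: "0 < bc ?y 0" .
  obtain x c where b: "b = x # c" "length c = Suc s" using Suc.prems(2) by (cases b) auto
  have h: "inv_branch \<kappa> False ?y \<in> half x" "branch \<kappa> x (inv_branch \<kappa> False ?y) \<in> cyl \<kappa> c"
    using Suc.prems(1) by (simp_all add: b cyl_Cons pos)
  have x: "x = False"
  proof (rule ccontr)
    assume "x \<noteq> False"
    then have "bc (branch \<kappa> False (inv_branch \<kappa> False ?y)) 0 = 0"
      using branch_half_boundary[OF pos inv_branch_in_half[OF pos y] h(1)] by simp
    then show False using y0 by (simp add: branch_inv_branch pos y)
  qed
  then have "c = replicate s False @ [last c]" using Suc.IH h(2) b(2)
      by (simp add: branch_inv_branch pos y)
  then show ?case using b x by auto
qed

lemma degree_newest:
  "{b. length b = Suc s \<and> cyl_vertex (replicate (Suc s) False) n \<in> cyl_vertex b ` {..n}} =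
    {replicate s False @ [False], replicate s False @ [True]}" (is "?L = ?R")
proof
  have eq: "cyl_vertex (replicate s False @ [x]) n = inv_word \<kappa> (replicate s False) edge_mid" for x
    using n_pos by (simp add: cyl_vertex_snoc)
  have r: "replicate (Suc s) False = replicate s False @ [False]"
    by (simp add: replicate_append_same)
  show "?R \<subseteq> ?L" unfolding r using eq by (auto simp: image_iff intro!: bexI[of _ n])
  show "?L \<subseteq> ?R"
  proof
    fix b assume b: "b \<in> ?L"
    then have "inv_word \<kappa> (replicate s False) edge_mid \<in> cyl \<kappa> b"
      unfolding r eq using cyl_vertex_in_cyl by auto
    then have "b = replicate s False @ [last b]"
      using b bc_edge_mid_pos[of 0] by (intro inv_word_replicate_cyl[OF edge_mid_in]) auto
    then show "b \<in> ?R" by (cases "last b") auto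
  qed
qed

text \<open>The vertex in a position strictly between 0 and \<open>n\<close> is determined without
  the last two digits and keeps its position for all four choices of them.\<close>

lemma degree_older:
  assumes "length a = Suc (Suc s)" "1 \<le> k" "k < n"
  shows "4 \<le> card {b. length b = Suc (Suc s) \<and>
      cyl_vertex a k \<in> cyl_vertex b ` {..n}}" (is "_ \<le> card ?L")
proof -
  obtain c x y where a: "a = (c @ [x]) @ [y]" "length c = s"
    using assms(1) unfolding length_Suc_conv_rev by blast
  have "cyl_vertex ((c @ [x']) @ [y']) k = (if Suc k =
      n then inv_word \<kappa> c edge_mid else cyl_vertex c (Suc (Suc k)))" for x' y'
    using assms(2,3) cyl_vertex_snoc[of k "c @ [x']" y'] cyl_vertex_snoc[of "Suc k" c x'] by simp
  then have eq: "cyl_vertex ((c @ [x']) @ [y']) k = cyl_vertex a k" for x' y'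
    by (simp only: a(1))
  let ?S = "(\<lambda>(x', y'). (c @ [x']) @ [y']) ` (UNIV \<times> UNIV)"
  have sub: "?S \<subseteq> ?L"
  proof (rule image_subsetI, clarify)
    fix x' y'
    have "cyl_vertex a k \<in> cyl_vertex ((c @ [x']) @ [y']) ` {..n}"
      using eq[of x' y', symmetric] assms(3) by (intro image_eqI[of _ _ k]) auto
    then show "length ((c @ [x']) @ [y']) = Suc (Suc s) \<and>
        cyl_vertex a k \<in> cyl_vertex ((c @ [x']) @ [y']) ` {..n}"
      using a(2) by simp
  qed
  have fin: "finite ?L"
    using finite_lists_length_eq[of "UNIV :: bool set" "Suc (Suc s)"]
        by (auto intro: rev_finite_subset)
  have "card ?S = 4"
    by (subst card_image) (auto simp: inj_on_def card_UNIV_bool)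
  then show ?thesis using card_mono[OF fin sub] by (simp only:)
qed

lemma inv_word_replicate_vertex_0: "inv_word \<kappa> (replicate t False) (v 0) = v 0"
  using n_pos by (induction t) (simp_all add: inv_branch_vertex hi_def)

lemma vertices_Suc:
  assumes "length a = s" "k \<le> n" shows "\<exists>b. length b = Suc s \<and>
      cyl_vertex a k \<in> cyl_vertex b ` {..n}"
proof -
  \<comment> \<open>Vertices 0 and 1 become vertex 0 of different children and the others move down
    by one; truncated subtraction covers \<open>k = 0\<close>.\<close>
  have "cyl_vertex a k = cyl_vertex (a @ [k = 1]) (k - 1)"
    using assms(2) by (cases "k = 0"; cases "k = 1") (auto simp: cyl_vertex_snoc hi_def)
  then show ?thesis using assms by (intro exI[of _ "a @ [k = 1]"]) auto
qed

text \<open>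
  The iterated map colours the vertices of the complex by the vertices of the simplex, and a
  simplicial automorphism permutes the colours by a permutation \<open>\<sigma>\<close> because neighbouring
  maximal simplexes share all colours but one.  Colour \<open>0\<close> is fixed since \<open>v 0\<close> is; colour \<open>n\<close>,
  that of the newest vertices, is fixed since the newest vertex of the simplex at \<open>v 0\<close> lies in just
  two maximal simplexes, unlike the vertices of the colours between.  Hence the automorphism
  descends to the previous level.
\<close>

lemma cyl_vertex_rigid:
  assumes "\<And>a. length a = t \<Longrightarrow> length (\<pi> a) = t \<and>
      \<gamma> ` cyl_vertex a ` {..n} = cyl_vertex (\<pi> a) ` {..n}"
    and "inj_on \<gamma> (\<Union>a\<in>{a. length a = t}. cyl_vertex a ` {..n})"
    and "\<And>k. k \<le> n \<Longrightarrow> \<gamma> (v k) = v k"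
    and "length a = t" "k \<le> n"
  shows "\<gamma> (cyl_vertex a k) = cyl_vertex a k"
  using assms
proof (induction t arbitrary: \<pi> a k)
  case 0
  then show ?case by simp
next
  case (Suc s)
  let ?t = "Suc s"
  have len: "length (\<pi> a) = ?t" if "length a = ?t" for a using Suc.prems(1)[OF that] by blast
  have img: "\<gamma> ` cyl_vertex a ` {..n} = cyl_vertex (\<pi> a) ` {..n}" if "length a = ?t" for a
    using Suc.prems(1)[OF that] by blast
  have \<gamma>_inj: "cyl_vertex a k = cyl_vertex b j"
    if "\<gamma> (cyl_vertex a k) = \<gamma> (cyl_vertex b j)" "length a = ?t" "length b = ?t" "k \<le> n" "j \<le> n"
        for a b k j
    using that Suc.prems(2) unfolding inj_on_def by blast
  have \<pi>_inj: "a = b" if "\<pi> a = \<pi> b" "length a = ?t" "length b = ?t" for a b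
  proof -
    have "\<gamma> ` cyl_vertex a ` {..n} = \<gamma> ` cyl_vertex b ` {..n}" using that img by simp
    then have "cyl_vertex a ` {..n} = cyl_vertex b ` {..n}"
      by (rule inj_on_image_eq_iff[OF Suc.prems(2), THEN iffD1, rotated 2]) (use that in auto)
    then show ?thesis using cyl_vertex_image_inj that by simp
  qed
  define col where "col x = (THE k. k \<le> n \<and> (step_map \<kappa> ^^ ?t) x = v k)" for x
  have col_cyl_vertex: "col (cyl_vertex a k) = k" if "length a = ?t" "k \<le> n" for a k
    unfolding col_def using that step_map_cyl_vertex[OF that(2), of a] vertex_inj
        by (intro the_equality) auto
  define c where "c a k = col (\<gamma> (cyl_vertex a k))" for a k
  have c: "c a k \<le> n \<and> \<gamma> (cyl_vertex a k) = cyl_vertex (\<pi> a) (c a k)"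
      if "length a = ?t" "k \<le> n" for a k
  proof -
    have "\<gamma> (cyl_vertex a k) \<in> cyl_vertex (\<pi> a) ` {..n}" using img[OF that(1)] that(2) by blast
    then obtain j where "j \<le> n" "\<gamma> (cyl_vertex a k) = cyl_vertex (\<pi> a) j" by auto
    then show ?thesis using col_cyl_vertex[OF len[OF that(1)]] by (simp add: c_def)
  qed
  have c_inj: "inj_on (c a) {..n}" if "length a = ?t" for a
  proof (rule inj_onI)
    fix i k assume ik: "i \<in> {..n}" "k \<in> {..n}" "c a i = c a k"
    then have "\<gamma> (cyl_vertex a i) = \<gamma> (cyl_vertex a k)" using c[OF that] by simp
    then have "cyl_vertex a i = cyl_vertex a k" using \<gamma>_inj that ik by simp
    then show "i = k" using cyl_vertex_color[of a a] ik by simp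
  qed
  have c_image: "c a ` {..n} = {..n}" if "length a = ?t" for a
    by (rule endo_inj_surj[OF _ _ c_inj[OF that]]) (use c[OF that] in auto)
  define \<sigma> where "\<sigma> = c (replicate ?t False)"
  have "restrict (c a) {..n} = restrict (c b) {..n}" if "length a = ?t" "length b = ?t" for a b
  proof (rule words_connected[where f = "\<lambda>a. restrict (c a) {..n}", OF _ that])
    fix a b j
    assume ab: "length a = ?t" "length b = ?t" "j \<le> n" and eq: "\<And>k. k \<le> n \<Longrightarrow> k \<noteq> j \<Longrightarrow>
        cyl_vertex a k = cyl_vertex b k"
    have ne: "c a k = c b k" if "k \<le> n" "k \<noteq> j" for k using eq[OF that] by (simp add: c_def)
    \<comment> \<open>\<open>c a\<close> permutes the colours, so its value at \<open>j\<close> is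
      the one left over by the others.\<close>
    have single: "{c a j} = {..n} - c a ` ({..n} - {j})" if "length a = ?t" for a
      using inj_on_image_set_diff[OF c_inj[OF that], of "{..n}" "{j}"]
        inj_on_image_set_diff[OF c_inj[OF that], of "{..n}" "{..n} - {j}"] c_image[OF that] ab(3)
      by (auto simp: Diff_Diff_Int)
    have "c a ` ({..n} - {j}) = c b ` ({..n} - {j})" using ne by (intro image_cong) auto
    then have "{c a j} = {c b j}" using single ab by simp
    then show "restrict (c a) {..n} = restrict (c b) {..n}" using ne
        by (auto simp: restrict_def fun_eq_iff)
  qed
  then have "c a k = \<sigma> k" if "length a = ?t" "k \<le> n" for a k
    using that unfolding \<sigma>_def by (metis atMost_iff length_replicate restrict_apply')
  then have \<sigma>: "\<gamma> (cyl_vertex a k) = cyl_vertex (\<pi> a) (\<sigma> k)" if "length a = ?t" "k \<le> n" for a k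
    using c that by simp
  have \<sigma>_le: "\<sigma> k \<le> n" if "k \<le> n" for k using c that by (simp add: \<sigma>_def)
  have \<sigma>_inj: "inj_on \<sigma> {..n}" using c_inj by (simp add: \<sigma>_def)
  have \<sigma>_eq: "\<sigma> k = k" if "length a = ?t" "k \<le> n" "cyl_vertex a k = v j" "j \<le> n" for a k j
  proof -
    have "cyl_vertex (\<pi> a) (\<sigma> k) = cyl_vertex a k" using \<sigma>[OF that(1,2)] Suc.prems(3) that by simp
    then show ?thesis
      using cyl_vertex_color[of "\<pi> a" a "\<sigma> k" k] len[OF that(1)] that(1,2) \<sigma>_le[OF that(2)] by simp
  qed
  have \<sigma>0: "\<sigma> 0 = 0"
    by (rule \<sigma>_eq[of "replicate ?t False" 0 0])
      (simp_all only: cyl_vertex_def inv_word_replicate_vertex_0 length_replicate le0)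
  have \<sigma>n: "\<sigma> n = n"
  proof (cases s)
    case 0
    \<comment> \<open>At depth 1 every vertex but the newest is a vertex of the base simplex and
      hence fixed; counting incident simplexes requires depth at least 2.\<close>
    have "\<sigma> k = k" if "k < n" for k
    proof (cases "k = 0")
      case False
      then show ?thesis
        using that 0 cyl_vertex_snoc[of k "[]" False]
            by (intro \<sigma>_eq[of "[False]" k "Suc k"]) simp_all
    qed (simp add: \<sigma>0)
    then have "\<sigma> ` {..<n} = {..<n}" by simp
    moreover have "\<sigma> n \<notin> \<sigma> ` {..<n}"
    proof
      assume "\<sigma> n \<in> \<sigma> ` {..<n}"
      then obtain k where "k < n" "\<sigma> n = \<sigma> k" by auto
      then show False using inj_onD[OF \<sigma>_inj, of n k] by simp
    qed
    ultimately show ?thesis using \<sigma>_le[of n] by auto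
  next
    case (Suc s')
    let ?z = "replicate ?t False"
    have z: "length ?z = ?t" by simp
    have \<pi>_maps: "bij_betw \<pi> {b. length b = ?t} {b. length b = ?t}"
      using len \<pi>_inj finite_lists_length_eq[of "UNIV :: bool set" ?t]
      by (intro bij_betw_imageI endo_inj_surj inj_onI) auto
    have deg: "cyl_vertex (\<pi> ?z) (\<sigma> n) \<in> cyl_vertex (\<pi> b) ` {..n} \<longleftrightarrow>
        cyl_vertex ?z n \<in> cyl_vertex b ` {..n}" if "length b = ?t" for b
    proof -
      have "\<gamma> (cyl_vertex ?z n) \<in> \<gamma> ` cyl_vertex b ` {..n} \<longleftrightarrow> cyl_vertex ?z n \<in> cyl_vertex b ` {..n}"
      proof (rule inj_on_image_mem_iff[OF Suc.prems(2)])
        show "cyl_vertex ?z n \<in> (\<Union>a\<in>{a. length a = ?t}. cyl_vertex a ` {..n})" using z by blast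
        show "cyl_vertex b ` {..n} \<subseteq> (\<Union>a\<in>{a. length a = ?t}. cyl_vertex a ` {..n})" using that
            by blast
      qed
      then show ?thesis using \<sigma>[OF z] img[OF that] by simp
    qed
    define L where "L = {b. length b = ?t \<and> cyl_vertex ?z n \<in> cyl_vertex b ` {..n}}"
    define R where "R = {b. length b = ?t \<and> cyl_vertex (\<pi> ?z) (\<sigma> n) \<in> cyl_vertex b ` {..n}}"
    have "\<pi> ` L = R"
    proof
      show "\<pi> ` L \<subseteq> R"
      proof (rule image_subsetI)
        fix b assume "b \<in> L"
        then show "\<pi> b \<in> R" using deg[of b] len[of b] unfolding L_def R_def by blast
      qed
      show "R \<subseteq> \<pi> ` L"
      proof
        fix b assume b: "b \<in> R"
        then have "b \<in> \<pi> ` {b. length b = ?t}"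
          using \<pi>_maps unfolding bij_betw_def R_def by blast
        then obtain a where "length a = ?t" "b = \<pi> a" by blast
        then show "b \<in> \<pi> ` L" using b deg[of a] unfolding L_def R_def by blast
      qed
    qed
    moreover have "inj_on \<pi> L" using \<pi>_inj unfolding inj_on_def L_def by blast
    moreover have "card L = 2" unfolding L_def degree_newest by simp
    ultimately have card_R: "card R = 2" using card_image by metis
    have "\<not> (1 \<le> \<sigma> n \<and> \<sigma> n < n)"
    proof
      assume k: "1 \<le> \<sigma> n \<and> \<sigma> n < n"
      have "length (\<pi> ?z) = Suc (Suc s')" using len[OF z] Suc by simp
      then have "4 \<le> card R" using degree_older[of "\<pi> ?z" s' "\<sigma> n"] k by (simp only: R_def Suc)
      then show False using card_R by simp
    qed
    moreover have "\<sigma> n \<noteq> 0"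
      using \<sigma>_inj \<sigma>0 n_pos unfolding inj_on_def
          by (metis One_nat_def atMost_iff le0 not_one_le_zero order_refl)
    ultimately show ?thesis using \<sigma>_le[of n] by linarith
  qed
  have \<sigma>_image: "\<sigma> ` {..n} = {..n}" using c_image by (simp add: \<sigma>_def)
  \<comment> \<open>Siblings share all vertices of nonzero colour. Since \<open>\<sigma>\<close>
    fixes 0, the images share theirs too, which makes them siblings again.\<close>
  have descend: "\<exists>c \<beta>. \<pi> (a @ [False]) = c @ [\<beta>] \<and> \<pi> (a @ [True]) = c @ [\<not> \<beta>] \<and> length c = s \<and>
      \<gamma> ` cyl_vertex a ` {..n} = cyl_vertex c ` {..n}" if a: "length a = s" for a
  proof -
    have la: "length (a @ [x]) = ?t" for x using a by simp
    obtain c \<beta> where c: "\<pi> (a @ [False]) = c @ [\<beta>]" "length c = s"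
      using len[OF la] unfolding length_Suc_conv_rev by blast
    obtain e \<beta>' where e: "\<pi> (a @ [True]) = e @ [\<beta>']" "length e = s"
      using len[OF la] unfolding length_Suc_conv_rev by blast
    have eqk: "cyl_vertex (c @ [\<beta>]) k = cyl_vertex (e @ [\<beta>']) k" if k: "1 \<le> k" "k \<le> n" for k
    proof -
      obtain i where i: "i \<le> n" "\<sigma> i = k" using \<sigma>_image k by (metis atMost_iff imageE)
      then have "i \<noteq> 0" using \<sigma>0 k by (metis not_one_le_zero)
      then have "cyl_vertex (a @ [False]) i = cyl_vertex (a @ [True]) i" using i
          by (simp add: cyl_vertex_snoc)
      then show ?thesis using \<sigma>[OF la i(1)] i(2) c(1) e(1) by metis
    qed
    \<comment> \<open>The images have the same newest vertex. It lies inside the bisected edge of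
      each parent, so \<open>carrier_eq\<close> identifies these edges.\<close>
    have "inv_word \<kappa> c edge_mid = inv_word \<kappa> e edge_mid"
      using eqk[of n] n_pos by (simp add: cyl_vertex_snoc)
    then have low: "cyl_vertex c k = cyl_vertex e k" if "k \<le> 1" for k
      using that carrier_eq[of c e edge_mid k] edge_mid_in bc_edge_mid_pos[of k] c(2) e(2) n_pos
          by simp
    have "cyl_vertex c k = cyl_vertex e k" if "k \<le> n" for k
    proof (cases "k \<le> 1")
      case False
      then obtain j where "k = Suc j" "1 \<le> j" by (cases k) auto
      then show ?thesis using eqk[of j] that by (simp add: cyl_vertex_snoc)
    qed (rule low)
    then have ce: "c = e" using cyl_vertex_word_inj c(2) e(2) by simp
    have \<beta>: "\<beta>' = (\<not> \<beta>)"
      using \<pi>_inj[OF _ la la] c(1) e(1) ce by (metis append1_eq_conv)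
    have "\<gamma> (cyl_vertex a k) \<in> cyl_vertex c ` {..n}" if k: "k \<le> n" for k
    proof (cases "k \<le> 1")
      case True
      then have "\<exists>x. cyl_vertex a k = cyl_vertex (a @ [x]) 0"
        by (intro exI[of _ "k = 1"]) (cases k, auto simp: cyl_vertex_snoc hi_def)
      then obtain x where x: "cyl_vertex a k = cyl_vertex (a @ [x]) 0" by blast
      have "\<exists>y. \<pi> (a @ [x]) = c @ [y]" using c(1) e(1) ce by (cases x) auto
      then obtain y where y: "\<pi> (a @ [x]) = c @ [y]" by blast
      have "\<gamma> (cyl_vertex a k) = cyl_vertex (c @ [y]) 0" using x y \<sigma>[OF la, of 0 x] \<sigma>0 by simp
      then show ?thesis by (simp add: cyl_vertex_snoc)
    next
      case False
      then obtain j where j: "k = Suc j" "j \<noteq> 0" by (cases k) auto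
      then have jn: "j \<le> n" "j \<noteq> n" using k by auto
      \<comment> \<open>A colour other than 0 and \<open>n\<close> belongs to a vertex inherited
        from the parent at the index one higher; this is where \<open>\<sigma> n = n\<close> is
        used.\<close>
      have s: "\<sigma> j \<noteq> 0" "\<sigma> j \<noteq> n"
        using inj_onD[OF \<sigma>_inj, of j 0] inj_onD[OF \<sigma>_inj, of j n] \<sigma>0 \<sigma>n j(2) jn by auto
      have "cyl_vertex a k = cyl_vertex (a @ [False]) j" using j jn by (simp add: cyl_vertex_snoc)
      then have "\<gamma> (cyl_vertex a k) = cyl_vertex (c @ [\<beta>]) (\<sigma> j)"
        using \<sigma>[OF la jn(1), of False] c(1) by simp
      also have "\<dots> = cyl_vertex c (Suc (\<sigma> j))" using s \<sigma>_le[OF jn(1)] by (simp add: cyl_vertex_snoc)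
      finally show ?thesis using s(2) \<sigma>_le[OF jn(1)] by auto
    qed
    then have sub: "\<gamma> ` cyl_vertex a ` {..n} \<subseteq> cyl_vertex c ` {..n}" by auto
    have "inj_on \<gamma> (cyl_vertex a ` {..n})"
      by (rule inj_on_subset[OF Suc.prems(2)]) (use vertices_Suc[OF a] in auto)
    then have "card (\<gamma> ` cyl_vertex a ` {..n}) = card (cyl_vertex c ` {..n})"
      by (simp only: card_image card_cyl_vertex)
    then have "\<gamma> ` cyl_vertex a ` {..n} = cyl_vertex c ` {..n}" using sub
        by (intro card_subset_eq) auto
    then show ?thesis using c e ce \<beta> by blast
  qed
  \<comment> \<open>Both children of a word have images with the same parent, so picking the child
    with digit 0 is a mere choice.\<close>
  have fix_s: "\<gamma> (cyl_vertex a k) = cyl_vertex a k" if "length a = s" "k \<le> n" for a k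
  proof (rule Suc.IH[of "\<lambda>a. butlast (\<pi> (a @ [False]))"])
    show "length (butlast (\<pi> (a @ [False]))) = s \<and>
        \<gamma> ` cyl_vertex a ` {..n} = cyl_vertex (butlast (\<pi> (a @ [False]))) ` {..n}"
      if "length a = s" for a
      using descend[OF that] by (elim exE conjE) simp
    show "inj_on \<gamma> (\<Union>a\<in>{a. length a = s}. cyl_vertex a ` {..n})"
      by (rule inj_on_subset[OF Suc.prems(2)]) (use vertices_Suc in fastforce)
  qed (use Suc.prems(3) that in auto)
  obtain a' x where a': "a = a' @ [x]" "length a' = s"
    using Suc.prems(4) unfolding length_Suc_conv_rev by blast
  show ?case
  proof (cases "k = n")
    case False
    then have "\<exists>j\<le>n. cyl_vertex a k = cyl_vertex a' j"
      using Suc.prems(5) by (cases "k = 0") (auto simp: a' cyl_vertex_snoc intro: exI[of _ "Suc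
          k"] exI[of _ "hi x"])
    then show ?thesis using fix_s[OF a'(2)] by auto
  next
    case True
    \<comment> \<open>The parent of the image is now \<open>a'\<close> itself, and the newest vertex
      does not depend on the last digit.\<close>
    obtain c \<beta> where c: "\<pi> (a' @ [False]) = c @ [\<beta>]" "\<pi> (a' @ [True]) = c @ [\<not> \<beta>]" "length c = s"
      "\<gamma> ` cyl_vertex a' ` {..n} = cyl_vertex c ` {..n}"
      using descend[OF a'(2)] by blast
    have "\<gamma> ` cyl_vertex a' ` {..n} = cyl_vertex a' ` {..n}"
      unfolding image_image using fix_s[OF a'(2)] by (intro image_cong) auto
    then have "c = a'" using cyl_vertex_image_inj[of c a'] c(3,4) a'(2) by simp
    then have "\<exists>y. \<pi> a = a' @ [y]" using c(1,2) a'(1) by (cases x) auto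
    then obtain y where y: "\<pi> a = a' @ [y]" by blast
    have "\<gamma> (cyl_vertex a n) = cyl_vertex (a' @ [y]) n" using \<sigma>[OF Suc.prems(4), of n] \<sigma>n y by simp
    then show ?thesis using True n_pos a'(1) by (simp add: cyl_vertex_snoc)
  qed
qed

section \<open>From automorphisms of the face order to vertex maps\<close>

lemma vertex_face_cyl: "{x} face_of cyl \<kappa> a \<longleftrightarrow> x \<in> cyl_vertex a ` {..n}"
proof
  assume "{x} face_of cyl \<kappa> a"
  then obtain D where D: "D face_of base_simplex" "{x} = inv_word \<kappa> a ` D"
    using face_cyl_iff[OF pos] by blast
  then obtain J where J: "J \<subseteq> {..n}" "D = Face J" using face_simplex_iff by blast
  have "J \<noteq> {}"
  proof
    assume "J = {}"
    then have "D = {}" using J Face_hull[of J] by simp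
    then show False using D(2) by simp
  qed
  then obtain k where k: "k \<in> J" by blast
  then have "v k \<in> D" using J Face_hull[OF J(1)] hull_subset[of "v ` J" convex] by auto
  then have "inv_word \<kappa> a (v k) \<in> {x}" unfolding D(2) by blast
  then show "x \<in> cyl_vertex a ` {..n}" using k J(1) by (auto simp: cyl_vertex_def)
next
  assume "x \<in> cyl_vertex a ` {..n}"
  then obtain k where k: "k \<le> n" "x = cyl_vertex a k" by auto
  have "Face {k} face_of base_simplex" using k face_simplex_iff by blast
  then show "{x} face_of cyl \<kappa> a"
    unfolding face_cyl_iff[OF pos] using k Face_singleton[OF k(1)] by (auto simp: cyl_vertex_def)
qed

text \<open>Krein-Milman, extreme points being the singleton faces. A cell is thus determined by its
  vertices, and an automorphism need only be controlled there.\<close>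

lemma cell_hull:
  assumes "S \<in> cells \<kappa> t" shows "S = convex hull {x. {x} face_of S}"
proof -
  obtain a where a: "S face_of cyl \<kappa> a" using assms by (auto simp: cells_def)
  have "compact S" "convex S"
    using face_of_imp_compact[OF convex_cyl[OF pos] compact_cyl[OF pos] a] face_of_imp_convex[OF
        a] by auto
  then show ?thesis using Krein_Milman_Minkowski[of S] by (simp add: face_of_singleton)
qed

lemma cell_vertex_exists:
  assumes "S \<in> cells \<kappa> t" "S \<noteq> {}" shows "\<exists>x. {x} face_of S \<and> {x} \<in> cells \<kappa> t"
proof -
  have "{x. {x} face_of S} \<noteq> {}"
    using cell_hull[OF assms(1)] assms(2) by (metis convex_hull_empty)
  then show ?thesis using face_of_cell[OF assms(1)] by blast
qed

lemma cells_vertex_iff: "{x} \<in> cells \<kappa> t \<longleftrightarrow> x \<in> (\<Union>a\<in>{a. length a = t}. cyl_vertex a ` {..n})"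
  by (auto simp: cells_def vertex_face_cyl)

text \<open>The empty face is least and the vertices are minimal above it, so \<open>g\<close>
  permutes the singletons and induces a vertex map \<open>\<gamma>\<close>. Counting vertices shows
  that \<open>\<gamma>\<close> respects maximal simplexes, and rigidity applies.\<close>

lemma cells_automorphism:
  assumes bij: "bij_betw g (cells \<kappa> t) (cells \<kappa> t)"
    and face: "\<And>S S'. S \<in> cells \<kappa> t \<Longrightarrow> S' \<in> cells \<kappa> t \<Longrightarrow> S face_of S' \<longleftrightarrow> g S face_of g S'"
    and fixed: "\<And>k. k \<le> n \<Longrightarrow> g {v k} = {v k}"
    and S: "S \<in> cells \<kappa> t"
  shows "g S = S"
proof -
  have g_in: "g S \<in> cells \<kappa> t" if "S \<in> cells \<kappa> t" for S using bij that bij_betwE by blast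
  have g_inj: "S = S'" if "g S = g S'" "S \<in> cells \<kappa> t" "S' \<in> cells \<kappa> t" for S S'
    using inj_onD[OF bij_betw_imp_inj_on[OF bij] that] .
  have g_surj: "\<exists>S'\<in>cells \<kappa> t. g S' = S" if "S \<in> cells \<kappa> t" for S
  proof -
    have "S \<in> g ` cells \<kappa> t" using that bij_betw_imp_surj_on[OF bij] by simp
    then show ?thesis by (elim imageE) (rule bexI, rule sym)
  qed
  have empty_in: "{} \<in> cells \<kappa> t"
    using Ex_list_of_length[of t] by (auto simp: cells_def)
  have g_empty: "g {} = {}"
  proof -
    obtain S0 where S0: "S0 \<in> cells \<kappa> t" "g S0 = {}" using g_surj[OF empty_in] by blast
    then have "g {} face_of {}" using face[OF empty_in S0(1)] by simp
    then show ?thesis using face_of_imp_subset by blast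
  qed
  have sing: "\<exists>y. g {x} = {y}" if x: "{x} \<in> cells \<kappa> t" for x
  proof -
    have "g {x} \<noteq> {}" using g_inj[OF _ x empty_in] g_empty by auto
    then obtain y where y: "{y} face_of g {x}" "{y} \<in> cells \<kappa> t"
      using cell_vertex_exists[OF g_in[OF x]] by blast
    obtain S' where S': "S' \<in> cells \<kappa> t" "g S' = {y}" using g_surj[OF y(2)] by blast
    then have "S' \<subseteq> {x}" using face[OF S'(1) x] y(1) face_of_imp_subset by simp
    moreover have "S' \<noteq> {}" using S' g_empty by auto
    ultimately have "S' = {x}" by auto
    then show ?thesis using S' by blast
  qed
  define \<gamma> where "\<gamma> x = (SOME y. g {x} = {y})" for x
  have \<gamma>: "g {x} = {\<gamma> x}" if "{x} \<in> cells \<kappa> t" for x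
    unfolding \<gamma>_def using someI_ex[OF sing[OF that]] .
  have \<gamma>v: "\<gamma> (v k) = v k" if "k \<le> n" for k
    using fixed[OF that] by (simp add: \<gamma>_def)
  have vset: "{y. {y} face_of g T} = \<gamma> ` {x. {x} face_of T}" if T: "T \<in> cells \<kappa> t" for T
  proof
    show "\<gamma> ` {x. {x} face_of T} \<subseteq> {y. {y} face_of g T}"
    proof (rule image_subsetI)
      fix x assume "x \<in> {x. {x} face_of T}"
      then have "{x} \<in> cells \<kappa> t" "{x} face_of T" using face_of_cell[OF T] by auto
      then show "\<gamma> x \<in> {y. {y} face_of g T}" using face[OF _ T] \<gamma> by auto
    qed
    show "{y. {y} face_of g T} \<subseteq> \<gamma> ` {x. {x} face_of T}"
    proof
      fix y assume "y \<in> {y. {y} face_of g T}"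
      then have y: "{y} face_of g T" "{y} \<in> cells \<kappa> t" using face_of_cell[OF g_in[OF T]] by auto
      obtain S' where S': "S' \<in> cells \<kappa> t" "g S' = {y}" using g_surj[OF y(2)] by blast
      then have "S' \<noteq> {}" using g_empty by auto
      then obtain x where x: "{x} face_of S'" "{x} \<in> cells \<kappa> t"
        using cell_vertex_exists[OF S'(1)] by blast
      then have "{\<gamma> x} face_of {y}" using face[OF x(2) S'(1)] \<gamma>[OF x(2)] S'(2) by simp
      then have "\<gamma> x = y" using face_of_imp_subset by blast
      moreover have "{x} face_of T" using face[OF x(2) T] \<gamma>[OF x(2)] y(1) calculation by simp
      ultimately show "y \<in> \<gamma> ` {x. {x} face_of T}" by blast
    qed
  qed
  have \<gamma>_inj: "inj_on \<gamma> (\<Union>a\<in>{a. length a = t}. cyl_vertex a ` {..n})"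
  proof (rule inj_onI, unfold cells_vertex_iff[symmetric])
    fix x y assume xy: "{x} \<in> cells \<kappa> t" "{y} \<in> cells \<kappa> t" "\<gamma> x = \<gamma> y"
    then have "g {x} = g {y}" using \<gamma> by simp
    then have "{x} = {y}" using g_inj xy by blast
    then show "x = y" by simp
  qed
  have cyl_cell: "cyl \<kappa> a \<in> cells \<kappa> t" if "length a = t" for a
    using that face_of_refl[OF convex_cyl[OF pos]] by (auto simp: cells_def)
  have "\<exists>b. length b = t \<and> \<gamma> ` cyl_vertex a ` {..n} = cyl_vertex b ` {..n}"
      if a: "length a = t" for a
  proof -
    obtain b where b: "length b = t" "g (cyl \<kappa> a) face_of cyl \<kappa> b"
      using g_in[OF cyl_cell[OF a]] by (auto simp: cells_def)
    have "\<gamma> ` cyl_vertex a ` {..n} = {y. {y} face_of g (cyl \<kappa> a)}"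
      using vset[OF cyl_cell[OF a]] by (simp add: vertex_face_cyl)
    also have "\<dots> \<subseteq> {y. {y} face_of cyl \<kappa> b}" using b(2) face_of_trans by blast
    also have "\<dots> = cyl_vertex b ` {..n}" by (simp add: vertex_face_cyl)
    finally have sub: "\<gamma> ` cyl_vertex a ` {..n} \<subseteq> cyl_vertex b ` {..n}" .
    have "inj_on \<gamma> (cyl_vertex a ` {..n})" by (rule inj_on_subset[OF \<gamma>_inj]) (use a in auto)
    then have "card (\<gamma> ` cyl_vertex a ` {..n}) = card (cyl_vertex b ` {..n})"
        by (simp only: card_image card_cyl_vertex)
    then have "\<gamma> ` cyl_vertex a ` {..n} = cyl_vertex b ` {..n}" using sub
        by (intro card_subset_eq) auto
    then show ?thesis using b(1) by blast
  qed
  then obtain \<pi> where \<pi>: "\<And>a. length a = t \<Longrightarrow> length (\<pi> a) = t \<and>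
      \<gamma> ` cyl_vertex a ` {..n} = cyl_vertex (\<pi> a) ` {..n}"
    by metis
  have \<gamma>_id: "\<gamma> x = x" if "{x} \<in> cells \<kappa> t" for x
    using that cyl_vertex_rigid[OF \<pi> \<gamma>_inj \<gamma>v] unfolding cells_vertex_iff by auto
  have "{y. {y} face_of g S} = {x. {x} face_of S}"
    unfolding vset[OF S] using \<gamma>_id face_of_cell[OF S] by force
  then show ?thesis using cell_hull[OF S] cell_hull[OF g_in[OF S]] by simp
qed

end


lemma cells_iso_unique:
  assumes bij: "bij_betw h (cells 1 t) (cells 2 t)"
    and face: "\<And>S S'. S \<in> cells 1 t \<Longrightarrow> S' \<in> cells 1 t \<Longrightarrow> S face_of S' \<longleftrightarrow> h S face_of h S'"
    and fixed: "\<And>k. k \<le> n \<Longrightarrow> h {v k} = {v k}"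
    and S: "S \<in> cells 1 t"
  shows "h S = conjugacy 1 2 ` S"
proof -
  have \<kappa>: "(1::real) \<in> {1, 2}" "(2::real) \<in> {1, 2}" by auto
  have h_in: "h S \<in> cells 2 t" if "S \<in> cells 1 t" for S using bij that bij_betwE by blast
  let ?g = "(`) (conjugacy 2 1) \<circ> h"
  have "?g S = S"
  proof (rule cells_automorphism[OF zero_less_one _ _ _ S])
    show "bij_betw ?g (cells 1 t) (cells 1 t)"
      using bij conjugacy_bij_cells[OF \<kappa>(2,1)] by (rule bij_betw_trans)
    show "S face_of S' \<longleftrightarrow> ?g S face_of ?g S'" if "S \<in> cells 1 t" "S' \<in> cells 1 t" for S S'
      using face[OF that] conjugacy_face_of_iff[OF \<kappa>(2,1) h_in h_in] that by simp
    show "?g {v k} = {v k}" if "k \<le> n" for k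
      using fixed[OF that] conjugacy_vertex[OF \<kappa>(2,1) that] by simp
  qed
  then have "conjugacy 1 2 ` S = conjugacy 1 2 ` conjugacy 2 1 ` h S" by simp
  then show ?thesis using conjugacy_image_inverse[OF \<kappa>(2,1) cells_subset[OF h_in[OF S]]] by simp
qed

text \<open>Links the inequality defining \<open>half\<close> with the hull description of the two
  halves: \<open>half a\<close> is the cylinder of a one-digit word and so the hull of its
  vertices.\<close>

lemma half_hull:
  assumes "0 < \<kappa>" shows "convex hull (inv_branch \<kappa> a ` v ` {..n}) = half a"
proof -
  have cyl: "cyl \<kappa> [a] = half a"
    using cyl_Cons[OF assms, of _ a "[]"] branch_in[OF assms] by auto
  have "cyl \<kappa> [a] \<in> cells \<kappa> 1"
    using face_of_refl[OF convex_cyl[OF assms]] unfolding cells_def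
        by (intro CollectI exI[of _ "[a]"]) simp
  from cell_hull[OF assms this] show ?thesis
    unfolding vertex_face_cyl[OF assms] unfolding cyl
        by (simp add: cyl_vertex_def[OF assms] image_image)
qed

lemma fold_branch: "fold (\<lambda>b f. branch \<kappa> b \<circ> f) a g = branch_word \<kappa> a \<circ> g"
  by (induction a arbitrary: g) (simp_all add: fun_eq_iff)

lemma conjugacy_functional_equation:
  assumes "p \<in> base_simplex"
  shows "conjugacy 1 2 p = (restrict (branch_word 2 a) (cyl 2 a) \<circ> restrict (conjugacy 1 2)
      (cyl 1 a)
    \<circ> inv_into (cyl 1 a) (restrict (branch_word 1 a) (cyl 1 a))) p"
proof -
  have \<kappa>: "(1::real) \<in> {1, 2}" "(2::real) \<in> {1, 2}" by auto
  have "inj_on (restrict (branch_word 1 a) (cyl 1 a)) (cyl 1 a)"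
    by (rule inj_on_inverseI[of _ "inv_word 1 a"]) (simp add: inv_word_branch_word)
  then have inv: "inv_into (cyl 1 a) (restrict (branch_word 1 a) (cyl 1 a)) p = inv_word 1 a p"
    using assms by (intro inv_into_f_eq) (simp_all add: inv_word_in_cyl branch_word_inv_word)
  have P: "conjugacy 1 2 p \<in> base_simplex" using conjugacy_in[OF \<kappa>(2)] .
  have "conjugacy 1 2 (inv_word 1 a p) = inv_word 2 a (conjugacy 1 2 p)"
      by (rule conjugacy_inv_word[OF \<kappa> assms])
  then show ?thesis
    using P assms by (simp add: inv inv_word_in_cyl branch_word_inv_word)
qed

text \<open>A continuous injection on a compact set has a continuous inverse, so continuity of the
  conjugacy in one direction suffices.\<close>

lemma conjugacy_homeomorphism:
  assumes "S \<in> cells 1 t" shows "\<exists>g. homeomorphism S (conjugacy 1 2 ` S) (conjugacy 1 2) g"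
proof (rule homeomorphism_compact)
  obtain a where a: "S face_of cyl 1 a" using assms by (auto simp: cells_def)
  show "compact S"
    using face_of_imp_compact[OF convex_cyl compact_cyl a] by simp
  show "continuous_on S (conjugacy 1 2)"
    using continuous_on_subset[OF continuous_on_conjugacy cells_subset[OF assms]] .
  have "inj_on (conjugacy 1 2) base_simplex"
    by (rule inj_on_inverseI[of _ "conjugacy 2 1"]) (simp add: conjugacy_inverse)
  then show "inj_on (conjugacy 1 2) S" using cells_subset[OF assms] inj_on_subset by blast
qed simp

end

subsection \<open>The coordinates of the standard simplex\<close>

lemma pos_Some_le: "pos (Some i :: 'n::{finite,linorder} option) \<le> CARD('n)"
  by (simp add: card_mono)

lemma pos_bij: "bij_betw (pos :: 'n::{finite,linorder} option \<Rightarrow> nat) UNIV {1..CARD('n) + 1}"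
proof -
  have Some_less: "pos (Some i) < pos (Some j)" if "i < j" for i j :: 'n
  proof -
    have "{k. k \<le> i} \<subseteq> {k. k \<le> j}" "j \<in> {k. k \<le> j}" "j \<notin> {k. k \<le> i}" using that by auto
    then have "{k. k \<le> i} \<subset> {k. k \<le> j}" by blast
    then show ?thesis by (simp add: psubset_card_mono)
  qed
  have inj: "inj (pos :: 'n option \<Rightarrow> nat)"
  proof (rule injI)
    fix x y :: "'n option" assume eq: "pos x = pos y"
    show "x = y"
    proof (cases x; cases y)
      fix i j assume ij: "x = Some i" "y = Some j"
      then show ?thesis using eq Some_less[of i j] Some_less[of j i]
          by (metis less_irrefl linorder_cases)
    next
      fix i assume "x = None" "y = Some i"
      then show ?thesis using eq pos_Some_le[of i] by simp
    next
      fix i assume "x = Some i" "y = None"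
      then show ?thesis using eq pos_Some_le[of i] by simp
    qed simp
  qed
  have "pos x \<in> {1..CARD('n) + 1}" for x :: "'n option"
  proof (cases x)
    case (Some i)
    have "{j. j \<le> i} \<noteq> {}" by auto
    then have "0 < card {j. j \<le> i}" by (simp add: card_gt_0_iff)
    then show ?thesis using Some pos_Some_le[of i] by simp
  qed simp
  then have "range (pos :: 'n option \<Rightarrow> nat) \<subseteq> {1..CARD('n) + 1}" by auto
  moreover have "card (range (pos :: 'n option \<Rightarrow> nat)) = card {1..CARD('n) + 1}"
    using card_image[OF inj] by simp
  ultimately show ?thesis
    using inj by (simp add: bij_betw_def card_subset_eq)
qed

text \<open>Zero-based inverse of \<open>pos\<close>, matching the numbering of the vertices;
  \<open>None\<close> is number \<open>n\<close>.\<close>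

definition idx :: "nat \<Rightarrow> 'n::{finite,linorder} option" where
  "idx k = inv_into UNIV pos (Suc k)"

lemma pos_idx: "k \<le> CARD('n) \<Longrightarrow> pos (idx k :: 'n::{finite,linorder} option) = Suc k"
  unfolding idx_def by (rule f_inv_into_f) (use pos_bij in \<open>auto simp: bij_betw_def\<close>)

lemma idx_pos: "idx (pos i - 1) = (i :: 'n::{finite,linorder} option)"
proof -
  have "pos i \<in> {1..CARD('n) + 1}" using pos_bij by (metis bij_betwE UNIV_I)
  then have "Suc (pos i - 1) = pos i" by simp
  then show ?thesis unfolding idx_def using pos_bij
      by (metis bij_betw_imp_inj_on inv_into_f_f UNIV_I)
qed

lemma pos_bounds: "1 \<le> pos (i :: 'n::{finite,linorder} option)" "pos i \<le> CARD('n) + 1"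
  using pos_bij bij_betwE by fastforce+

lemma idx_CARD: "idx CARD('n) = (None :: 'n::{finite,linorder} option)"
  using idx_pos[of "None :: 'n option"] by simp

lemma idx_bij: "bij_betw (idx :: nat \<Rightarrow> 'n::{finite,linorder} option) {..CARD('n)} UNIV"
proof (rule bij_betw_byWitness[where f' = "\<lambda>i. pos i - 1"])
  show "\<forall>k\<in>{..CARD('n)}. pos (idx k :: 'n option) - 1 = k" by (simp add: pos_idx)
  show "\<forall>i\<in>UNIV. idx (pos i - 1) = (i :: 'n option)" using idx_pos by blast
  show "(\<lambda>i :: 'n option. pos i - 1) ` UNIV \<subseteq> {..CARD('n)}" 
    by (rule image_subsetI) (use pos_bounds(2) in \<open>simp add: le_diff_conv\<close>)
qed simp

lemma sum_idx: "(\<Sum>i\<in>UNIV. f (i :: 'n::{finite,linorder} option)) = (\<Sum>k\<le>CARD('n). f (idx k))"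
  using sum.reindex_bij_betw[OF idx_bij, of f] by simp

lemma range_idx: "range f = (\<lambda>k. f (idx k :: 'n::{finite,linorder} option)) ` {..CARD('n)}"
  using bij_betw_imp_surj_on[OF idx_bij[where 'n = 'n]]
      by (simp only: image_image[symmetric, of f idx])

text \<open>Column \<open>k + 1\<close> of the matrix V: the origin for \<open>k = 0\<close>, the
  all-ones point for \<open>k = 1\<close>, and the first unit vector for
  \<open>k = n\<close>.\<close>

definition vtx :: "nat \<Rightarrow> real ^ 'n::{finite,linorder}" where
  "vtx k = (\<chi> i. if 1 \<le> k \<and> pos (Some i) + k \<le> CARD('n) + 1 then 1 else 0)"

text \<open>The coordinates of a point, extended by \<open>1\<close> at position \<open>0\<close> and \<open>0\<close> at position \<open>n + 1\<close>.\<close>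

definition xcoord :: "real ^ 'n::{finite,linorder} \<Rightarrow> nat \<Rightarrow> real" where
  "xcoord x p = (if p = 0 then 1 else case idx (p - 1) of None \<Rightarrow> 0 | Some i \<Rightarrow> x $ i)"

text \<open>Coordinates decrease on the simplex, and the weights of the vertices are the gaps of the
  extended sequence, read from its end. The first gap belongs to the origin, vertex 0, and breaks
  the pattern of indices.\<close>

definition bcoord :: "real ^ 'n::{finite,linorder} \<Rightarrow> nat \<Rightarrow> real" where
  "bcoord x k = (if k = 0 then 1 - xcoord x 1 else xcoord x (CARD('n) + 1 - k) -
      xcoord x (CARD('n) + 2 - k))"

lemma xcoord_pos [simp]: "xcoord x (pos (Some i)) = x $ i"
  using idx_pos[of "Some i"] pos_bounds(1)[of "Some i"] unfolding xcoord_def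
      by (metis not_one_le_zero option.simps(5))

lemma xcoord_last [simp]: "xcoord (x :: real ^ 'n::{finite,linorder}) (Suc CARD('n)) = 0"
  by (simp add: xcoord_def idx_CARD)

lemma ex_pos_Some:
  assumes "1 \<le> p" "p \<le> CARD('n)"
  obtains i :: "'n::{finite,linorder}" where "p = pos (Some i)"
proof -
  have p: "pos (idx (p - 1) :: 'n option) = p" using assms pos_idx[where 'n = 'n, of "p - 1"]
      by simp
  then have "(idx (p - 1) :: 'n option) \<noteq> None" using assms
      by (metis Suc_n_not_le_n Suc_eq_plus1 pos.simps(2))
  then show thesis using that p by force
qed

lemma vtx_sum_nth:
  "(\<Sum>k\<le>CARD('n). c k *\<^sub>R vtx k) $ i = (\<Sum>k=1..CARD('n) + 1 - pos (Some i). c k)"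
  for i :: "'n::{finite,linorder}"
proof -
  have "(\<Sum>k\<le>CARD('n). c k *\<^sub>R vtx k) $ i =
      (\<Sum>k\<in>{..CARD('n)}. if k \<in> {1..CARD('n) + 1 - pos (Some i)} then c k else 0)"
    by (auto simp: vtx_def intro!: sum.cong)
  also have "\<dots> = (\<Sum>k\<in>{..CARD('n)} \<inter> {1..CARD('n) + 1 - pos (Some i)}. c k)"
    by (rule sum.inter_restrict[symmetric]) simp
  also have "{..CARD('n)} \<inter> {1..CARD('n) + 1 - pos (Some i)} = {1..CARD('n) + 1 - pos (Some i)}"
    using pos_bounds(1)[of "Some i"] by auto
  finally show ?thesis .
qed

lemma sum_bcoord:
  "m \<le> CARD('n) \<Longrightarrow> (\<Sum>k=1..m. bcoord x k) = xcoord (x :: real ^ 'n::{finite,linorder}) (CARD('n) +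
      1 - m)"
proof (induction m)
  case (Suc m)
  have "CARD('n) + 2 - Suc m = CARD('n) + 1 - m" by simp
  then show ?case using Suc by (simp add: bcoord_def)
qed simp

interpretation std: barycentric "CARD('n::{finite,linorder})"
    "vtx :: nat \<Rightarrow> real ^ 'n::{finite,linorder}" bcoord
proof
  show "1 \<le> CARD('n)" by (simp add: Suc_leI)
  fix x :: "(real, 'n) vec" and c :: "nat \<Rightarrow> real" and j k :: nat
  have split0: "(\<Sum>k\<le>CARD('n). f k) = f 0 + (\<Sum>k=1..CARD('n). f k)" for f :: "nat \<Rightarrow> real"
    by (simp add: sum.atLeast1_atMost_eq sum.atMost_shift)
  show "(\<Sum>k\<le>CARD('n). bcoord x k) = 1"
    unfolding split0 sum_bcoord[OF order_refl] by (simp add: bcoord_def)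
  show "(\<Sum>k\<le>CARD('n). bcoord x k *\<^sub>R vtx k) = x"
  proof (rule vec_eq_iff[THEN iffD2, rule_format])
    fix i :: 'n
    have "CARD('n) + 1 - (CARD('n) + 1 - pos (Some i)) = pos (Some i)"
      using pos_bounds(2)[of "Some i"] by simp
    moreover have "CARD('n) + 1 - pos (Some i) \<le> CARD('n)" using pos_bounds(1)[of "Some i"] by simp
    ultimately show "(\<Sum>k\<le>CARD('n). bcoord x k *\<^sub>R vtx k) $ i = x $ i"
      unfolding vtx_sum_nth by (simp only: sum_bcoord xcoord_pos)
  qed
  show "continuous_on UNIV (\<lambda>x :: (real, 'n) vec. bcoord x k)"
  proof -
    have "continuous_on UNIV (\<lambda>x :: (real, 'n) vec. xcoord x p)" for p
    proof (cases "idx (p - 1) :: 'n option")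
      case None
      then have eq: "(\<lambda>x :: (real, 'n) vec. xcoord x p) = (\<lambda>_. if p = 0 then 1 else 0)"
        by (simp add: xcoord_def fun_eq_iff)
      show ?thesis unfolding eq by (rule continuous_on_const)
    next
      case (Some i)
      then have eq: "(\<lambda>x :: (real, 'n) vec. xcoord x p) = (\<lambda>x. if p = 0 then 1 else x $ i)"
        by (simp add: xcoord_def fun_eq_iff)
      show ?thesis unfolding eq by (cases "p = 0") (auto intro!: continuous_intros)
    qed
    then show ?thesis unfolding bcoord_def by (cases "k = 0") (auto intro!: continuous_intros)
  qed
  assume c: "(\<Sum>k\<le>CARD('n). c k) = 1" and j: "j \<le> CARD('n)"
  let ?y = "\<Sum>k\<le>CARD('n). c k *\<^sub>R vtx k :: (real, 'n) vec"
  have X: "xcoord ?y p = (\<Sum>k=1..CARD('n) + 1 - p. c k)" if p: "1 \<le> p" "p \<le> CARD('n) + 1" for p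
  proof (cases "p = CARD('n) + 1")
    case False
    then have "p \<le> CARD('n)" using p by simp
    with p(1) obtain i :: 'n where "p = pos (Some i)" by (rule ex_pos_Some)
    then show ?thesis by (simp only: xcoord_pos vtx_sum_nth)
  qed simp
  show "bcoord ?y j = c j"
  proof (cases "j = 0")
    case True
    then show ?thesis using c split0[of c] by (simp add: bcoord_def X Suc_leI)
  next
    case False
    then obtain i where i: "j = Suc i" by (cases j) auto
    have "bcoord ?y j = (\<Sum>k=1..j. c k) - (\<Sum>k=1..i. c k)"
      using i j by (simp add: bcoord_def X)
    then show ?thesis using i by simp
  qed
qed

section \<open>The defining matrices in barycentric coordinates\<close>

definition coords :: "real ^ ('n::{finite,linorder} option) \<Rightarrow> nat \<Rightarrow> real" where
  "coords c k = c $ idx k"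

definition of_coords :: "(nat \<Rightarrow> real) \<Rightarrow> real ^ ('n::{finite,linorder} option)" where
  "of_coords f = (\<chi> i. f (pos i - 1))"

lemma coords_of_coords: "k \<le> CARD('n) \<Longrightarrow> coords (of_coords f :: real ^
    ('n::{finite,linorder} option)) k = f k"
  by (simp add: coords_def of_coords_def pos_idx)

lemma coords_eqI:
  fixes c d :: "real ^ ('n::{finite,linorder} option)"
  assumes "\<And>k. k \<le> CARD('n) \<Longrightarrow> coords c k = coords d k"
  shows "c = d"
proof (rule vec_eq_iff[THEN iffD2, rule_format])
  fix i :: "'n option"
  have "pos i - 1 \<le> CARD('n)" using pos_bounds(2)[of i] by simp
  then have "c $ idx (pos i - 1) = d $ idx (pos i - 1)" using assms by (simp only: coords_def)
  then show "c $ i = d $ i" by (simp only: idx_pos)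
qed

lemma V_mat_None: "(V_mat :: 'n::{finite,linorder} sqmat) $ None $ j = 1"
  by (simp add: V_mat_def)

lemma V_mat_Some: "k \<le> CARD('n) \<Longrightarrow> (V_mat :: 'n::{finite,linorder} sqmat) $ Some i $ idx k =
    vtx k $ i"
  using pos_Some_le[of i] by (simp add: V_mat_def vtx_def pos_idx del: pos.simps)

lemma V_mat_mult:
  fixes c :: "real ^ ('n::{finite,linorder} option)"
  shows "(V_mat *v c) $ None = (\<Sum>k\<le>CARD('n). coords c k)"
    and "(V_mat *v c) $ Some i = (\<Sum>k\<le>CARD('n). coords c k *\<^sub>R vtx k) $ i"
  by (simp_all add: matrix_vector_mult_def sum_idx V_mat_None V_mat_Some coords_def mult.commute)

lemma matrix_inv_mult:
  fixes A :: "real ^ 'm ^ 'm"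
  assumes "\<And>c. A *v c = 0 \<Longrightarrow> c = 0"
  shows "matrix_inv A *v (A *v c) = c"
proof -
  have "invertible A"
    unfolding invertible_left_inverse matrix_left_invertible_ker using assms by blast
  then have "matrix_inv A ** A = mat 1"
    unfolding invertible_def matrix_inv_def by (metis (mono_tags, lifting) someI_ex)
  then show ?thesis by (simp add: matrix_vector_mul_assoc)
qed

lemma V_mat_inv: "matrix_inv V_mat *v (V_mat *v c) = (c :: real ^ ('n::{finite,linorder} option))"
proof (rule matrix_inv_mult)
  fix c :: "real ^ ('n option)"
  assume c: "V_mat *v c = 0"
  have "(\<Sum>k\<le>CARD('n). coords c k) = 0"
    using V_mat_mult(1)[of c] c by simp
  moreover have "(\<Sum>k\<le>CARD('n). coords c k *\<^sub>R vtx k :: (real, 'n) vec) = 0"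
    using V_mat_mult(2)[of c] c by (simp add: vec_eq_iff)
  \<comment> \<open>Adding 1 at index 0 turns a kernel vector into barycentric coordinates of
    \<open>vtx 0\<close>, which are unique.\<close>
  moreover define f where "f k = coords c k + (if k = 0 then 1 else 0)" for k
  ultimately have f: "(\<Sum>k\<le>CARD('n). f k) = 1"
      "(\<Sum>k\<le>CARD('n). f k *\<^sub>R vtx k) = (vtx 0 :: (real, 'n) vec)"
    by (simp_all add: f_def sum.distrib scaleR_add_left if_distrib[of "\<lambda>r. r *\<^sub>R _"] cong: if_cong)
  show "c = 0"
  proof (rule coords_eqI)
    fix k assume k: "k \<le> CARD('n)"
    have "f k = bcoord (vtx 0 :: (real, 'n) vec) k"
      using std.bc_comb[OF f(1) k] unfolding f(2) by simp
    then show "coords c k = coords 0 k"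
      using std.bc_vertex[where 'n = 'n, of 0 k] k by (simp add: f_def coords_def)
  qed
qed

lemma V_mat_inv_homog: "matrix_inv V_mat *v homog x =
    of_coords (bcoord (x :: real ^ 'n::{finite,linorder}))"
proof -
  let ?c = "of_coords (bcoord x) :: real ^ ('n option)"
  have *: "(\<Sum>k\<le>CARD('n). coords ?c k * (w k :: real)) = (\<Sum>k\<le>CARD('n). bcoord x k * w k)"
    "(\<Sum>k\<le>CARD('n). coords ?c k *\<^sub>R (vtx k :: (real, 'n) vec)) =
        (\<Sum>k\<le>CARD('n). bcoord x k *\<^sub>R vtx k)" for w
    by (simp_all add: coords_of_coords)
  have "V_mat *v ?c = homog x"
  proof (rule vec_eq_iff[THEN iffD2, rule_format])
    fix i :: "'n option"
    show "(V_mat *v ?c) $ i = homog x $ i"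
      using *(1)[of "\<lambda>_. 1"] *(2)
      by (cases i) (simp_all add: V_mat_mult homog_def std.bc_sum std.bc_reconstruct)
  qed
  then show ?thesis using V_mat_inv[of ?c] by simp
qed

lemma sum_bwd_unit:
  "k \<le> CARD('n::{finite,linorder}) \<Longrightarrow>
    (\<Sum>l\<le>CARD('n). barycentric.bwd CARD('n) \<kappa> a (\<lambda>j.
        if j = l then 1 else 0) k * c l) = barycentric.bwd CARD('n) \<kappa> a c k"
  by (auto simp: std.bwd_def std.hi_def std.lo_def algebra_simps sum.distrib if_distrib[of "\<lambda>r. _
      * r"]
      if_distrib[of "\<lambda>r. r / _"] cong: if_cong)

text \<open>One name for both families, so that for \<open>\<kappa>\<close> equal to 1 or 2 it is
  the matrix of \<open>bwd \<kappa> a\<close>.\<close>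

definition AB_mat :: "real \<Rightarrow> bool \<Rightarrow> 'n::{finite,linorder} sqmat" where
  "AB_mat \<kappa> = (if \<kappa> = 1 then A_mat else B_mat)"

lemma AB_mat_nth:
  assumes "\<kappa> \<in> {1, 2}" "k \<le> CARD('n)" "l \<le> CARD('n)"
  shows "(AB_mat \<kappa> a :: 'n::{finite,linorder} sqmat) $ idx k $ idx l =
    barycentric.bwd CARD('n) \<kappa> a (\<lambda>j. if j = l then 1 else 0) k"
proof -
  have "0 < CARD('n)" by simp
  then have A: "(A_mat a :: 'n sqmat) $ idx k $ idx l =
    barycentric.bwd CARD('n) 1 a (\<lambda>j. if j = l then 1 else 0) k"
    using assms(2,3) by (auto simp: A_mat_def pos_idx std.bwd_def std.hi_def std.lo_def)
  have "(B_mat a :: 'n sqmat) $ idx k $ idx l =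
      (if l = CARD('n) then (A_mat a :: 'n sqmat) $ idx k $ idx l / 2 else
          (A_mat a :: 'n sqmat) $ idx k $ idx l)"
    using assms(3) by (simp add: B_mat_def pos_idx)
  then have "(B_mat a :: 'n sqmat) $ idx k $ idx l =
      barycentric.bwd CARD('n) 2 a (\<lambda>j. if j = l then 1 else 0) k"
    unfolding A using assms(2,3) \<open>0 < CARD('n)\<close> by (auto simp: std.bwd_def std.hi_def std.lo_def)
  with A show ?thesis using assms(1) by (auto simp: AB_mat_def)
qed

lemma AB_mat_mult:
  assumes "\<kappa> \<in> {1, 2}" "k \<le> CARD('n)"
  shows "coords (AB_mat \<kappa> a *v c :: real ^ ('n::{finite,linorder} option)) k =
      barycentric.bwd CARD('n) \<kappa> a (coords c) k"
proof -
  have "coords (AB_mat \<kappa> a *v c) k = (\<Sum>l\<le>CARD('n).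
      (AB_mat \<kappa> a :: 'n sqmat) $ idx k $ idx l * coords c l)"
    by (simp add: coords_def matrix_vector_mult_def sum_idx)
  also have "\<dots> = (\<Sum>l\<le>CARD('n). barycentric.bwd CARD('n) \<kappa> a (\<lambda>j.
      if j = l then 1 else 0) k * coords c l)"
    using assms by (simp add: AB_mat_nth)
  also have "\<dots> = barycentric.bwd CARD('n) \<kappa> a (coords c) k" by (rule sum_bwd_unit[OF assms(2)])
  finally show ?thesis .
qed

lemma AB_mat_inv:
  assumes "\<kappa> \<in> {1, 2}"
  shows "matrix_inv (AB_mat \<kappa> a) *v d = (of_coords (barycentric.fwd CARD('n) \<kappa> a
      (coords d)) :: real ^ ('n::{finite,linorder} option))"
proof -
  have pos: "0 < \<kappa>" using assms by auto
  have inj: "c = 0" if "AB_mat \<kappa> a *v c = 0" for c :: "real ^ ('n option)"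
  proof (rule coords_eqI)
    fix k assume k: "k \<le> CARD('n)"
    have "barycentric.fwd CARD('n) \<kappa> a (barycentric.bwd CARD('n) \<kappa> a (coords c)) k =
        barycentric.fwd CARD('n) \<kappa> a (\<lambda>_. 0) k"
      using AB_mat_mult[OF assms, of _ a c] that k
      by (intro std.fwd_cong) (simp_all add: coords_def)
    then show "coords c k = coords 0 k"
      using std.fwd_bwd[OF pos k] by (simp add: coords_def std.fwd_def)
  qed
  let ?c = "of_coords (barycentric.fwd CARD('n) \<kappa> a (coords d)) :: real ^ ('n option)"
  have "AB_mat \<kappa> a *v ?c = d"
  proof (rule coords_eqI)
    fix k assume k: "k \<le> CARD('n)"
    have "coords (AB_mat \<kappa> a *v ?c) k = barycentric.bwd CARD('n) \<kappa> a (coords ?c) k"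
      by (rule AB_mat_mult[OF assms k])
    also have "\<dots> = barycentric.bwd CARD('n) \<kappa> a (barycentric.fwd CARD('n) \<kappa> a (coords d)) k"
      using k by (intro std.bwd_cong) (simp_all add: coords_of_coords)
    finally show "coords (AB_mat \<kappa> a *v ?c) k = coords d k" using std.bwd_fwd[OF pos k] by simp
  qed
  then show ?thesis using matrix_inv_mult[of "AB_mat \<kappa> a" ?c] inj by simp
qed

lemma proj_point_V_mat: "proj_point (V_mat *v of_coords f) =
    (std.pt f :: real ^ 'n::{finite,linorder})"
proof (rule vec_eq_iff[THEN iffD2, rule_format])
  fix j :: 'n
  have "(V_mat *v of_coords f :: real ^ ('n option)) $ None = (\<Sum>k\<le>CARD('n). f k)"
    unfolding V_mat_mult(1) by (simp add: coords_of_coords)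
  moreover have "(V_mat *v of_coords f :: real ^ ('n option)) $ Some j =
      (\<Sum>k\<le>CARD('n). f k *\<^sub>R vtx k) $ j"
    unfolding V_mat_mult(2) by (simp add: coords_of_coords)
  ultimately show "proj_point (V_mat *v of_coords f) $ j = (std.pt f :: (real, 'n) vec) $ j"
    by (simp add: proj_point_def std.pt_def)
qed

lemma branch_coords:
  assumes "\<kappa> \<in> {1, 2}"
  shows "(V_mat ** matrix_inv (AB_mat \<kappa> a) ** matrix_inv V_mat) *v homog
      (x :: real ^ 'n::{finite,linorder}) =
    V_mat *v of_coords (barycentric.fwd CARD('n) \<kappa> a (bcoord x))"
proof -
  have "(V_mat ** matrix_inv (AB_mat \<kappa> a) ** matrix_inv V_mat) *v homog x =
      V_mat *v (of_coords (barycentric.fwd CARD('n) \<kappa> a (coords (of_coords (bcoord x) :: real ^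
          ('n option)))))"
    by (simp only: matrix_vector_mul_assoc[symmetric] V_mat_inv_homog AB_mat_inv[OF assms])
  also have "of_coords (barycentric.fwd CARD('n) \<kappa> a (coords (of_coords (bcoord x) :: real ^
      ('n option)))) =
      (of_coords (barycentric.fwd CARD('n) \<kappa> a (bcoord x)) :: real ^ ('n option))"
    by (rule coords_eqI) (auto simp: coords_of_coords intro!: std.fwd_cong)
  finally show ?thesis .
qed

section \<open>Identification of the given maps, cylinders and complexes\<close>

lemma M_branch_eq: "M_branch a = (std.branch 1 a :: real ^ 'n::{finite,linorder} \<Rightarrow> _)"
proof
  fix x :: "(real, 'n) vec"
  have "M_mat a *v homog x = V_mat *v of_coords (barycentric.fwd CARD('n) 1 a (bcoord x))"
    using branch_coords[of 1 a x] by (simp add: M_mat_def AB_mat_def)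
  then show "M_branch a x = std.branch 1 a x"
    unfolding M_branch_def std.branch_def by (simp only: proj_point_V_mat)
qed

lemma T_branch_eq: "T_branch a = (std.branch 2 a :: real ^ 'n::{finite,linorder} \<Rightarrow> _)"
proof
  fix x :: "(real, 'n) vec"
  let ?f = "barycentric.fwd CARD('n) 2 a (bcoord x)"
  have T: "T_mat a *v homog x = V_mat *v of_coords ?f"
    using branch_coords[of 2 a x] by (simp add: T_mat_def AB_mat_def)
  \<comment> \<open>The last homogeneous coordinate is the total, which \<open>fwd 2\<close>
    preserves; so the missing normalisation in \<open>T_branch\<close> makes no difference.\<close>
  have "(V_mat *v of_coords ?f :: real ^ ('n option)) $ None = 1"
    unfolding V_mat_mult(1) using std.sum_fwd[where 'n = 'n, of 2 a "bcoord x"] std.bc_sum[of x]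
    by (simp add: coords_of_coords)
  then have "T_branch a x = proj_point (V_mat *v of_coords ?f)"
    by (simp add: T_branch_def T proj_point_def)
  then show "T_branch a x = std.branch 2 a x"
    by (simp only: proj_point_V_mat std.branch_def)
qed

lemma column_points_V_mat: "column_points V_mat =
    (vtx ` {..CARD('n)} :: (real ^ 'n::{finite,linorder}) set)"
proof -
  have "proj_point (column (idx k) V_mat) = (vtx k :: (real, 'n) vec)" if "k \<le> CARD('n)" for k
    using that by (simp add: vec_eq_iff proj_point_def column_def V_mat_None V_mat_Some)
  moreover have "range (\<lambda>j. proj_point (column j V_mat)) =
      (\<lambda>k. proj_point (column (idx k) V_mat) :: (real, 'n) vec) ` {..CARD('n)}"
    by (rule range_idx)
  ultimately show ?thesis unfolding column_points_def by simp
qed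

lemma Delta_eq: "Delta = (std.base_simplex :: (real ^ 'n::{finite,linorder}) set)"
  unfolding Delta_def column_points_V_mat by (rule std.simplex_hull)

lemma Delta_half_eq: "Delta_half a = (std.half a :: (real ^ 'n::{finite,linorder}) set)"
proof -
  have col: "proj_point (column (idx l) (V_mat ** A_mat a)) =
      (std.inv_branch 1 a (vtx l) :: (real, 'n) vec)"
    if l: "l \<le> CARD('n)" for l
  proof -
    let ?u = "barycentric.bwd CARD('n) 1 a (bcoord (vtx l :: (real, 'n) vec))"
    have "column (idx l) (V_mat ** A_mat a) = V_mat *v column (idx l) (A_mat a :: 'n sqmat)"
      by (simp add: vec_eq_iff column_def matrix_matrix_mult_def matrix_vector_mult_def)
    also have "column (idx l) (A_mat a :: 'n sqmat) = of_coords ?u"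
    proof (rule coords_eqI)
      fix k assume k: "k \<le> CARD('n)"
      have "coords (column (idx l) (A_mat a :: 'n sqmat)) k =
          barycentric.bwd CARD('n) 1 a (\<lambda>j. if j = l then 1 else 0) k"
        using AB_mat_nth[where 'n = 'n, of 1 k l a] k l
            by (simp add: coords_def column_def AB_mat_def)
      also have "\<dots> = ?u k"
        using k l std.bc_vertex[where 'n = 'n, of l] by (intro std.bwd_cong) auto
      finally show "coords (column (idx l) (A_mat a :: 'n sqmat)) k =
          coords (of_coords ?u :: real ^ ('n option)) k"
        using k by (simp add: coords_of_coords)
    qed
    finally show ?thesis by (simp only: proj_point_V_mat std.inv_branch_def)
  qed
  have "column_points (V_mat ** A_mat a) =
      (\<lambda>l. proj_point (column (idx l) (V_mat ** A_mat a)) :: (real, 'n) vec) ` {..CARD('n)}"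
    unfolding column_points_def by (rule range_idx)
  also have "\<dots> = std.inv_branch 1 a ` vtx ` {..CARD('n)}"
    unfolding image_image using col by (intro image_cong) auto
  finally show ?thesis
    unfolding Delta_half_def using std.half_hull[where 'n = 'n, of 1 a] by simp
qed

lemma Moenkemeyer_eq: "Moenkemeyer = (std.step_map 1 :: real ^ 'n::{finite,linorder} \<Rightarrow> _)"
  by (simp add: fun_eq_iff Moenkemeyer_def std.step_map_def M_branch_eq Delta_half_eq)

lemma tent_eq: "tent = (std.step_map 2 :: real ^ 'n::{finite,linorder} \<Rightarrow> _)"
  by (simp add: fun_eq_iff tent_def std.step_map_def T_branch_eq Delta_half_eq)

lemma Delta_cyl_eq: "Delta_cyl a = (std.cyl 1 a :: (real ^ 'n::{finite,linorder}) set)"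
  by (simp add: Delta_cyl_def std.cyl_def Moenkemeyer_eq Delta_half_eq Delta_eq)

lemma Gamma_cyl_eq: "Gamma_cyl a = (std.cyl 2 a :: (real ^ 'n::{finite,linorder}) set)"
  by (simp add: Gamma_cyl_def std.cyl_def tent_eq Delta_half_eq Delta_eq)

lemma F_complex_eq: "F_complex t = (std.cells 1 t :: (real ^ 'n::{finite,linorder}) set set)"
  by (simp add: F_complex_def std.cells_def Delta_cyl_eq)

lemma B_complex_eq: "B_complex t = (std.cells 2 t :: (real ^ 'n::{finite,linorder}) set set)"
  by (simp add: B_complex_def std.cells_def Gamma_cyl_eq)

lemma Phi_eq: "Phi = (std.conjugacy 1 2 :: real ^ 'n::{finite,linorder} \<Rightarrow> _)"
proof -
  have "phi = (std.point_of 1 :: _ \<Rightarrow> (real, 'n) vec)"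
      "upsilon = (std.point_of 2 :: _ \<Rightarrow> (real, 'n) vec)"
    by (simp_all add: fun_eq_iff phi_def upsilon_def std.point_of_def std.prefix_word_def
        Delta_cyl_eq Gamma_cyl_eq)
  then show ?thesis by (simp add: fun_eq_iff Phi_def std.conjugacy_def)
qed

lemma canonical_iso_eq:
  "canonical_iso t = restrict ((`) Phi) (F_complex t :: (real ^ 'n::{finite,linorder}) set set)"
  unfolding canonical_iso_def
proof (rule the_equality)
  have \<kappa>: "(1::real) \<in> {1, 2}" "(2::real) \<in> {1, 2}" by auto
  let ?h = "restrict ((`) Phi) (F_complex t :: (real, 'n) vec set set)"
  \<comment> \<open>\<open>?h\<close> is \<open>undefined\<close> off the complex, so the vertices
    it should fix must first be shown to be cells at depth \<open>t\<close>.\<close>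
  have vertex: "{vtx k :: (real, 'n) vec} \<in> F_complex t" if k: "k \<le> CARD('n)" for k
  proof -
    obtain a where a: "length a = t" "(vtx k :: (real, 'n) vec) \<in> std.cyl 1 a"
      using std.cyl_exists[of 1 "vtx k :: (real, 'n) vec" t] std.vertex_in_simplex[OF k] by auto
    have "{vtx k :: (real, 'n) vec} face_of std.base_simplex"
      unfolding std.face_simplex_iff using k std.Face_singleton[where 'n = 'n, OF k]
      by (intro exI[of _ "{k}"]) simp
    then have "{vtx k :: (real, 'n) vec} face_of std.cyl 1 a"
      by (rule face_of_subset) (use a(2) std.cyl_simplex in blast)+
    then show ?thesis using a(1) by (auto simp: F_complex_eq std.cells_def)
  qed
  have "bij_betw ?h (F_complex t) (B_complex t)"
    using std.conjugacy_bij_cells[OF \<kappa>, of t] unfolding F_complex_eq B_complex_eq Phi_eq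
    by (subst bij_betw_cong[where g = "(`) (std.conjugacy 1 2)"]) auto
  moreover have "S face_of S' \<longleftrightarrow> ?h S face_of ?h S'"
    if "S \<in> F_complex t" "S' \<in> F_complex t" for S S'
    using std.conjugacy_face_of_iff[OF \<kappa>, of S t S'] that by (simp add: F_complex_eq Phi_eq)
  moreover have "?h {vtx k} = {vtx k}" if "k \<le> CARD('n)" for k
    using vertex[OF that] std.conjugacy_vertex[OF \<kappa> that] by (simp add: Phi_eq)
  ultimately show "?h \<in> extensional (F_complex t) \<and>
      combinatorial_iso (F_complex t) (B_complex t) ?h \<and>
      (\<forall>v \<in> column_points V_mat. ?h {v} = {v})"
    unfolding combinatorial_iso_def column_points_V_mat by auto
next
  fix h :: "(real, 'n) vec set \<Rightarrow> (real, 'n) vec set"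
  assume h: "h \<in> extensional (F_complex t) \<and> combinatorial_iso (F_complex t) (B_complex t) h \<and>
      (\<forall>v \<in> column_points V_mat. h {v} = {v})"
  have "h S = Phi ` S" if "S \<in> F_complex t" for S
    using h that std.cells_iso_unique[of h t S]
    unfolding combinatorial_iso_def column_points_V_mat F_complex_eq B_complex_eq Phi_eq by auto
  then show "h = restrict ((`) Phi) (F_complex t)"
    using h by (intro extensionalityI[where A = "F_complex t"]) auto
qed

theorem proposition3p1:
  fixes t :: nat
  shows "(\<forall>Xi \<in> (F_complex t :: (real ^ 'n::{finite,linorder}) set set).
            \<exists>g. homeomorphism Xi (canonical_iso t Xi) Phi g) \<and>
         (\<forall>a. length a = t \<longrightarrow>
            (\<forall>p \<in> (Delta :: (real ^ 'n::{finite,linorder}) set).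
               Phi p = (T_word a \<circ> restrict Phi (Delta_cyl a)
                          \<circ> inv_into (Delta_cyl a) (M_word a)) p))"
proof (intro conjI ballI allI impI)
  fix Xi :: "(real, 'n) vec set"
  assume "Xi \<in> F_complex t"
  then show "\<exists>g. homeomorphism Xi (canonical_iso t Xi) Phi g"
    using std.conjugacy_homeomorphism[of Xi t] by (simp add: canonical_iso_eq F_complex_eq Phi_eq)
next
  fix a and p :: "(real, 'n) vec"
  assume "p \<in> Delta"
  moreover have "M_word a = restrict (std.branch_word 1 a) (std.cyl 1 a :: (real, 'n) vec set)"
    "T_word a = restrict (std.branch_word 2 a) (std.cyl 2 a :: (real, 'n) vec set)"
    by (simp_all add: M_word_def T_word_def M_branch_eq T_branch_eq std.fold_branch Delta_cyl_eq
        Gamma_cyl_eq)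
  ultimately show "Phi p = (T_word a \<circ> restrict Phi (Delta_cyl a) \<circ> inv_into (Delta_cyl a)
      (M_word a)) p"
    using std.conjugacy_functional_equation[of p a] by (simp only: Delta_eq Phi_eq Delta_cyl_eq)
qed

end
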